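(* Let $\pi$ be a permutation of $q\ge2$ symbols, consider the aperiodic Cantor system $(I_{np}^*, F^*_\pi)$ of the rotated odometer $F_\pi$, and let $\mathcal{A}=\{0,1,\ldots,q-1\}$. There exist a sequence $(\chi_k)_{k \geq 1}$ of substitutions $\chi_k: \mathcal{A} \to \mathcal{A}^*$, $i \mapsto \chi_k(i)$, and an ordered Bratteli diagram $(V,E,<)$ with the following properties: (1) The sequence $(\chi_k)_{k \geq 1}$ is pre-periodic, i.e. there exist $k_0,p_0\ge1$ such that $\chi_k=\chi_{k+p_0}$ for all $k\ge k_0$. (2) The set $V_0 = \{v_0\}$ is a singleton, and for $k \geq 1$ the vertex set $V_k$ is identified with a non-empty subset of $\mathcal{A}$. (3) For $k\ge1$, the edge set $E_k$ and the order on the set of incoming edges of each $i \in V_{k+1}$ are determined by the substitution $\chi_k$: there is an edge from $j\in V_k$ to $i\in V_{k+1}$ for each appearance of the letter $j$ in $\chi_k(i)$, and the edges incoming to $i$ are ordered as the corresponding letters in the word $\chi_k(i)$. (4) The path space $X_{(V,E,<)}$ of $(V,E,<)$ has a unique maximal and a unique minimal path, and the Vershik map $\tau: X_{(V,E,<)} \to X_{(V,E,<)}$ is a homeomorphism. (5) There is a homeomorphism $\psi: I_{np}^* \to X_{(V,E,<)}$ such that $\psi \circ F^*_\pi = \tau \circ \psi$.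
   Context: Rotated odometer: let $I=[0,1)$. The von Neumann–Kakutani map $\mathfrak a: I\to I$ is $\mathfrak a(x)=x-(1-3\cdot 2^{-n})$ for $x\in[1-2^{1-n},1-2^{-n})$, $n\ge 1$. For a permutation $\pi$ of $\{0,\dots,q-1\}$, $R_\pi:I\to I$ maps each $[\frac iq,\frac{i+1}q)$ by a translation onto $[\frac{\pi(i)}q,\frac{\pi(i)+1}q)$, and $F_\pi=\mathfrak a\circ R_\pi$. $I_{per}$ is the set of $F_\pi$-periodic points in $I$, $I_{np}=I\setminus I_{per}$. The map $F_\pi$ is injective and its range is $(0,1)$. Compactification: let $D_0\subset I$ consist of $0$, the points $R_\pi^{-1}(1-2^{-n})$, $n\ge0$, and all discontinuity points of $F_\pi$. Let $D$ be the union of the forward orbits of the points of $D_0$ and the backward orbits of the points of $D_0\setminus\{0\}$ under $F_\pi$. For each $x\in D\setminus\{0\}$ add a new point $x^-$; write $x^+:=x$ for $x\in D$, and $1^-:=1$. Set $I^*=I\cup\{x^-:x\in D\setminus\{0\}\}\cup\{1\}$, ordered by extending the order of $[0,1]$ so that $x^-$ is the immediate predecessor of $x^+$, and give $I^*$ the order topology. Let $\widehat x=\lim_{y\nearrow1}R_\pi^{-1}(y)\in(0,1]$. Define $F_\pi^*:I^*\to I^*$ by $F_\pi^*=F_\pi$ on $I$, $F_\pi^*(\widehat x^-)=0$, and $F^*_\pi(z^-)=\lim_{y\nearrow z}F_\pi(y)$ (limit in $I^*$) for all other added points $z^-$, $z\in (D\setminus\{0\})\cup\{1\}$. Let $I_{per}^*$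 be the union of all order intervals $[x^+,y^-]\subset I^*$ with $x\in D$, $y\in D\cup\{1\}$, $[x,y)\subset I_{per}$, and $I_{np}^*=I^*\setminus I_{per}^*$. Substitutions and Bratteli diagrams: $\mathcal A^*$ is the set of finite words over $\mathcal A$; a substitution assigns to each letter a word. A Bratteli diagram $(V,E)$ is an infinite graph with finite vertex sets $V_k$, $k\ge0$, $V_0=\{v_0\}$, and finite edge sets $E_k$, $k\ge0$, each $e\in E_k$ joining its source $\boldsymbol s(e)\in V_k$ to its target $\boldsymbol t(e)\in V_{k+1}$; every vertex of $V_1$ is joined to $v_0$ by a single edge, every vertex in $V_k$, $k\ge1$, has at least one outgoing edge in $E_k$ and every vertex in $V_{k+1}$ has at least one incoming edge in $E_k$. It is ordered if for every vertex the set of incoming edges carries a total order. The path space $X_{(V,E,<)}$ is the set of infinite sequences $(e_k)_{k\ge0}$, $e_k\in E_k$, $\boldsymbol t(e_k)=\boldsymbol s(e_{k+1})$, with the product topology of the discrete topologies. A path is minimal (maximal) if all of its edges are minimal (maximal) among the edges with the same target. If $e=(e_k)$ is not maximal, let $k$ be the smallest index such that $e_k$ is not maximal; then $\tau(e)_j=e_j$ for $j>k$, $\tau(e)_k$ is the successor of $e_k$ among edges with the same target, and $\tau(e)_0\dots\tau(e)_{k-1}$ is the minimal path from $v_0$ to $\boldsymbol s(\tau(e)_k)$. The unique maximal path is mapped by $\tau$ to the unique minimal path. *)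

theory Defs
  imports "HOL-Analysis.Analysis"
begin

section \<open>Rotated odometers\<close>

text \<open>All maps of the half-open interval \<open>I = {0..<1}\<close> are total functions on the reals; their
  values outside \<open>I\<close> are irrelevant.\<close>

definition odometer :: "real \<Rightarrow> real" where
  "odometer x =
    (let n = (THE n::nat. 1 \<le> n \<and> x \<in> {1 - 2 / 2 ^ n ..< 1 - 1 / 2 ^ n}) in x - (1 - 3 / 2 ^ n))"

text \<open>\<open>x\<close> lies in \<open>[i/q, (i+1)/q)\<close> for \<open>i = \<lfloor>q x\<rfloor>\<close>.\<close>

definition rotation :: "nat \<Rightarrow> (nat \<Rightarrow> nat) \<Rightarrow> real \<Rightarrow> real" where
  "rotation q \<pi> x =
    (let i = nat \<lfloor>real q * x\<rfloor> in x - real i / real q + real (\<pi> i) / real q)"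

definition rotation_inv :: "nat \<Rightarrow> (nat \<Rightarrow> nat) \<Rightarrow> real \<Rightarrow> real" where
  "rotation_inv q \<pi> = inv_into {0..<1} (rotation q \<pi>)"

definition rot_odometer :: "nat \<Rightarrow> (nat \<Rightarrow> nat) \<Rightarrow> real \<Rightarrow> real" where
  "rot_odometer q \<pi> = odometer \<circ> rotation q \<pi>"

definition I_per :: "nat \<Rightarrow> (nat \<Rightarrow> nat) \<Rightarrow> real set" where
  "I_per q \<pi> = {x \<in> {0..<1}. \<exists>n\<ge>1. (rot_odometer q \<pi> ^^ n) x = x}"


section \<open>The compactification\<close>

definition D0 :: "nat \<Rightarrow> (nat \<Rightarrow> nat) \<Rightarrow> real set" where
  "D0 q \<pi> = {0} \<union> range (\<lambda>n::nat. rotation_inv q \<pi> (1 - 1 / 2 ^ n))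
     \<union> {x \<in> {0..<1}. \<not> continuous (at x within {0..<1}) (rot_odometer q \<pi>)}"

definition D :: "nat \<Rightarrow> (nat \<Rightarrow> nat) \<Rightarrow> real set" where
  "D q \<pi> = {(rot_odometer q \<pi> ^^ n) x | n x. x \<in> D0 q \<pi>}
     \<union> {y \<in> {0..<1}. \<exists>n. (rot_odometer q \<pi> ^^ n) y \<in> D0 q \<pi> - {0}}"

text \<open>\<open>At x\<close> is the point \<open>x\<close> of \<open>I\<close> (which is also \<open>x\<^sup>+\<close> if \<open>x \<in> D\<close>), and \<open>Minus x\<close> is \<open>x\<^sup>-\<close>.
  By the convention \<open>1\<^sup>- = 1\<close>, the added endpoint \<open>1\<close> is \<open>Minus 1\<close>.\<close>

datatype point = At real | Minus real

primrec base :: "point \<Rightarrow> real" where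
  "base (At x) = x"
| "base (Minus x) = x"

primrec side :: "point \<Rightarrow> nat" where
  "side (Minus x) = 0"
| "side (At x) = 1"

instantiation point :: linorder
begin

definition less_eq_point :: "point \<Rightarrow> point \<Rightarrow> bool" where
  "p \<le> r \<longleftrightarrow> base p < base r \<or> base p = base r \<and> side p \<le> side r"

definition less_point :: "point \<Rightarrow> point \<Rightarrow> bool" where
  "p < r \<longleftrightarrow> base p < base r \<or> base p = base r \<and> side p < side r"

instance
proof
  fix p r :: point
  assume "p \<le> r" "r \<le> p"
  then show "p = r"
    by (cases p; cases r) (auto simp: less_eq_point_def)
qed (auto simp: less_eq_point_def less_point_def)

end

definition I_star :: "nat \<Rightarrow> (nat \<Rightarrow> nat) \<Rightarrow> point set" where
  "I_star q \<pi> = At ` {0..<1} \<union> Minus ` (D q \<pi> - {0}) \<union> {Minus 1}"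

text \<open>The order topology of the ordered set \<open>X\<close> itself. It can be strictly coarser than the
  topology induced on \<open>X\<close> by the order topology of the ambient type, because only rays with
  endpoint in \<open>X\<close> are used.\<close>

definition order_topology_on :: "'a::linorder set \<Rightarrow> 'a topology" where
  "order_topology_on X = topology_generated_by
     ({X} \<union> {{y \<in> X. y < a} | a. a \<in> X} \<union> {{y \<in> X. a < y} | a. a \<in> X})"

definition x_hat :: "nat \<Rightarrow> (nat \<Rightarrow> nat) \<Rightarrow> real" where
  "x_hat q \<pi> = Lim (at_left 1) (rotation_inv q \<pi>)"

fun F_star :: "nat \<Rightarrow> (nat \<Rightarrow> nat) \<Rightarrow> point \<Rightarrow> point" where
  "F_star q \<pi> (At x) = At (rot_odometer q \<pi> x)"
| "F_star q \<pi> (Minus z) =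
     (if z = x_hat q \<pi> then At 0
      else (THE l. limitin (order_topology_on (I_star q \<pi>))
                     (\<lambda>y. At (rot_odometer q \<pi> y)) l (at_left z)))"

definition I_per_star :: "nat \<Rightarrow> (nat \<Rightarrow> nat) \<Rightarrow> point set" where
  "I_per_star q \<pi> =
     \<Union> {{p \<in> I_star q \<pi>. At x \<le> p \<and> p \<le> Minus y} | x y.
         x \<in> D q \<pi> \<and> y \<in> D q \<pi> \<union> {1} \<and> {x..<y} \<subseteq> I_per q \<pi>}"

definition I_np_star :: "nat \<Rightarrow> (nat \<Rightarrow> nat) \<Rightarrow> point set" where
  "I_np_star q \<pi> = I_star q \<pi> - I_per_star q \<pi>"

definition I_np_star_topology :: "nat \<Rightarrow> (nat \<Rightarrow> nat) \<Rightarrow> point topology" where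
  "I_np_star_topology q \<pi> = subtopology (order_topology_on (I_star q \<pi>)) (I_np_star q \<pi>)"


section \<open>Ordered Bratteli diagrams\<close>

text \<open>Vertices and edges are indexed by their level, so \<open>vertices B k\<close> for different \<open>k\<close> are
  regarded as disjoint even if they overlap as sets, and likewise for edges. The reflexive linear
  order on the edges of level \<open>k\<close> entering \<open>v\<close> is \<open>edge_order B k v\<close>.\<close>

record ('v, 'e) bratteli =
  vertices :: "nat \<Rightarrow> 'v set"
  edges :: "nat \<Rightarrow> 'e set"
  source :: "nat \<Rightarrow> 'e \<Rightarrow> 'v"
  target :: "nat \<Rightarrow> 'e \<Rightarrow> 'v"
  edge_order :: "nat \<Rightarrow> 'v \<Rightarrow> 'e rel"

definition incoming :: "('v, 'e) bratteli \<Rightarrow> nat \<Rightarrow> 'v \<Rightarrow> 'e set" where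
  "incoming B k v = {e \<in> edges B k. target B k e = v}"

definition bratteli_diagram :: "('v, 'e) bratteli \<Rightarrow> bool" where
  "bratteli_diagram B \<longleftrightarrow>
     (\<forall>k. finite (vertices B k) \<and> finite (edges B k)) \<and>
     (\<exists>v0. vertices B 0 = {v0}) \<and>
     (\<forall>k. \<forall>e\<in>edges B k. source B k e \<in> vertices B k \<and> target B k e \<in> vertices B (Suc k)) \<and>
     (\<forall>v\<in>vertices B 1. \<exists>!e. e \<in> incoming B 0 v) \<and>
     (\<forall>k\<ge>1. \<forall>v\<in>vertices B k. \<exists>e\<in>edges B k. source B k e = v) \<and>
     (\<forall>k. \<forall>v\<in>vertices B (Suc k). incoming B k v \<noteq> {})"

definition ordered_bratteli_diagram :: "('v, 'e) bratteli \<Rightarrow> bool" where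
  "ordered_bratteli_diagram B \<longleftrightarrow> bratteli_diagram B \<and>
     (\<forall>k. \<forall>v\<in>vertices B (Suc k). linear_order_on (incoming B k v) (edge_order B k v))"

definition path_space :: "('v, 'e) bratteli \<Rightarrow> (nat \<Rightarrow> 'e) set" where
  "path_space B =
     {e. \<forall>k. e k \<in> edges B k \<and> target B k (e k) = source B (Suc k) (e (Suc k))}"

definition path_topology :: "('v, 'e) bratteli \<Rightarrow> (nat \<Rightarrow> 'e) topology" where
  "path_topology B =
     subtopology (product_topology (\<lambda>k. discrete_topology (edges B k)) UNIV) (path_space B)"

definition min_edge :: "('v, 'e) bratteli \<Rightarrow> nat \<Rightarrow> 'e \<Rightarrow> bool" where
  "min_edge B k e \<longleftrightarrow>
     (\<forall>e'\<in>incoming B k (target B k e). (e, e') \<in> edge_order B k (target B k e))"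

definition max_edge :: "('v, 'e) bratteli \<Rightarrow> nat \<Rightarrow> 'e \<Rightarrow> bool" where
  "max_edge B k e \<longleftrightarrow>
     (\<forall>e'\<in>incoming B k (target B k e). (e', e) \<in> edge_order B k (target B k e))"

definition is_succ_edge :: "('v, 'e) bratteli \<Rightarrow> nat \<Rightarrow> 'e \<Rightarrow> 'e \<Rightarrow> bool" where
  "is_succ_edge B k e e' \<longleftrightarrow>
     (let v = target B k e; r = edge_order B k v in
        e' \<in> incoming B k v \<and> e' \<noteq> e \<and> (e, e') \<in> r \<and>
        (\<forall>e''\<in>incoming B k v. e'' \<noteq> e \<and> (e, e'') \<in> r \<longrightarrow> (e', e'') \<in> r))"

definition minimal_path :: "('v, 'e) bratteli \<Rightarrow> (nat \<Rightarrow> 'e) \<Rightarrow> bool" where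
  "minimal_path B e \<longleftrightarrow> e \<in> path_space B \<and> (\<forall>k. min_edge B k (e k))"

definition maximal_path :: "('v, 'e) bratteli \<Rightarrow> (nat \<Rightarrow> 'e) \<Rightarrow> bool" where
  "maximal_path B e \<longleftrightarrow> e \<in> path_space B \<and> (\<forall>k. max_edge B k (e k))"

definition vershik :: "('v, 'e) bratteli \<Rightarrow> (nat \<Rightarrow> 'e) \<Rightarrow> (nat \<Rightarrow> 'e)" where
  "vershik B e =
     (if maximal_path B e then (THE f. minimal_path B f)
      else let k = (LEAST k. \<not> max_edge B k (e k)) in
        (THE f. f \<in> path_space B \<and> (\<forall>j>k. f j = e j) \<and> is_succ_edge B k (e k) (f k) \<and>
                (\<forall>j<k. min_edge B j (f j))))"


section \<open>Substitutions\<close>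

definition substitution :: "'a set \<Rightarrow> ('a \<Rightarrow> 'a list) \<Rightarrow> bool" where
  "substitution A chi \<longleftrightarrow> (\<forall>i\<in>A. chi i \<in> lists A)"

text \<open>The edges of level \<open>k\<close> entering \<open>i\<close>, enumerated in increasing order as
  \<open>f 0, f 1, \<dots>\<close>, start at the successive letters of the word \<open>w\<close>.\<close>

definition incoming_reads :: "('v, 'e) bratteli \<Rightarrow> nat \<Rightarrow> 'v \<Rightarrow> 'v list \<Rightarrow> bool" where
  "incoming_reads B k i w \<longleftrightarrow>
     (\<exists>f. bij_betw f {..<length w} (incoming B k i) \<and>
          (\<forall>m<length w. source B k (f m) = w ! m) \<and>
          (\<forall>m n. m \<le> n \<and> n < length w \<longrightarrow> (f m, f n) \<in> edge_order B k i))"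

end

theory Submission
  imports Defs
begin

text \<open>The odometer is self-similar: on the right half of the interval it is
  \<open>a(x) = a(2 x - 1) / 2\<close>, while on the left half it is the translation onto the right half. Cut the
  interval into \<open>q 2\<^sup>k\<close> equal cells of level \<open>k\<close>. Then \<open>F\<close> permutes the cells by a permutation \<open>sig k\<close>,
  as translations, except that cells sent into \<open>[0, 2\<^sup>-\<^sup>k)\<close> are there followed by a scaled copy of the
  odometer. Therefore the first return map to \<open>[0, 2\<^sup>-\<^sup>k)\<close> is, after scaling, again a rotated
  odometer, for the permutation \<open>rho k\<close> of the \<open>q\<close> base cells induced by \<open>sig k\<close>. The cells split into
  towers over the base cells and cycles avoiding them; cycles consist of periodic points. A tower of
  level \<open>k + 1\<close> is a stack of towers of level \<open>k\<close>, and the list of their names is a word that depends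
  on \<open>rho k\<close> only. As \<open>rho (k + 1)\<close> is a function of \<open>rho k\<close>, these words are pre-periodic in \<open>k\<close>.

  The cells themselves are too fine. An endpoint \<open>i/q\<close> need not lie in \<open>D\<close> (take the identity
  permutation and \<open>q = 3\<close>), and then it is not split in the compactification, whereas the path space of
  the words above would split it. So neighbouring base cells are merged into blocks, which begin at
  marked cells. A base cell of level \<open>k + 1\<close> stays unmarked only if it and its left neighbour visit the same
  blocks of level \<open>k\<close> side by side until they return. This makes \<open>marks (k + 1)\<close> a function of \<open>rho k\<close>
  and \<open>marks k\<close>, so pre-periodicity survives the merging. Two facts show that the marks are the right
  ones: left endpoints of marked cells belong to \<open>D\<close> (\<open>marks_D\<close>), and conversely a point of
  \<open>D\<close> is not interior to any block floor from some level on (\<open>eventually_cut_D\<close>).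
  Consequently the sets of points with a given address (block and floor) are open and separate
  points, and they form a basis (\<open>openin_NP_iff\<close>).

  The vertices are the blocks that contain an aperiodic real. A path is a nested sequence of block
  floors, each with an aperiodic real in it. These reals converge, and their limit, taken on
  the correct side, is the point with that path (\<open>padr_realize\<close>). Moving up one floor is what the
  Vershik map does to a path. Uniqueness of the extreme paths is a contraction: a bottom floor
  of level \<open>k + q\<close> lies in the first cell of level \<open>k\<close>, and \<open>sig k\<close> sends the level-\<open>k\<close> cell of a top
  floor of level \<open>k + q\<close> to the cell \<open>q - 1\<close>.

  What does not concern numbers is isolated in the locale \<open>tower_coding\<close>: a system with such
  addresses is conjugate to the Vershik map of the diagram of its words.\<close>

section \<open>Stacks of towers\<close>

text \<open>The height at which the \<open>m\<close>-th storey begins when storeys of heights \<open>xs\<close> are stacked.\<close>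

definition offset :: "nat list \<Rightarrow> nat \<Rightarrow> nat" where
  "offset xs m = sum_list (take m xs)"

lemma offset_0 [simp]: "offset xs 0 = 0"
  by (simp add: offset_def)

lemma offset_Suc: "m < length xs \<Longrightarrow> offset xs (Suc m) = offset xs m + xs ! m"
  by (simp add: offset_def take_Suc_conv_app_nth)

lemma offset_length: "offset xs (length xs) = sum_list xs"
  by (simp add: offset_def)

lemma offset_mono: "m \<le> m' \<Longrightarrow> offset xs m \<le> offset xs m'"
proof -
  assume "m \<le> m'"
  then obtain d where "m' = m + d" using le_Suc_ex by blast
  then show ?thesis by (simp add: offset_def take_add)
qed

lemma offset_add_less:
  assumes "m < length xs" "s < xs ! m" "m < m'"
  shows "offset xs m + s < offset xs m'"
proof -
  have "offset xs m + s < offset xs (Suc m)" using assms offset_Suc by simp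
  also have "\<dots> \<le> offset xs m'" using assms by (intro offset_mono) simp
  finally show ?thesis .
qed

lemma offset_unique:
  assumes "m < length xs" "s < xs ! m" "m' < length xs" "s' < xs ! m'"
    and eq: "offset xs m + s = offset xs m' + s'"
  shows "m = m' \<and> s = s'"
proof -
  have "\<not> m < m'" using offset_add_less[OF assms(1,2)] eq by (metis add_leD1 le_add1 linorder_not_le)
  moreover have "\<not> m' < m" using offset_add_less[OF assms(3,4)] eq by (metis add_leD1 le_add1 linorder_not_le)
  ultimately show ?thesis using eq by auto
qed

lemma offset_exists:
  assumes "s < sum_list xs"
  shows "\<exists>m<length xs. \<exists>r<xs ! m. s = offset xs m + r"
  using assms
proof (induction xs arbitrary: s)
  case (Cons a xs)
  show ?case
  proof (cases "s < a")
    case True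
    then show ?thesis by (intro exI[of _ 0]) auto
  next
    case False
    then have "s - a < sum_list xs" using Cons.prems by simp
    then obtain m r where "m < length xs" "r < xs ! m" "s - a = offset xs m + r"
      using Cons.IH[of "s - a"] by blast
    then show ?thesis using False
      by (intro exI[of _ "Suc m"]) (auto simp: offset_def)
  qed
qed simp

section \<open>Ordered Bratteli diagrams of words\<close>

text \<open>An edge of level \<open>k\<close> is a letter occurrence: the pair \<open>(i, m)\<close> stands for the
  position \<open>m\<close> in the word of \<open>i\<close>. Giving the level \<open>0\<close> the one-letter words \<open>[v\<^sub>0]\<close> lets the edges
  leaving the root be treated like all others.\<close>

definition word_diagram :: "(nat \<Rightarrow> nat set) \<Rightarrow> (nat \<Rightarrow> nat \<Rightarrow> nat list) \<Rightarrow> (nat, nat \<times> nat) bratteli" where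
  "word_diagram V chi = \<lparr> vertices = V,
     edges = (\<lambda>k. {(i, m). i \<in> V (Suc k) \<and> m < length (chi k i)}),
     source = (\<lambda>k e. chi k (fst e) ! snd e),
     target = (\<lambda>k e. fst e),
     edge_order = (\<lambda>k v. {((v, m), (v, m')) | m m'. m \<le> m' \<and> m' < length (chi k v)}) \<rparr>"

lemma word_diagram_sel [simp]:
  "vertices (word_diagram V chi) = V"
  "edges (word_diagram V chi) k = {(i, m). i \<in> V (Suc k) \<and> m < length (chi k i)}"
  "source (word_diagram V chi) k e = chi k (fst e) ! snd e"
  "target (word_diagram V chi) k e = fst e"
  "edge_order (word_diagram V chi) k v = {((v, m), (v, m')) | m m'. m \<le> m' \<and> m' < length (chi k v)}"
  by (simp_all add: word_diagram_def)

lemma incoming_word_diagram: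
  "v \<in> V (Suc k) \<Longrightarrow> incoming (word_diagram V chi) k v = {(v, m) | m. m < length (chi k v)}"
  by (auto simp: incoming_def)

lemma min_edge_word_diagram:
  assumes "v \<in> V (Suc k)" "m < length (chi k v)"
  shows "min_edge (word_diagram V chi) k (v, m) \<longleftrightarrow> m = 0"
proof -
  have "0 < length (chi k v)" using assms(2) by (rule order.strict_trans1[rotated]) simp
  then show ?thesis using assms by (auto simp: min_edge_def incoming_word_diagram)
qed

lemma max_edge_word_diagram:
  assumes "v \<in> V (Suc k)" "m < length (chi k v)"
  shows "max_edge (word_diagram V chi) k (v, m) \<longleftrightarrow> Suc m = length (chi k v)"
proof -
  have "max_edge (word_diagram V chi) k (v, m) \<longleftrightarrow> (\<forall>m'<length (chi k v). m' \<le> m)"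
    using assms by (auto simp: max_edge_def incoming_word_diagram)
  also have "\<dots> \<longleftrightarrow> Suc m = length (chi k v)"
    using assms(2) by (metis Suc_lessI Suc_n_not_le_n less_Suc_eq_le)
  finally show ?thesis .
qed

lemma is_succ_edge_word_diagram:
  assumes "v \<in> V (Suc k)" "m < length (chi k v)"
  shows "is_succ_edge (word_diagram V chi) k (v, m) f \<longleftrightarrow> f = (v, Suc m) \<and> Suc m < length (chi k v)"
proof
  assume a: "is_succ_edge (word_diagram V chi) k (v, m) f"
  then obtain m' where m': "f = (v, m')" "m' < length (chi k v)" "m \<le> m'" "m' \<noteq> m"
    using assms by (auto simp: is_succ_edge_def incoming_word_diagram Let_def)
  then have l: "Suc m < length (chi k v)" by linarith
  have "((v, m'), (v, Suc m)) \<in> edge_order (word_diagram V chi) k v"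
    using a assms l m'(1) unfolding is_succ_edge_def Let_def
    by (auto simp: incoming_word_diagram)
  then show "f = (v, Suc m) \<and> Suc m < length (chi k v)" using m' l by auto
qed (use assms in \<open>auto simp: is_succ_edge_def incoming_word_diagram Let_def\<close>)

lemma linear_order_on_word_diagram:
  assumes "v \<in> V (Suc k)"
  shows "linear_order_on (incoming (word_diagram V chi) k v) (edge_order (word_diagram V chi) k v)"
  unfolding incoming_word_diagram[of v V, OF assms]
  by (auto simp: linear_order_on_def partial_order_on_def preorder_on_def refl_on_def trans_def
      antisym_def total_on_def)

lemma incoming_reads_word_diagram:
  assumes "v \<in> V (Suc k)"
  shows "incoming_reads (word_diagram V chi) k v (chi k v)"
  unfolding incoming_reads_def
proof (intro exI[of _ "\<lambda>m. (v, m)"] conjI allI impI)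
  show "bij_betw (Pair v) {..<length (chi k v)} (incoming (word_diagram V chi) k v)"
    unfolding incoming_word_diagram[of v V, OF assms] by (auto simp: bij_betw_def inj_on_def)
qed auto

text \<open>Every product neighbourhood restricts only finitely many edges, so the cylinders of
  initial segments form a basis.\<close>

lemma openin_path_topology_iff:
  "openin (path_topology B) W \<longleftrightarrow> W \<subseteq> path_space B \<and>
     (\<forall>e\<in>W. \<exists>n. \<forall>e'\<in>path_space B. (\<forall>j<n. e' j = e j) \<longrightarrow> e' \<in> W)"
proof -
  let ?P = "product_topology (\<lambda>k. discrete_topology (edges B k)) UNIV"
  have sub: "path_space B \<subseteq> Pi\<^sub>E UNIV (edges B)" by (auto simp: path_space_def)
  show ?thesis
  proof (intro iffI conjI ballI)
    assume o: "openin (path_topology B) W"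
    then obtain S where S: "openin ?P S" "W = S \<inter> path_space B"
      by (auto simp: path_topology_def openin_subtopology)
    then show "W \<subseteq> path_space B" by auto
    fix e assume "e \<in> W"
    then have "e \<in> S" using S by auto
    then obtain U where U: "finite {i. U i \<noteq> edges B i}" "e \<in> Pi\<^sub>E UNIV U" "Pi\<^sub>E UNIV U \<subseteq> S"
      using S(1) unfolding openin_product_topology_alt by (auto dest!: bspec)
    then obtain n where n: "\<forall>i\<in>{i. U i \<noteq> edges B i}. i < n"
      by (metis finite_nat_set_iff_bounded)
    have "e' \<in> W" if e': "e' \<in> path_space B" "\<forall>j<n. e' j = e j" for e'
    proof -
      have "e' i \<in> U i" for i
      proof (cases "i < n")
        case True
        then show ?thesis using e' U(2) by (simp add: PiE_iff)
      next
        case False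
        then have "U i = edges B i" using n by auto
        then show ?thesis using e'(1) by (simp add: path_space_def)
      qed
      then show ?thesis using U(3) S(2) e'(1) by (auto simp: PiE_iff)
    qed
    then show "\<exists>n. \<forall>e'\<in>path_space B. (\<forall>j<n. e' j = e j) \<longrightarrow> e' \<in> W" by blast
  next
    assume a: "W \<subseteq> path_space B \<and>
      (\<forall>e\<in>W. \<exists>n. \<forall>e'\<in>path_space B. (\<forall>j<n. e' j = e j) \<longrightarrow> e' \<in> W)"
    then obtain N where N: "\<And>e e'. \<lbrakk>e \<in> W; e' \<in> path_space B; \<forall>j<N e. e' j = e j\<rbrakk> \<Longrightarrow> e' \<in> W"
      by metis
    define C where "C e = Pi\<^sub>E UNIV (\<lambda>j. if j < N e then {e j} else edges B j)" for e
    have oC: "openin ?P (C e)" if "e \<in> W" for e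
      unfolding C_def
    proof (rule iffD2[OF openin_PiE_gen], intro disjI2 conjI ballI)
      show "finite {i \<in> UNIV. (if i < N e then {e i} else edges B i) \<noteq> topspace (discrete_topology (edges B i))}"
        by (rule finite_subset[of _ "{..<N e}"]) (auto split: if_splits)
      fix i show "openin (discrete_topology (edges B i)) (if i < N e then {e i} else edges B i)"
        using a that sub by (auto simp: path_space_def)
    qed
    have "W = (\<Union>e\<in>W. C e) \<inter> path_space B"
    proof (intro equalityI subsetI)
      fix e assume "e \<in> W"
      then have "e \<in> C e" using a sub by (auto simp: C_def PiE_iff)
      then show "e \<in> (\<Union>e\<in>W. C e) \<inter> path_space B" using \<open>e \<in> W\<close> a by auto
    next
      fix e' assume e': "e' \<in> (\<Union>e\<in>W. C e) \<inter> path_space B"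
      then obtain e where e: "e \<in> W" "e' \<in> C e" by auto
      have "\<forall>j<N e. e' j = e j"
      proof (intro allI impI)
        fix j assume "j < N e"
        moreover have "e' j \<in> (if j < N e then {e j} else edges B j)"
          using e(2) by (simp add: C_def PiE_iff)
        ultimately show "e' j = e j" by simp
      qed
      then show "e' \<in> W" using N e e' by auto
    qed
    moreover have "openin ?P (\<Union>e\<in>W. C e)" using oC by blast
    ultimately show "openin (path_topology B) W"
      unfolding path_topology_def openin_subtopology by blast
  qed
qed

lemma topspace_path_topology: "topspace (path_topology B) = path_space B"
  by (auto simp: path_topology_def path_space_def)

section \<open>Systems with tower addresses\<close>

text \<open>Openness in both directions is the form in which the coding and the dynamics are
  compared below.\<close>

lemma homeomorphic_map_bijI:
  assumes bij: "bij_betw f (topspace X) (topspace Y)"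
    and op: "\<And>U. U \<subseteq> topspace X \<Longrightarrow> openin Y (f ` U) \<longleftrightarrow> openin X U"
  shows "homeomorphic_map X Y f"
proof (rule bijective_open_imp_homeomorphic_map)
  show im: "f ` topspace X = topspace Y" and "inj_on f (topspace X)" using bij by (auto simp: bij_betw_def)
  show "open_map X Y f"
    unfolding open_map_def
  proof (intro allI impI)
    fix U assume "openin X U"
    then show "openin Y (f ` U)" using op[OF openin_subset[of X U]] by simp
  qed
  show "continuous_map X Y f"
    unfolding continuous_map_def
  proof (intro conjI allI impI)
    show "f \<in> topspace X \<rightarrow> topspace Y" using im by auto
    fix W assume W: "openin Y W"
    have "f ` {x \<in> topspace X. f x \<in> W} = f ` topspace X \<inter> W" by auto
    also have "\<dots> = W" unfolding im using openin_subset[OF W] by (rule Int_absorb1)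
    finally have "f ` {x \<in> topspace X. f x \<in> W} = W" .
    then show "openin X {x \<in> topspace X. f x \<in> W}"
      using op[of "{x \<in> topspace X. f x \<in> W}"] W by simp
  qed
qed

text \<open>A point \<open>p\<close> lies at level \<open>k\<close> on floor \<open>flr k p\<close> of the tower \<open>vtx k p\<close>, which has height
  \<open>h k (vtx k p)\<close> and is a stack of towers of the level below, named by the word \<open>chi\<close>. The map \<open>T\<close>
  climbs one floor and sends the top floors of a level somewhere into its bottom floors.
  The axioms \<open>sep\<close>, \<open>realize\<close> and \<open>open_iff\<close> say that addresses describe the points and the topology
  completely; \<open>bottoms\<close> and \<open>tops\<close> will force unique extreme paths.\<close>

locale tower_coding =
  fixes X :: "'a topology" and T :: "'a \<Rightarrow> 'a"
    and vtx flr :: "nat \<Rightarrow> 'a \<Rightarrow> nat"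
    and h :: "nat \<Rightarrow> nat \<Rightarrow> nat"
    and chi :: "nat \<Rightarrow> nat \<Rightarrow> nat list"
  assumes nonempty: "topspace X \<noteq> {}"
    and T_in: "p \<in> topspace X \<Longrightarrow> T p \<in> topspace X"
    and vt_0: "vtx 0 p = 0" and chi_0: "chi 0 i = [0]" and h_0: "h 0 0 = 1"
    and finite_vt: "finite (vtx k ` topspace X)"
    and h_Suc: "p \<in> topspace X \<Longrightarrow> h (Suc k) (vtx (Suc k) p) = sum_list (map (h k) (chi k (vtx (Suc k) p)))"
    and h_pos: "\<lbrakk>p \<in> topspace X; i \<in> set (chi k (vtx (Suc k) p))\<rbrakk> \<Longrightarrow> 0 < h k i"
    and flr_less: "p \<in> topspace X \<Longrightarrow> flr k p < h k (vtx k p)"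
    and refine: "p \<in> topspace X \<Longrightarrow> \<exists>m<length (chi k (vtx (Suc k) p)).
      vtx k p = chi k (vtx (Suc k) p) ! m \<and>
      flr (Suc k) p = offset (map (h k) (chi k (vtx (Suc k) p))) m + flr k p"
    and move_up: "\<lbrakk>p \<in> topspace X; Suc (flr k p) < h k (vtx k p)\<rbrakk> \<Longrightarrow>
      vtx k (T p) = vtx k p \<and> flr k (T p) = Suc (flr k p)"
    and move_top: "\<lbrakk>p \<in> topspace X; Suc (flr k p) = h k (vtx k p)\<rbrakk> \<Longrightarrow> flr k (T p) = 0"
    and fill: "\<lbrakk>p \<in> topspace X; s < h k (vtx k p)\<rbrakk> \<Longrightarrow>
      \<exists>p'\<in>topspace X. vtx k p' = vtx k p \<and> flr k p' = s"
    and sep: "\<lbrakk>p \<in> topspace X; p' \<in> topspace X; \<And>k. vtx k p = vtx k p'; \<And>k. flr k p = flr k p'\<rbrakk> \<Longrightarrow> p = p'"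
    and realize: "\<lbrakk>\<And>k. x k \<in> topspace X; \<And>k. vtx k (x (Suc k)) = vtx k (x k);
        \<And>k. flr k (x (Suc k)) = flr k (x k)\<rbrakk> \<Longrightarrow>
      \<exists>p\<in>topspace X. \<forall>k. vtx k p = vtx k (x k) \<and> flr k p = flr k (x k)"
    and bottoms: "\<exists>n\<ge>k. \<forall>p\<in>topspace X. \<forall>p'\<in>topspace X.
      flr n p = 0 \<longrightarrow> flr n p' = 0 \<longrightarrow> vtx k p = vtx k p'"
    and tops: "\<exists>n\<ge>k. \<forall>p\<in>topspace X. \<forall>p'\<in>topspace X.
      Suc (flr n p) = h n (vtx n p) \<longrightarrow> Suc (flr n p') = h n (vtx n p') \<longrightarrow> vtx k p = vtx k p'"
    and open_iff: "openin X U \<longleftrightarrow> U \<subseteq> topspace X \<and>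
      (\<forall>p\<in>U. \<exists>k. \<forall>p'\<in>topspace X. vtx k p' = vtx k p \<and> flr k p' = flr k p \<longrightarrow> p' \<in> U)"
begin

abbreviation Y :: "'a set" where "Y \<equiv> topspace X"

abbreviation hts :: "nat \<Rightarrow> nat \<Rightarrow> nat list" where
  "hts k i \<equiv> map (h k) (chi k i)"

abbreviation V :: "nat \<Rightarrow> nat set" where "V k \<equiv> vtx k ` Y"

abbreviation B :: "(nat, nat \<times> nat) bratteli" where
  "B \<equiv> word_diagram V chi"

text \<open>The storey of its tower of level \<open>k + 1\<close> in which the point lies.\<close>

definition pos :: "nat \<Rightarrow> 'a \<Rightarrow> nat" where
  "pos k p = (SOME m. m < length (chi k (vtx (Suc k) p)) \<and> vtx k p = chi k (vtx (Suc k) p) ! m \<and>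
      flr (Suc k) p = offset (hts k (vtx (Suc k) p)) m + flr k p)"

lemma pos:
  assumes "p \<in> Y"
  shows "pos k p < length (chi k (vtx (Suc k) p))"
    "vtx k p = chi k (vtx (Suc k) p) ! pos k p"
    "flr (Suc k) p = offset (hts k (vtx (Suc k) p)) (pos k p) + flr k p"
  using someI_ex[OF refine[OF assms, of k, unfolded Bex_def]] unfolding pos_def by auto

lemma flr_less_nth: "p \<in> Y \<Longrightarrow> flr k p < hts k (vtx (Suc k) p) ! pos k p"
  using pos[of p k] flr_less[of p k] by simp

text \<open>Storeys are disjoint, so the floor at level \<open>k + 1\<close> determines tower, storey and floor at
  level \<open>k\<close>.\<close>

lemma floor_unique:
  assumes "p \<in> Y" "m < length (chi k (vtx (Suc k) p))" "s < h k (chi k (vtx (Suc k) p) ! m)"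
    and "flr (Suc k) p = offset (hts k (vtx (Suc k) p)) m + s"
  shows "pos k p = m \<and> flr k p = s \<and> vtx k p = chi k (vtx (Suc k) p) ! m"
proof -
  have "pos k p = m \<and> flr k p = s"
  proof (rule offset_unique[where xs = "hts k (vtx (Suc k) p)"])
    show "pos k p < length (hts k (vtx (Suc k) p))" using pos(1)[OF assms(1), of k] by simp
    show "flr k p < hts k (vtx (Suc k) p) ! pos k p" using flr_less_nth[OF assms(1)] .
    show "m < length (hts k (vtx (Suc k) p))" "s < hts k (vtx (Suc k) p) ! m" using assms by simp_all
    show "offset (hts k (vtx (Suc k) p)) (pos k p) + flr k p = offset (hts k (vtx (Suc k) p)) m + s"
      using pos(3)[OF assms(1), of k] assms(4) by metis
  qed
  then show ?thesis using pos(2)[OF assms(1), of k] by simp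
qed

lemma floor_unique_at:
  assumes "p \<in> Y" "vtx (Suc k) p = v" "m < length (chi k v)" "s < h k (chi k v ! m)"
    and "flr (Suc k) p = offset (hts k v) m + s"
  shows "pos k p = m \<and> flr k p = s \<and> vtx k p = chi k v ! m"
  using floor_unique[OF assms(1)] assms(2-) by blast

lemma floor_less_height:
  assumes "p \<in> Y" "m < length (chi k (vtx (Suc k) p))" "s < h k (chi k (vtx (Suc k) p) ! m)"
  shows "offset (hts k (vtx (Suc k) p)) m + s < h (Suc k) (vtx (Suc k) p)"
proof -
  have "offset (hts k (vtx (Suc k) p)) m + s < offset (hts k (vtx (Suc k) p)) (length (hts k (vtx (Suc k) p)))"
    by (rule offset_add_less) (use assms in auto)
  then show ?thesis unfolding h_Suc[OF assms(1)] offset_length .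
qed

lemma fill_floor:
  assumes "p \<in> Y" "m < length (chi k (vtx (Suc k) p))" "s < h k (chi k (vtx (Suc k) p) ! m)"
  obtains p' where "p' \<in> Y" "vtx (Suc k) p' = vtx (Suc k) p"
    "flr (Suc k) p' = offset (hts k (vtx (Suc k) p)) m + s"
    "vtx k p' = chi k (vtx (Suc k) p) ! m" "flr k p' = s" "pos k p' = m"
proof -
  obtain p' where p': "p' \<in> Y" "vtx (Suc k) p' = vtx (Suc k) p"
    "flr (Suc k) p' = offset (hts k (vtx (Suc k) p)) m + s"
    using fill[OF assms(1) floor_less_height[OF assms]] by blast
  then show ?thesis using that[of p'] floor_unique[of p' m k s] assms by simp
qed

lemma address_down:
  assumes "p \<in> Y" "p' \<in> Y" "vtx (Suc k) p = vtx (Suc k) p'" "flr (Suc k) p = flr (Suc k) p'"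
  shows "vtx k p = vtx k p' \<and> flr k p = flr k p' \<and> pos k p = pos k p'"
  using floor_unique[OF assms(1), of "pos k p'" k "flr k p'"] pos[OF assms(2), of k]
    flr_less[OF assms(2), of k] assms by auto

lemma address_mono:
  assumes "p \<in> Y" "p' \<in> Y" "k \<le> n" "vtx n p = vtx n p'" "flr n p = flr n p'"
  shows "vtx k p = vtx k p' \<and> flr k p = flr k p'"
  using assms(3,4,5)
proof (induction n rule: dec_induct)
  case (step n)
  then show ?case using address_down[OF assms(1,2), of n] by blast
qed auto

text \<open>Letters have positive height, hence floor \<open>0\<close> of a stack belongs to its first storey.\<close>

lemma bottom_Suc:
  assumes "p \<in> Y"
  shows "flr (Suc k) p = 0 \<longleftrightarrow> flr k p = 0 \<and> pos k p = 0"
proof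
  assume a: "flr (Suc k) p = 0"
  then have o: "offset (hts k (vtx (Suc k) p)) (pos k p) = 0" "flr k p = 0" using pos[OF assms, of k] by auto
  have "pos k p = 0"
  proof (rule ccontr)
    assume n: "pos k p \<noteq> 0"
    have len: "0 < length (chi k (vtx (Suc k) p))"
      using pos(1)[OF assms, of k] by (rule order.strict_trans1[rotated]) simp
    then have "offset (hts k (vtx (Suc k) p)) 0 + 0 < offset (hts k (vtx (Suc k) p)) (pos k p)"
      using n h_pos[OF assms, of "chi k (vtx (Suc k) p) ! 0" k]
      by (intro offset_add_less) auto
    then show False using o by simp
  qed
  with o show "flr k p = 0 \<and> pos k p = 0" by simp
qed (use pos[OF assms, of k] in auto)

definition is_top :: "nat \<Rightarrow> 'a \<Rightarrow> bool" where
  "is_top k p \<longleftrightarrow> Suc (flr k p) = h k (vtx k p)"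

lemma not_topD: "p \<in> Y \<Longrightarrow> \<not> is_top k p \<Longrightarrow> Suc (flr k p) < h k (vtx k p)"
  using flr_less[of p k] by (simp add: is_top_def)

lemma top_Suc:
  assumes "p \<in> Y"
  shows "is_top (Suc k) p \<longleftrightarrow> is_top k p \<and> Suc (pos k p) = length (chi k (vtx (Suc k) p))"
proof -
  let ?xs = "hts k (vtx (Suc k) p)"
  have P: "pos k p < length ?xs" "flr k p < ?xs ! pos k p"
    using pos[OF assms, of k] flr_less_nth[OF assms, of k] by auto
  have H: "h (Suc k) (vtx (Suc k) p) = offset ?xs (length ?xs)"
    using h_Suc[OF assms] by (simp add: offset_length del: length_map)
  have S: "offset ?xs (Suc (pos k p)) = offset ?xs (pos k p) + ?xs ! pos k p" by (rule offset_Suc[OF P(1)])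
  have V: "h k (vtx k p) = ?xs ! pos k p" using pos[OF assms, of k] by simp
  show ?thesis
  proof (cases "Suc (pos k p) = length (chi k (vtx (Suc k) p))")
    case True
    then show ?thesis unfolding is_top_def H V pos(3)[OF assms, of k] using S by auto
  next
    case False
    then have l: "Suc (pos k p) < length ?xs" using P by simp
    then have "0 < ?xs ! Suc (pos k p)" using h_pos[OF assms, of "chi k (vtx (Suc k) p) ! Suc (pos k p)" k] by simp
    then have "offset ?xs (Suc (pos k p)) + 0 < offset ?xs (length ?xs)" using l by (intro offset_add_less) auto
    then show ?thesis unfolding is_top_def H V pos(3)[OF assms, of k] using S P False by auto
  qed
qed

lemma flr_0: "p \<in> Y \<Longrightarrow> flr 0 p = 0"
  using flr_less[of p 0] by (simp add: vt_0 h_0)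

lemma top_0: "p \<in> Y \<Longrightarrow> is_top 0 p"
  using flr_0[of p] by (simp add: is_top_def vt_0 h_0)

text \<open>Used for the bottom floors and for the top floors alike. Nested sets \<open>Q k\<close>, each inside
  one floor per tower, shrink to one point if \<open>Q n\<close> meets a single tower of level \<open>k\<close> for large \<open>n\<close>.\<close>

lemma extreme_point:
  assumes down: "\<And>k p. p \<in> Y \<Longrightarrow> Q (Suc k) p \<Longrightarrow> Q k p"
    and ex: "\<And>k. \<exists>p\<in>Y. Q k p"
    and determ: "\<And>k p p'. \<lbrakk>p \<in> Y; p' \<in> Y; Q k p; Q k p'; vtx k p = vtx k p'\<rbrakk> \<Longrightarrow> flr k p = flr k p'"
    and addr: "\<And>k p p'. \<lbrakk>p \<in> Y; p' \<in> Y; vtx k p = vtx k p'; flr k p = flr k p'; Q k p\<rbrakk> \<Longrightarrow> Q k p'"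
    and contract: "\<And>k. \<exists>n\<ge>k. \<forall>p\<in>Y. \<forall>p'\<in>Y. Q n p \<longrightarrow> Q n p' \<longrightarrow> vtx k p = vtx k p'"
  shows "\<exists>!p. p \<in> Y \<and> (\<forall>k. Q k p)"
proof -
  have down': "Q k p" if "p \<in> Y" "Q n p" "k \<le> n" for p k n
    using that(3,2)
  proof (induction n rule: dec_induct)
    case (step n)
    then show ?case using down[OF that(1), of n] by blast
  qed
  obtain g where g: "\<And>k. k \<le> g k"
    "\<And>k p p'. \<lbrakk>p \<in> Y; p' \<in> Y; Q (g k) p; Q (g k) p'\<rbrakk> \<Longrightarrow> vtx k p = vtx k p'"
    using contract by metis
  have same: "vtx k p = vtx k p' \<and> flr k p = flr k p'" if "p \<in> Y" "p' \<in> Y" "Q (g k) p" "Q (g k) p'" for k p p'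
    using g(2)[OF that] determ[OF that(1,2)] down'[OF _ _ g(1)] that by blast
  obtain y where y: "\<And>k. y k \<in> Y" "\<And>k. Q k (y k)" using ex by metis
\<comment> \<open>Depth sufficient for the levels \<open>k\<close> and \<open>k + 1\<close> makes consecutive terms agree at level \<open>k\<close>.\<close>
  define x where "x k = y (max (g k) (g (Suc k)))" for k
  have xQ: "x k \<in> Y" "Q (g k) (x k)" "Q (g (Suc k)) (x k)" for k
    unfolding x_def using y down'[OF y(1) y(2)] by simp_all
  have "\<exists>p\<in>Y. \<forall>k. vtx k p = vtx k (x k) \<and> flr k p = flr k (x k)"
  proof (rule realize)
    fix k
    show "vtx k (x (Suc k)) = vtx k (x k)" "flr k (x (Suc k)) = flr k (x k)"
      using address_down[OF xQ(1)[of "Suc k"] xQ(1)[of k]]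
        same[OF xQ(1)[of "Suc k"] xQ(1)[of k] xQ(2)[of "Suc k"] xQ(3)[of k]] by blast+
  qed (rule xQ)
  then obtain p where p: "p \<in> Y" "\<And>k. vtx k p = vtx k (x k)" "\<And>k. flr k p = flr k (x k)" by auto
  have "Q k p" for k
    using addr[OF xQ(1)[of k] p(1), of k] p(2,3) down'[OF xQ(1) xQ(2) g(1)] by auto
  moreover have "p' = p''" if "p' \<in> Y" "p'' \<in> Y" "\<forall>k. Q k p'" "\<forall>k. Q k p''" for p' p''
    using sep[of p' p''] same[of p' p''] that by auto
  ultimately show ?thesis using p(1) by metis
qed

lemma ex1_bottom: "\<exists>!p. p \<in> Y \<and> (\<forall>k. flr k p = 0)"
proof (rule extreme_point)
  fix k
  obtain p where "p \<in> Y" using nonempty by blast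
  moreover have "0 < h k (vtx k p)" using flr_less[OF \<open>p \<in> Y\<close>, of k] by simp
  ultimately show "\<exists>p\<in>Y. flr k p = 0" using fill by blast
qed (use bottom_Suc bottoms in auto)

lemma ex1_top: "\<exists>!p. p \<in> Y \<and> (\<forall>k. is_top k p)"
proof (rule extreme_point)
  fix k
  obtain p where p: "p \<in> Y" using nonempty by blast
  then have "h k (vtx k p) - 1 < h k (vtx k p)" using flr_less[OF p, of k] by simp
  then obtain p' where "p' \<in> Y" "vtx k p' = vtx k p" "flr k p' = h k (vtx k p) - 1" using fill p by blast
  then have "is_top k p'" using flr_less[OF p, of k] unfolding is_top_def by simp
  then show "\<exists>p\<in>Y. is_top k p" using \<open>p' \<in> Y\<close> by blast
next
  fix k show "\<exists>n\<ge>k. \<forall>p\<in>Y. \<forall>p'\<in>Y. is_top n p \<longrightarrow> is_top n p' \<longrightarrow> vtx k p = vtx k p'"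
    using tops unfolding is_top_def .
qed (use top_Suc in \<open>auto simp: is_top_def\<close>)

section \<open>Coding points by paths\<close>

definition code :: "'a \<Rightarrow> nat \<Rightarrow> nat \<times> nat" where
  "code p k = (vtx (Suc k) p, pos k p)"

lemma path_space_B:
  "e \<in> path_space B \<longleftrightarrow> (\<forall>k. fst (e k) \<in> V (Suc k) \<and> snd (e k) < length (chi k (fst (e k))) \<and>
     fst (e k) = chi (Suc k) (fst (e (Suc k))) ! snd (e (Suc k)))"
  by (simp add: path_space_def case_prod_beta del: image_iff)

lemma code_in: "p \<in> Y \<Longrightarrow> code p \<in> path_space B"
  unfolding path_space_B code_def fst_conv snd_conv using pos(1,2)[of p] by blast

lemma V_0: "V 0 = {0}"
  unfolding vt_0 using nonempty by (simp only: image_constant_conv) simp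

text \<open>The prefixes of a path prescribe floors, which \<open>fill\<close> occupies one level at a time and
  \<open>realize\<close> occupies simultaneously.\<close>

lemma code_surj:
  assumes e: "e \<in> path_space B"
  shows "\<exists>p\<in>Y. code p = e"
proof -
  define v where "v k = (case k of 0 \<Rightarrow> 0 | Suc k \<Rightarrow> fst (e k))" for k
  define m where "m k = snd (e k)" for k
  define s where "s = rec_nat 0 (\<lambda>k r. offset (hts k (v (Suc k))) (m k) + r)"
  have s_Suc: "s (Suc k) = offset (hts k (v (Suc k))) (m k) + s k" for k by (simp add: s_def)
  have ek: "e k = (v (Suc k), m k)" for k by (simp add: v_def m_def)
  have vV: "v (Suc k) \<in> V (Suc k)" and ml: "m k < length (chi k (v (Suc k)))"
    and vn: "v (Suc k) = chi (Suc k) (v (Suc (Suc k))) ! m (Suc k)" for k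
    using e[unfolded path_space_B, rule_format, of k] unfolding ek fst_conv snd_conv by blast+
  have vn: "v k = chi k (v (Suc k)) ! m k" for k
  proof (cases k)
    case 0
    then show ?thesis using ml[of 0] by (simp add: v_def chi_0)
  next
    case (Suc j)
    then show ?thesis using vn[of j] by (simp only:)
  qed
  have "\<exists>p\<in>Y. v k = vtx k p" for k
    using vV[of "k - 1"] nonempty by (cases k) (auto simp: v_def vt_0)
  then obtain y where y: "\<And>k. y k \<in> Y" "\<And>k. vtx k (y k) = v k" by metis
  have sh: "s k < h k (v k)" for k
  proof (induction k)
    case 0
    then show ?case by (simp add: s_def v_def h_0)
  next
    case (Suc k)
    have "s k < h k (chi k (v (Suc k)) ! m k)" using Suc vn[of k] by metis
    then show ?case using floor_less_height[OF y(1)[of "Suc k"], of "m k" k "s k"] ml[of k]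
      unfolding y(2) s_Suc by simp
  qed
  have "\<exists>p\<in>Y. vtx k p = v k \<and> flr k p = s k" for k
    using fill[OF y(1)[of k], of "s k" k] sh y(2) by auto
  then obtain x where x: "\<And>k. x k \<in> Y" "\<And>k. vtx k (x k) = v k" "\<And>k. flr k (x k) = s k" by metis
  have x': "vtx k (x (Suc k)) = v k \<and> flr k (x (Suc k)) = s k" for k
    using floor_unique_at[OF x(1)[of "Suc k"] x(2) ml, of "s k"] sh[of k] vn[of k]
      x(3)[of "Suc k"] s_Suc[of k] by metis
  then have "\<exists>p\<in>Y. \<forall>k. vtx k p = vtx k (x k) \<and> flr k p = flr k (x k)"
    by (intro realize) (use x in auto)
  then obtain p where p: "p \<in> Y" "\<And>k. vtx k p = v k" "\<And>k. flr k p = s k" using x(2,3) by auto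
  have "pos k p = m k" for k
    using floor_unique_at[OF p(1) p(2) ml, of "s k"] sh[of k] vn[of k]
      p(3)[of "Suc k"] s_Suc[of k] by metis
  then have "code p = e" using p by (auto simp: code_def ek)
  then show ?thesis using p(1) by blast
qed

text \<open>The bridge between the cylinder topology of paths and the topology given by addresses.\<close>

lemma code_prefix:
  assumes "p \<in> Y" "p' \<in> Y"
  shows "(\<forall>j<k. code p j = code p' j) \<longleftrightarrow> vtx k p = vtx k p' \<and> flr k p = flr k p'"
proof (induction k)
  case 0
  then show ?case using assms by (simp add: vt_0 flr_0)
next
  case (Suc k)
  have "(\<forall>j<Suc k. code p j = code p' j) \<longleftrightarrow> vtx k p = vtx k p' \<and> flr k p = flr k p' \<and> code p k = code p' k"
    using Suc by (auto simp: less_Suc_eq)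
  also have "\<dots> \<longleftrightarrow> vtx (Suc k) p = vtx (Suc k) p' \<and> flr (Suc k) p = flr (Suc k) p'"
    using address_down[OF assms, of k] pos[OF assms(1), of k] pos[OF assms(2), of k]
    unfolding code_def prod.inject by metis
  finally show ?case .
qed

lemma code_inj: "inj_on code Y"
proof (rule inj_onI)
  fix p p' assume "p \<in> Y" "p' \<in> Y" "code p = code p'"
  then show "p = p'" using sep[of p p'] code_prefix[of p p'] by auto
qed

lemma code_image: "code ` Y = path_space B"
  using code_in code_surj by blast

lemma open_map_image_iff:
  assumes U: "U \<subseteq> Y"
  shows "openin (path_topology B) (code ` U) \<longleftrightarrow> openin X U"
proof -
  have "openin (path_topology B) (code ` U) \<longleftrightarrow>
      (\<forall>p\<in>U. \<exists>k. \<forall>p'\<in>Y. (\<forall>j<k. code p' j = code p j) \<longrightarrow> code p' \<in> code ` U)"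
    using U code_in unfolding openin_path_topology_iff code_image[symmetric] by auto
  also have "\<dots> \<longleftrightarrow> (\<forall>p\<in>U. \<exists>k. \<forall>p'\<in>Y. vtx k p' = vtx k p \<and> flr k p' = flr k p \<longrightarrow> p' \<in> U)"
  proof -
    have "code p' \<in> code ` U \<longleftrightarrow> p' \<in> U" if "p' \<in> Y" for p'
      using inj_on_image_mem_iff[OF code_inj that U] .
    then show ?thesis using U by (auto simp: code_prefix subset_iff cong: ball_cong)
  qed
  also have "\<dots> \<longleftrightarrow> openin X U" using U by (simp add: open_iff)
  finally show ?thesis .
qed

lemma homeomorphic_code: "homeomorphic_map X (path_topology B) code"
proof (rule homeomorphic_map_bijI)
  show "bij_betw code (topspace X) (topspace (path_topology B))"
    using code_inj code_image by (simp add: bij_betw_def topspace_path_topology)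
  show "openin (path_topology B) (code ` U) = openin X U" if "U \<subseteq> Y" for U
    using open_map_image_iff[OF that] .
qed

lemma max_edge_code: "p \<in> Y \<Longrightarrow> max_edge B k (code p k) \<longleftrightarrow> Suc (pos k p) = length (chi k (vtx (Suc k) p))"
  unfolding code_def by (rule max_edge_word_diagram) (use pos(1) in auto)

lemma min_edge_code: "p \<in> Y \<Longrightarrow> min_edge B k (code p k) \<longleftrightarrow> pos k p = 0"
  unfolding code_def by (rule min_edge_word_diagram) (use pos(1) in auto)

lemma top_iff: "p \<in> Y \<Longrightarrow> is_top k p \<longleftrightarrow> (\<forall>j<k. max_edge B j (code p j))"
  by (induction k) (auto simp: top_0 top_Suc max_edge_code less_Suc_eq)

lemma bottom_iff: "p \<in> Y \<Longrightarrow> flr k p = 0 \<longleftrightarrow> (\<forall>j<k. min_edge B j (code p j))"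
  by (induction k) (auto simp: flr_0 bottom_Suc min_edge_code less_Suc_eq)

lemma maximal_path_code: "p \<in> Y \<Longrightarrow> maximal_path B (code p) \<longleftrightarrow> (\<forall>k. is_top k p)"
  using code_in by (auto simp: maximal_path_def top_iff)

lemma minimal_path_code: "p \<in> Y \<Longrightarrow> minimal_path B (code p) \<longleftrightarrow> (\<forall>k. flr k p = 0)"
  using code_in by (auto simp: minimal_path_def bottom_iff)

lemma ex1_maximal_path: "\<exists>!e. maximal_path B e"
proof -
  obtain p where p: "p \<in> Y" "\<forall>k. is_top k p" "\<And>p'. p' \<in> Y \<Longrightarrow> \<forall>k. is_top k p' \<Longrightarrow> p' = p"
    using ex1_top by metis
  show ?thesis
  proof (rule ex1I[of _ "code p"])
    show "maximal_path B (code p)" using p maximal_path_code by blast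
    fix e assume e: "maximal_path B e"
    then obtain p' where "p' \<in> Y" "code p' = e" using code_surj unfolding maximal_path_def by blast
    then show "e = code p" using p e maximal_path_code by blast
  qed
qed

lemma ex1_minimal_path: "\<exists>!e. minimal_path B e"
proof -
  obtain p where p: "p \<in> Y" "\<forall>k. flr k p = 0" "\<And>p'. p' \<in> Y \<Longrightarrow> \<forall>k. flr k p' = 0 \<Longrightarrow> p' = p"
    using ex1_bottom by metis
  show ?thesis
  proof (rule ex1I[of _ "code p"])
    show "minimal_path B (code p)" using p minimal_path_code by blast
    fix e assume e: "minimal_path B e"
    then obtain p' where "p' \<in> Y" "code p' = e" using code_surj unfolding minimal_path_def by blast
    then show "e = code p" using p e minimal_path_code by blast
  qed
qed

section \<open>The Vershik map\<close>

lemma top_antimono: "\<lbrakk>p \<in> Y; is_top n p; k \<le> n\<rbrakk> \<Longrightarrow> is_top k p"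
  by (auto simp: top_iff)

lemma bottom_antimono: "\<lbrakk>p \<in> Y; flr n p = 0; k \<le> n\<rbrakk> \<Longrightarrow> flr k p = 0"
  by (auto simp: bottom_iff)

lemma move_top': "p \<in> Y \<Longrightarrow> is_top k p \<Longrightarrow> flr k (T p) = 0"
  by (simp add: move_top is_top_def)

lemma move_up': "p \<in> Y \<Longrightarrow> \<not> is_top k p \<Longrightarrow> vtx k (T p) = vtx k p \<and> flr k (T p) = Suc (flr k p)"
  by (simp add: move_up not_topD)

lemma top_iff_T: "p \<in> Y \<Longrightarrow> is_top k p \<longleftrightarrow> flr k (T p) = 0"
  using move_top'[of p k] move_up'[of p k] by (metis nat.distinct(1))

definition adr :: "nat \<Rightarrow> 'a \<Rightarrow> nat \<times> nat" where "adr k p = (vtx k p, flr k p)"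

lemma adr_mono: "\<lbrakk>p \<in> Y; p' \<in> Y; adr n p = adr n p'; k \<le> n\<rbrakk> \<Longrightarrow> adr k p = adr k p'"
  using address_mono[of p p' k n] by (simp add: adr_def)

lemma adr_sep:
  assumes "p \<in> Y" "p' \<in> Y" "\<And>k. n \<le> k \<Longrightarrow> adr k p = adr k p'"
  shows "p = p'"
proof -
  have "adr k p = adr k p'" for k
    using adr_mono[OF assms(1,2) assms(3)[of "max n k"], of k] by simp
  then show ?thesis using sep[OF assms(1,2)] by (simp add: adr_def)
qed

text \<open>Below the top, \<open>T\<close> adds one to the floor, which is injective on addresses.\<close>

lemma adr_T_iff:
  assumes "p \<in> Y" "p' \<in> Y" "\<not> is_top n p"
  shows "adr n (T p) = adr n (T p') \<longleftrightarrow> adr n p = adr n p'"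
proof -
  have "\<not> is_top n p'" if "adr n (T p) = adr n (T p') \<or> adr n p = adr n p'"
    using that
  proof
    assume "adr n (T p) = adr n (T p')"
    then show ?thesis using assms(3) unfolding top_iff_T[OF assms(1)] top_iff_T[OF assms(2)] adr_def by simp
  next
    assume "adr n p = adr n p'"
    then show ?thesis using assms(3) unfolding adr_def is_top_def by simp
  qed
  then show ?thesis using move_up'[OF assms(1,3)] move_up'[OF assms(2), of n]
    unfolding adr_def prod.inject by (metis nat.inject)
qed

text \<open>The only delicate point is the one on all top floors: its neighbours are sent to low
  floors of deep levels, which \<open>bottoms\<close> puts into one tower.\<close>

lemma continuous_T:
  assumes p: "p \<in> Y"
  shows "\<exists>n. \<forall>p'\<in>Y. adr n p' = adr n p \<longrightarrow> adr k (T p') = adr k (T p)"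
proof (cases "\<forall>n. is_top n p")
  case True
  obtain n where n: "n \<ge> k" "\<And>p p'. \<lbrakk>p \<in> Y; p' \<in> Y; flr n p = 0; flr n p' = 0\<rbrakk> \<Longrightarrow> vtx k p = vtx k p'"
    using bottoms[of k] by blast
  have "adr k (T p') = adr k (T p)" if p': "p' \<in> Y" "adr n p' = adr n p" for p'
  proof -
    have "is_top n p'" using True p' by (auto simp: adr_def is_top_def)
    then have "flr n (T p') = 0" "flr n (T p) = 0" using True p p' move_top' by auto
    then show ?thesis using n(2)[of "T p'" "T p"] bottom_antimono[OF _ _ n(1)] T_in p p'
      by (simp add: adr_def)
  qed
  then show ?thesis by blast
next
  case False
  then obtain m where m: "\<not> is_top m p" by blast
  define n where "n = max m k"
  have "\<not> is_top n p" using m top_antimono[OF p, of n m] by (auto simp: n_def)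
  then have "adr k (T p') = adr k (T p)" if "p' \<in> Y" "adr n p' = adr n p" for p'
    using adr_mono[OF T_in[OF p] T_in[OF that(1)], of n k] adr_T_iff[OF p that(1), of n] that(2)
    by (simp add: n_def)
  then show ?thesis by blast
qed

lemma continuous_T_inv:
  assumes p: "p \<in> Y"
  shows "\<exists>n. \<forall>p'\<in>Y. adr n (T p') = adr n (T p) \<longrightarrow> adr k p' = adr k p"
proof (cases "\<forall>n. is_top n p")
  case True
  obtain n where n: "n \<ge> k" "\<And>p p'. \<lbrakk>p \<in> Y; p' \<in> Y; is_top n p; is_top n p'\<rbrakk> \<Longrightarrow> vtx k p = vtx k p'"
    using tops[of k] unfolding is_top_def by blast
  have "adr k p' = adr k p" if p': "p' \<in> Y" "adr n (T p') = adr n (T p)" for p'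
  proof -
    have t: "is_top n p'" "is_top n p" using True p' top_iff_T p by (auto simp: adr_def)
    then have "is_top k p'" "is_top k p" using top_antimono n(1) p p' by blast+
    then show ?thesis using n(2)[OF p'(1) p t] by (simp add: adr_def is_top_def)
  qed
  then show ?thesis by blast
next
  case False
  then obtain m where m: "\<not> is_top m p" by blast
  define n where "n = max m k"
  have "\<not> is_top n p" using m top_antimono[OF p, of n m] by (auto simp: n_def)
  then have "adr k p' = adr k p" if "p' \<in> Y" "adr n (T p') = adr n (T p)" for p'
    using adr_mono[OF p that(1), of n k] adr_T_iff[OF p that(1), of n] that(2)
    by (simp add: n_def)
  then show ?thesis by blast
qed

lemma inj_T: "inj_on T Y"
proof (rule inj_onI)
  fix p p' assume a: "p \<in> Y" "p' \<in> Y" "T p = T p'"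
  have "adr k p = adr k p'" for k
    using continuous_T_inv[OF a(2), of k] a by auto
  then show "p = p'" using adr_sep[OF a(1,2), of 0] by blast
qed

text \<open>A point off the bottom at level \<open>n\<close> is off the bottom at all deeper levels, and the
  floors just below it are the floors of a preimage.\<close>

lemma surj_T:
  assumes r: "r \<in> Y"
  shows "\<exists>p\<in>Y. T p = r"
proof (cases "\<forall>k. flr k r = 0")
  case True
  obtain p where p: "p \<in> Y" "\<forall>k. is_top k p" using ex1_top by blast
  then have "\<forall>k. flr k (T p) = 0" using move_top' by blast
  then show ?thesis using ex1_bottom True T_in p(1) r by blast
next
  case False
  then obtain n where n: "flr n r \<noteq> 0" by blast
  have pos: "flr m r \<noteq> 0" if "n \<le> m" for m using bottom_antimono[OF r _ that] n by blast
  have "\<exists>p\<in>Y. vtx m p = vtx m r \<and> flr m p = flr m r - 1" for m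
    using fill[OF r, of "flr m r - 1" m] flr_less[OF r, of m] by simp
  then obtain y where y: "\<And>m. y m \<in> Y" "\<And>m. vtx m (y m) = vtx m r" "\<And>m. flr m (y m) = flr m r - 1"
    by metis
  have Ty: "adr m (T (y m)) = adr m r" if "n \<le> m" for m
  proof -
    have "Suc (flr m (y m)) = flr m r" using y(3)[of m] pos[OF that] by simp
    then show ?thesis using move_up[OF y(1)[of m], of m] y(2)[of m] flr_less[OF r, of m]
      unfolding adr_def by simp
  qed
  have down: "adr k (y (Suc k)) = adr k (y k)" if k: "n \<le> k" for k
  proof -
    have *: "adr k (T (y (Suc k))) = adr k r"
      by (rule adr_mono[OF T_in[OF y(1)] r Ty]) (use k in simp_all)
    then have "flr k (T (y (Suc k))) \<noteq> 0" using pos[OF k] by (simp add: adr_def)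
    then have "\<not> is_top k (y (Suc k))" unfolding top_iff_T[OF y(1)] .
    moreover have "adr k (T (y (Suc k))) = adr k (T (y k))" using * Ty[OF k] by (rule trans[OF _ sym])
    ultimately show ?thesis using adr_T_iff[OF y(1) y(1), of k "Suc k" k] by simp
  qed
  define x where "x k = y (max k n)" for k
  have "adr k (x (Suc k)) = adr k (x k)" for k
  proof (cases "n \<le> k")
    case True
    then show ?thesis using down[OF True] by (simp add: x_def max_def)
  next
    case False
    then have "max (Suc k) n = max k n" by simp
    then show ?thesis unfolding x_def by simp
  qed
  then have "vtx k (x (Suc k)) = vtx k (x k)" "flr k (x (Suc k)) = flr k (x k)" for k
    unfolding adr_def prod.inject by blast+
  moreover have "x k \<in> Y" for k using y(1) by (simp add: x_def)
  ultimately obtain p where p: "p \<in> Y" "\<And>k. vtx k p = vtx k (x k)" "\<And>k. flr k p = flr k (x k)"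
    using realize[of x] by blast
  have "adr m (T p) = adr m r" if m: "n \<le> m" for m
  proof -
    have "adr m p = adr m (y m)" using p(2,3)[of m] m by (simp add: adr_def x_def)
    moreover have "\<not> is_top m (y m)" using Ty[OF m] pos[OF m] top_iff_T[OF y(1), of m m] by (simp add: adr_def)
    ultimately show ?thesis using adr_T_iff[OF y(1) p(1), of m m] Ty[OF m] by simp
  qed
  then have "T p = r" by (rule adr_sep[OF T_in[OF p(1)] r])
  then show ?thesis using p(1) by blast
qed

lemma open_adr: "openin X U \<longleftrightarrow> U \<subseteq> Y \<and> (\<forall>p\<in>U. \<exists>k. \<forall>p'\<in>Y. adr k p' = adr k p \<longrightarrow> p' \<in> U)"
  by (simp add: open_iff adr_def)

lemma openin_T_image_iff:
  assumes U: "U \<subseteq> Y"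
  shows "openin X (T ` U) \<longleftrightarrow> openin X U"
proof
  assume o: "openin X (T ` U)"
  show "openin X U"
    unfolding open_adr
  proof (intro conjI ballI U)
    fix p assume p: "p \<in> U"
    then obtain k where k: "\<And>p'. p' \<in> Y \<Longrightarrow> adr k p' = adr k (T p) \<Longrightarrow> p' \<in> T ` U"
      using o unfolding open_adr by blast
    obtain n where n: "\<And>p'. p' \<in> Y \<Longrightarrow> adr n p' = adr n p \<Longrightarrow> adr k (T p') = adr k (T p)"
      using continuous_T[of p k] p U by blast
    have "p' \<in> U" if "p' \<in> Y" "adr n p' = adr n p" for p'
    proof -
      have "T p' \<in> T ` U" using k n that T_in by blast
      then show ?thesis using inj_on_image_mem_iff[OF inj_T that(1) U] by blast
    qed
    then show "\<exists>k. \<forall>p'\<in>Y. adr k p' = adr k p \<longrightarrow> p' \<in> U" by blast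
  qed
next
  assume o: "openin X U"
  show "openin X (T ` U)"
    unfolding open_adr
  proof (intro conjI ballI)
    show "T ` U \<subseteq> Y" using U T_in by blast
    fix r assume "r \<in> T ` U"
    then obtain p where p: "p \<in> U" "r = T p" by blast
    then obtain k where k: "\<And>p'. p' \<in> Y \<Longrightarrow> adr k p' = adr k p \<Longrightarrow> p' \<in> U"
      using o unfolding open_adr by blast
    obtain n where n: "\<And>p'. p' \<in> Y \<Longrightarrow> adr n (T p') = adr n (T p) \<Longrightarrow> adr k p' = adr k p"
      using continuous_T_inv[of p k] p U by blast
    have "r' \<in> T ` U" if r': "r' \<in> Y" "adr n r' = adr n r" for r'
    proof -
      obtain p' where "p' \<in> Y" "T p' = r'" using surj_T[OF r'(1)] by blast
      then show ?thesis using k n r'(2) p(2) by blast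
    qed
    then show "\<exists>k. \<forall>r'\<in>Y. adr k r' = adr k r \<longrightarrow> r' \<in> T ` U" by blast
  qed
qed

text \<open>Let \<open>k\<close> be the first level whose edge is not maximal. The point is on the top floor up to
  level \<open>k\<close> and on no top floor beyond. So \<open>T\<close> moves it to the next storey at level \<open>k\<close>, to the bottom at
  the lower levels, and leaves the storeys of the higher levels alone.\<close>

lemma vershik_code:
  assumes p: "p \<in> Y"
  shows "vershik B (code p) = code (T p)"
proof (cases "maximal_path B (code p)")
  case True
  then have "\<forall>k. flr k (T p) = 0" using maximal_path_code p move_top' by blast
  then have "minimal_path B (code (T p))" using minimal_path_code T_in p by blast
  then have "(THE f. minimal_path B f) = code (T p)" using ex1_minimal_path by (rule the1_equality[rotated])
  then show ?thesis using True by (simp add: vershik_def)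
next
  case False
  define k where "k = (LEAST k. \<not> max_edge B k (code p k))"
  have ex: "\<exists>k. \<not> max_edge B k (code p k)" using False code_in[OF p] by (auto simp: maximal_path_def)
  have k: "\<not> max_edge B k (code p k)" unfolding k_def using ex by (rule LeastI_ex)
  have below: "max_edge B j (code p j)" if "j < k" for j
    using not_less_Least[of j] that unfolding k_def by blast
  have topk: "is_top k p" "\<And>n. k < n \<Longrightarrow> \<not> is_top n p" using below k by (auto simp: top_iff[OF p])
  have Tp: "T p \<in> Y" using T_in p .
  have up: "vtx n (T p) = vtx n p" "flr n (T p) = Suc (flr n p)" if "k < n" for n
    using move_up'[OF p topk(2)[OF that]] by auto
  have above: "code (T p) n = code p n" if n: "k < n" for n
  proof -
    have s: "Suc (flr n p) < h n (chi n (vtx (Suc n) p) ! pos n p)"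
      using not_topD[OF p topk(2)[OF n]] pos(2)[OF p, of n] by simp
    have "pos n (T p) = pos n p"
      using floor_unique_at[OF Tp up(1)[of "Suc n"] pos(1)[OF p] s] up(2)[of "Suc n"] n pos(3)[OF p, of n]
      by simp
    then show ?thesis using up(1)[of "Suc n"] n by (simp add: code_def)
  qed
  let ?l = "length (chi k (vtx (Suc k) p))"
  have l: "Suc (pos k p) < ?l" using k pos(1)[OF p, of k] by (simp add: max_edge_code[OF p])
  have "pos k (T p) = Suc (pos k p)"
  proof -
    have s: "0 < h k (chi k (vtx (Suc k) p) ! Suc (pos k p))"
      by (rule h_pos[OF p]) (use l in simp)
    have "offset (hts k (vtx (Suc k) p)) (Suc (pos k p)) = offset (hts k (vtx (Suc k) p)) (pos k p) + h k (vtx k p)"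
      using offset_Suc[of "pos k p" "hts k (vtx (Suc k) p)"] pos(1,2)[OF p, of k] by simp
    then have "flr (Suc k) (T p) = offset (hts k (vtx (Suc k) p)) (Suc (pos k p)) + 0"
      using topk(1) up(2)[of "Suc k"] pos(3)[OF p, of k] by (simp add: is_top_def)
    then show ?thesis using floor_unique_at[OF Tp up(1)[of "Suc k"] l s] by simp
  qed
  then have at: "is_succ_edge B k (code p k) (code (T p) k)"
    using up(1)[of "Suc k"] l p by (simp add: code_def is_succ_edge_word_diagram)
  have mins: "min_edge B j (code (T p) j)" if "j < k" for j
    using bottom_iff[OF Tp, of k] move_top'[OF p topk(1)] that by blast
  have uniq: "f = code (T p)"
    if f: "f \<in> path_space B" "\<forall>j>k. f j = code p j" "is_succ_edge B k (code p k) (f k)"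
      "\<forall>j<k. min_edge B j (f j)" for f
  proof -
    have fk: "f k = code (T p) k"
      using f(3) at p l unfolding code_def by (simp add: is_succ_edge_word_diagram)
    have P: "fst (f j) \<in> V (Suc j)" "snd (f j) < length (chi j (fst (f j)))"
      "fst (f j) = chi (Suc j) (fst (f (Suc j))) ! snd (f (Suc j))" for j
      using f(1) unfolding path_space_B by blast+
    have "f j = code (T p) j" if "j \<le> k" for j
      using that
    proof (induction j rule: inc_induct)
      case (step j)
      have "snd (f j) = 0"
        using f(4) step(2) min_edge_word_diagram[of "fst (f j)" V j "snd (f j)" chi, OF P(1,2)[of j]] by simp
      moreover have "snd (code (T p) j) = 0"
        using mins[of j] step min_edge_code[OF Tp] by (simp add: code_def)
      moreover have "fst (f j) = fst (code (T p) j)"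
        using step P(3)[of j] code_in[OF Tp, unfolded path_space_B, rule_format, of j] by simp
      ultimately show ?case by (simp add: prod_eq_iff)
    qed (rule fk)
    then show ?thesis using f(2) above by (intro ext) (metis not_le)
  qed
  have "(THE f. f \<in> path_space B \<and> (\<forall>j>k. f j = code p j) \<and> is_succ_edge B k (code p k) (f k) \<and>
                (\<forall>j<k. min_edge B j (f j))) = code (T p)"
    using code_in[OF Tp] above at mins uniq by (intro the_equality) blast+
  then show ?thesis using False unfolding vershik_def Let_def k_def[symmetric] by simp
qed

lemma homeomorphic_vershik: "homeomorphic_map (path_topology B) (path_topology B) (vershik B)"
proof (rule homeomorphic_map_bijI, unfold topspace_path_topology)
  have v: "vershik B ` code ` U = code ` T ` U" if "U \<subseteq> Y" for U
    using that vershik_code by (force simp: image_image)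
  have TY: "T ` Y = Y" using T_in surj_T by blast
  have "inj_on (vershik B) (code ` Y)"
    using code_inj inj_T T_in by (intro inj_onI) (auto simp: vershik_code inj_on_eq_iff)
  then show "bij_betw (vershik B) (path_space B) (path_space B)"
    unfolding bij_betw_def code_image[symmetric] using v[of Y] TY by simp
  fix U assume "U \<subseteq> path_space B"
  then obtain W where W: "W \<subseteq> Y" "U = code ` W" unfolding code_image[symmetric] by (meson subset_imageE)
  then show "openin (path_topology B) (vershik B ` U) = openin (path_topology B) U"
    using v[OF W(1)] open_map_image_iff[OF W(1)] open_map_image_iff[OF order.trans[OF image_mono[OF W(1)] TY[THEN equalityD1]]]
      openin_T_image_iff[OF W(1)] by simp
qed

lemma ordered_diagram: "ordered_bratteli_diagram B"
  unfolding ordered_bratteli_diagram_def bratteli_diagram_def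
proof (intro conjI allI ballI impI)
  show "finite (vertices B k)" for k using finite_vt by simp
  have "edges B k = Sigma (V (Suc k)) (\<lambda>i. {..<length (chi k i)})" for k by auto
  then show "finite (edges B k)" for k using finite_vt by simp
  show "\<exists>v0. vertices B 0 = {v0}" using V_0 by simp
  show "source B k e \<in> vertices B k" if e: "e \<in> edges B k" for k e
  proof -
    obtain p where p: "p \<in> Y" "fst e = vtx (Suc k) p" "snd e < length (chi k (fst e))"
      using e by auto
    then have "0 < h k (chi k (vtx (Suc k) p) ! snd e)" by (intro h_pos) auto
    then obtain p' where "p' \<in> Y" "vtx k p' = chi k (vtx (Suc k) p) ! snd e"
      using fill_floor[of p "snd e" k 0] p by metis
    then show ?thesis using p(2) by (metis imageI word_diagram_sel(1,3))
  qed
  show "target B k e \<in> vertices B (Suc k)" if "e \<in> edges B k" for k e using that by auto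
  show "\<exists>!e. e \<in> incoming B 0 v" if "v \<in> vertices B 1" for v
    using that by (simp add: incoming_word_diagram chi_0)
  show "\<exists>e\<in>edges B k. source B k e = v" if v: "v \<in> vertices B k" for k v
  proof -
    obtain p where p: "p \<in> Y" "v = vtx k p" using v by auto
    then have "code p k \<in> edges B k" "source B k (code p k) = v"
      using pos(1,2)[OF p(1), of k] by (auto simp: code_def)
    then show ?thesis by blast
  qed
  show "incoming B k v \<noteq> {}" if v: "v \<in> vertices B (Suc k)" for k v
  proof -
    obtain p where "p \<in> Y" "v = vtx (Suc k) p" using v by auto
    then show ?thesis using pos(1)[of p k] by (auto simp: incoming_word_diagram)
  qed
  show "linear_order_on (incoming B k v) (edge_order B k v)" if "v \<in> vertices B (Suc k)" for k v
    using that by (intro linear_order_on_word_diagram) simp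
qed

end

section \<open>First returns and doubling\<close>

definition return_time :: "nat \<Rightarrow> (nat \<Rightarrow> nat) \<Rightarrow> nat \<Rightarrow> nat" where
  "return_time q g i = (LEAST n. 1 \<le> n \<and> (g ^^ n) i < q)"

definition return_map :: "nat \<Rightarrow> (nat \<Rightarrow> nat) \<Rightarrow> nat \<Rightarrow> nat" where
  "return_map q g i = (if i < q then (g ^^ return_time q g i) i else i)"

text \<open>The exchange of the two halves of \<open>{..<2 q}\<close>: what the odometer does to the left and the
  right half of the interval, on cells of half the length.\<close>

definition swap_halves :: "nat \<Rightarrow> nat \<Rightarrow> nat" where
  "swap_halves q e = (if e < q then e + q else if e < 2 * q then e - q else e)"

text \<open>Cutting every cell into two refines a cell permutation \<open>g\<close>. The images inside the first
  \<open>2 q\<close> cells, that is inside the base of the coarser level, are subject to one more step of the odometer.\<close>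

definition doubled :: "nat \<Rightarrow> (nat \<Rightarrow> nat) \<Rightarrow> nat \<Rightarrow> nat" where
  "doubled q g c = swap_halves q (2 * g (c div 2) + c mod 2)"

definition in_tower :: "nat \<Rightarrow> (nat \<Rightarrow> nat) \<Rightarrow> nat \<Rightarrow> bool" where
  "in_tower q g c \<longleftrightarrow> (\<exists>i<q. \<exists>s<return_time q g i. c = (g ^^ s) i)"

definition tower_of :: "nat \<Rightarrow> (nat \<Rightarrow> nat) \<Rightarrow> nat \<Rightarrow> nat" where
  "tower_of q g c = (SOME i. i < q \<and> (\<exists>s<return_time q g i. c = (g ^^ s) i))"

definition floor_of :: "nat \<Rightarrow> (nat \<Rightarrow> nat) \<Rightarrow> nat \<Rightarrow> nat" where
  "floor_of q g c = (SOME s. s < return_time q g (tower_of q g c) \<and> c = (g ^^ s) (tower_of q g c))"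

locale first_return =
  fixes q Q :: nat and g :: "nat \<Rightarrow> nat"
  assumes perm: "g permutes {..<Q}" and qQ: "q \<le> Q"
begin

lemma inj_g: "inj g" using perm by (rule permutes_inj)

lemma inj_pow: "(g ^^ n) x = (g ^^ n) y \<longleftrightarrow> x = y"
  using inj_fn[OF inj_g, of n] by (auto dest: injD)

lemma g_less: "c < Q \<Longrightarrow> g c < Q"
  using permutes_in_image[OF perm, of c] by simp

lemma pow_less: "c < Q \<Longrightarrow> (g ^^ n) c < Q"
  by (induction n) (use g_less in auto)

lemma pow_cycle: "c < Q \<Longrightarrow> \<exists>n\<ge>1. (g ^^ n) c = c"
proof -
  assume c: "c < Q"
  have "\<not> inj_on (\<lambda>n. (g ^^ n) c) {..Q}"
  proof
    assume "inj_on (\<lambda>n. (g ^^ n) c) {..Q}"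
    then have "card {..Q} = card ((\<lambda>n. (g ^^ n) c) ` {..Q})" by (simp add: card_image)
    also have "\<dots> \<le> card {..<Q}" using pow_less[OF c] by (intro card_mono) auto
    finally show False by simp
  qed
  then obtain m n where mn: "(g ^^ m) c = (g ^^ n) c" "m < n"
    by (auto simp: inj_on_def) (metis linorder_neqE_nat)
  then obtain d where d: "n = m + d" "d \<ge> 1" by (metis less_imp_Suc_add le_add1 plus_1_eq_Suc add_Suc_right)
  then have "(g ^^ m) ((g ^^ d) c) = (g ^^ m) c" using mn by (simp add: funpow_add)
  then show ?thesis using d(2) inj_pow by blast
qed

lemma return_time:
  assumes "i < q"
  shows return_time_ge1: "1 \<le> return_time q g i" and return_less: "(g ^^ return_time q g i) i < q"
    and before_return: "\<And>n. 1 \<le> n \<Longrightarrow> n < return_time q g i \<Longrightarrow> q \<le> (g ^^ n) i"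
proof -
  obtain n where "n \<ge> 1" "(g ^^ n) i = i" using pow_cycle[of i] assms qQ by auto
  then have "\<exists>n. 1 \<le> n \<and> (g ^^ n) i < q" using assms by auto
  then have "1 \<le> return_time q g i \<and> (g ^^ return_time q g i) i < q" unfolding return_time_def by (rule LeastI_ex)
  then show "1 \<le> return_time q g i" "(g ^^ return_time q g i) i < q" by auto
  show "q \<le> (g ^^ n) i" if "1 \<le> n" "n < return_time q g i" for n
    using not_less_Least[of n "\<lambda>n. 1 \<le> n \<and> (g ^^ n) i < q"] that by (simp add: return_time_def)
qed

text \<open>Cancelling the smaller number of steps would make a point of the base return too early.\<close>

lemma floor_unique_aux:
  assumes "i < q" "i' < q" "s' < return_time q g i'" "(g ^^ s) i = (g ^^ s') i'" "s \<le> s'"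
  shows "i = i' \<and> s = s'"
proof -
  obtain d where d: "s' = s + d" using assms(5) le_Suc_ex by blast
  have "i = (g ^^ d) i'" using assms(4) inj_pow[of s i "(g ^^ d) i'"] by (simp add: d funpow_add)
  moreover have "q \<le> (g ^^ d) i'" if "1 \<le> d" using before_return[OF assms(2) that] assms(3) d by simp
  ultimately have "d = 0" using assms(1) by (cases d) auto
  then show ?thesis using \<open>i = (g ^^ d) i'\<close> d by simp
qed

lemma floor_unique:
  assumes "i < q" "i' < q" "s < return_time q g i" "s' < return_time q g i'" "(g ^^ s) i = (g ^^ s') i'"
  shows "i = i' \<and> s = s'"
proof (cases "s \<le> s'")
  case True
  then show ?thesis using floor_unique_aux[OF assms(1,2,4,5)] by simp
next
  case False
  then show ?thesis using floor_unique_aux[OF assms(2,1,3) assms(5)[symmetric]] by simp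
qed

lemma address_eq:
  assumes "i < q" "s < return_time q g i" "c = (g ^^ s) i"
  shows "tower_of q g c = i" "floor_of q g c = s"
proof -
  show t: "tower_of q g c = i"
    unfolding tower_of_def
  proof (rule some_equality)
    fix j assume "j < q \<and> (\<exists>s<return_time q g j. c = (g ^^ s) j)"
    then show "j = i" using floor_unique[of j i _ s] assms by blast
  qed (use assms in blast)
  show "floor_of q g c = s"
    unfolding floor_of_def t
  proof (rule some_equality)
    fix r assume "r < return_time q g i \<and> c = (g ^^ r) i"
    then show "r = s" using floor_unique[of i i r s] assms by blast
  qed (use assms in blast)
qed

lemma address:
  assumes "in_tower q g c"
  shows "tower_of q g c < q" "floor_of q g c < return_time q g (tower_of q g c)"
    "(g ^^ floor_of q g c) (tower_of q g c) = c"
  using assms address_eq unfolding in_tower_def by auto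

lemma next_floor:
  assumes "q \<le> g ((g ^^ s) i)" "i < q" "s < return_time q g i"
  shows "Suc s < return_time q g i"
proof (rule ccontr)
  assume "\<not> Suc s < return_time q g i"
  then have "Suc s = return_time q g i" using assms(3) by simp
  then have "g ((g ^^ s) i) < q" using return_less[OF assms(2)] by (metis funpow.simps(2) o_apply)
  then show False using assms(1) by simp
qed

lemma top_floor:
  assumes "g ((g ^^ s) i) < q" "i < q" "s < return_time q g i"
  shows "Suc s = return_time q g i" "return_map q g i = g ((g ^^ s) i)"
proof -
  show 1: "Suc s = return_time q g i"
  proof (rule ccontr)
    assume "Suc s \<noteq> return_time q g i"
    then have "q \<le> (g ^^ Suc s) i" using before_return[OF assms(2), of "Suc s"] assms(3) by simp
    then show False using assms(1) by simp
  qed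
  show "return_map q g i = g ((g ^^ s) i)" using assms(2) by (simp add: return_map_def 1[symmetric])
qed

lemma return_map_permutes: "return_map q g permutes {..<q}"
proof (rule bij_imp_permutes)
  have into: "return_map q g ` {..<q} \<subseteq> {..<q}" using return_less by (auto simp: return_map_def)
  have "inj_on (return_map q g) {..<q}"
  proof (rule inj_onI)
    fix i i' assume a: "i \<in> {..<q}" "i' \<in> {..<q}" "return_map q g i = return_map q g i'"
    obtain s s' where s: "return_time q g i = Suc s" "return_time q g i' = Suc s'"
      using return_time_ge1[of i] return_time_ge1[of i'] a by (auto simp: Suc_le_eq gr0_conv_Suc)
    then have "(g ^^ s) i = (g ^^ s') i'" using a inj_g by (auto simp: return_map_def dest: injD)
    then show "i = i'" using floor_unique[of i i' s s'] a s by simp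
  qed
  then show "bij_betw (return_map q g) {..<q} {..<q}"
    using into endo_inj_surj[of "{..<q}"] by (auto simp: bij_betw_def)
qed (simp add: return_map_def)

lemma in_tower_base: "c < q \<Longrightarrow> in_tower q g c"
  unfolding in_tower_def using return_time_ge1[of c] by (intro exI[of _ c] conjI exI[of _ "0::nat"]) auto

text \<open>A base cell is preceded by the top of a tower because the return map is onto.\<close>

lemma in_tower_back:
  assumes "in_tower q g (g c)"
  shows "in_tower q g c"
proof -
  obtain i s where i: "i < q" "s < return_time q g i" "g c = (g ^^ s) i" using assms unfolding in_tower_def by blast
  show ?thesis
  proof (cases s)
    case (Suc t)
    then have "c = (g ^^ t) i" using i(3) inj_g by (auto dest: injD)
    then show ?thesis unfolding in_tower_def using i Suc by (intro exI[of _ i] conjI exI[of _ t]) auto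
  next
    case 0
    obtain j where j: "j < q" "return_map q g j = i"
      using permutes_image[OF return_map_permutes] i(1) by (metis imageE lessThan_iff)
    obtain t where t: "return_time q g j = Suc t" using return_time_ge1[OF j(1)] by (cases "return_time q g j") auto
    have "g c = g ((g ^^ t) j)" using i(3) 0 j t by (simp add: return_map_def)
    then have "c = (g ^^ t) j" using inj_g by (auto dest: injD)
    then show ?thesis unfolding in_tower_def using j t by (intro exI[of _ j] conjI exI[of _ t]) auto
  qed
qed

lemma not_in_tower: "\<not> in_tower q g c \<Longrightarrow> q \<le> (g ^^ n) c"
proof (rule ccontr)
  assume a: "\<not> in_tower q g c" "\<not> q \<le> (g ^^ n) c"
  then have "in_tower q g ((g ^^ n) c)" by (intro in_tower_base) simp
  then have "in_tower q g c" by (induction n) (auto dest: in_tower_back)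
  then show False using a by simp
qed

end

lemma swap_halves_involution: "swap_halves q (swap_halves q e) = e"
  by (auto simp: swap_halves_def)

lemma swap_halves_less: "q \<le> Q \<Longrightarrow> e < 2 * Q \<Longrightarrow> swap_halves q e < 2 * Q"
  by (auto simp: swap_halves_def)

lemma doubled_permutes:
  assumes perm: "g permutes {..<Q}" and qQ: "q \<le> Q"
  shows "doubled q g permutes {..<2 * Q}"
proof (rule bij_imp_permutes)
  have into: "doubled q g ` {..<2 * Q} \<subseteq> {..<2 * Q}"
  proof
    fix y assume "y \<in> doubled q g ` {..<2 * Q}"
    then obtain c where c: "c < 2 * Q" "y = doubled q g c" by auto
    then have "c div 2 < Q" by simp
    then have "g (c div 2) < Q" using permutes_in_image[OF perm, of "c div 2"] by simp
    then have "2 * g (c div 2) + c mod 2 < 2 * Q" by linarith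
    then show "y \<in> {..<2 * Q}" using c swap_halves_less[OF qQ] by (simp add: doubled_def)
  qed
  have "inj_on (doubled q g) {..<2 * Q}"
  proof (rule inj_onI)
    fix c c' assume "doubled q g c = doubled q g c'"
    then have *: "2 * g (c div 2) + c mod 2 = 2 * g (c' div 2) + c' mod 2"
      unfolding doubled_def by (metis swap_halves_involution)
    then have 1: "g (c div 2) = g (c' div 2)" and 2: "c mod 2 = c' mod 2" by presburger+
    have "c div 2 = c' div 2" using injD[OF permutes_inj[OF perm] 1] .
    with 2 show "c = c'" by (metis div_mult_mod_eq)
  qed
  then show "bij_betw (doubled q g) {..<2 * Q} {..<2 * Q}"
    using into endo_inj_surj[of "{..<2 * Q}"] by (auto simp: bij_betw_def)
next
  fix c assume "c \<notin> {..<2 * Q}"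
  then have c: "Q \<le> c div 2" by auto
  then have "g (c div 2) = c div 2" using perm by (auto simp: permutes_def)
  then show "doubled q g c = c" using c qQ by (auto simp: doubled_def swap_halves_def)
qed

text \<open>The word of the doubling step: the halves of the base cells run through the first return
  of \<open>doubled q r\<close> to \<open>{..<q}\<close>, and each half is replaced by the cell that it comes from.\<close>

definition visited :: "nat \<Rightarrow> (nat \<Rightarrow> nat) \<Rightarrow> nat \<Rightarrow> nat list" where
  "visited q r i = map (\<lambda>m. (doubled q r ^^ m) i div 2) [0..<return_time q (doubled q r) i]"

lemma length_visited: "length (visited q r i) = return_time q (doubled q r) i"
  by (simp add: visited_def)

lemma nth_visited: "m < return_time q (doubled q r) i \<Longrightarrow> visited q r i ! m = (doubled q r ^^ m) i div 2"
  by (simp add: visited_def)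

context first_return
begin

abbreviation "rho \<equiv> return_map q g"
abbreviation "tau \<equiv> doubled q rho"
abbreviation "doubled_g \<equiv> doubled q g"
abbreviation "heights i \<equiv> map (return_time q g) (visited q rho i)"

lemma first_return_tau: "first_return q (2 * q) tau"
  using doubled_permutes[OF return_map_permutes order_refl] by unfold_locales auto

lemma tau_less: "c < 2 * q \<Longrightarrow> (tau ^^ m) c < 2 * q"
  using first_return.pow_less[OF first_return_tau] .

lemma doubled_pow:
  assumes c: "c < 2 * q" and s: "s < return_time q g (c div 2)"
  shows "(doubled_g ^^ s) c = 2 * (g ^^ s) (c div 2) + c mod 2"
  using s
proof (induction s)
  case (Suc s)
  have "q \<le> g ((g ^^ s) (c div 2))" using before_return[of "c div 2" "Suc s"] c Suc.prems by simp
  then show ?case using Suc by (simp add: doubled_def swap_halves_def)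
qed simp

text \<open>Both halves of a base cell climb the tower side by side, and only the return step differs
  from the coarser level.\<close>

lemma doubled_return:
  assumes c: "c < 2 * q"
  shows "(doubled_g ^^ return_time q g (c div 2)) c = tau c"
proof -
  have c2: "c div 2 < q" using c by simp
  obtain s where s: "return_time q g (c div 2) = Suc s" using return_time_ge1[OF c2] by (cases "return_time q g (c div 2)") auto
  have "(doubled_g ^^ Suc s) c = swap_halves q (2 * (g ^^ Suc s) (c div 2) + c mod 2)"
    using doubled_pow[OF c, of s] s by (simp add: doubled_def[of q g])
  also have "\<dots> = tau c" using c2 by (simp add: doubled_def return_map_def s[symmetric] del: funpow.simps)
  finally show ?thesis using s by simp
qed

lemma doubled_offset:
  assumes i: "i < q" and m: "m \<le> return_time q tau i"
  shows "(doubled_g ^^ offset (heights i) m) i = (tau ^^ m) i"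
  using m
proof (induction m)
  case (Suc m)
  have c: "(tau ^^ m) i < 2 * q" using tau_less i by simp
  have "offset (heights i) (Suc m) = offset (heights i) m + return_time q g ((tau ^^ m) i div 2)"
    using Suc.prems by (simp add: offset_Suc length_visited nth_visited)
  then have "(doubled_g ^^ offset (heights i) (Suc m)) i = (doubled_g ^^ return_time q g ((tau ^^ m) i div 2)) ((doubled_g ^^ offset (heights i) m) i)"
    by (metis add.commute funpow_add o_apply)
  also have "\<dots> = tau ((tau ^^ m) i)" using doubled_return[OF c] Suc by simp
  finally show ?case by simp
qed simp

lemma doubled_offset_add:
  assumes i: "i < q" and m: "m < return_time q tau i" and s: "s < return_time q g ((tau ^^ m) i div 2)"
  shows "(doubled_g ^^ (offset (heights i) m + s)) i = 2 * (g ^^ s) ((tau ^^ m) i div 2) + (tau ^^ m) i mod 2"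
proof -
  have "(doubled_g ^^ (offset (heights i) m + s)) i = (doubled_g ^^ s) ((doubled_g ^^ offset (heights i) m) i)"
    by (metis add.commute funpow_add o_apply)
  also have "\<dots> = (doubled_g ^^ s) ((tau ^^ m) i)" using doubled_offset[OF i] m by simp
  finally show ?thesis using doubled_pow[OF tau_less s] i by simp
qed

lemma visited_less: "i < q \<Longrightarrow> j \<in> set (visited q rho i) \<Longrightarrow> j < q"
proof -
  assume i: "i < q" and "j \<in> set (visited q rho i)"
  then obtain m where "j = (tau ^^ m) i div 2" unfolding visited_def by auto
  then show "j < q" using tau_less[of i m] i by simp
qed

lemma offset_heights_exists:
  assumes "t < sum_list (heights i)"
  obtains m s where "m < return_time q tau i" "s < return_time q g ((tau ^^ m) i div 2)" "t = offset (heights i) m + s"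
  using offset_exists[OF assms] by (auto simp: length_visited nth_visited)

text \<open>The tower of the refined permutation is the stack of the towers named by the word.\<close>

lemma return_time_doubled:
  assumes i: "i < q"
  shows "return_time q doubled_g i = sum_list (heights i)"
proof -
  interpret t: first_return q "2 * q" tau by (rule first_return_tau)
  have sum: "sum_list (heights i) = offset (heights i) (return_time q tau i)"
    using offset_length[of "heights i"] by (simp add: length_visited del: map_map)
  show ?thesis
    unfolding return_time_def[of q doubled_g]
  proof (rule Least_equality)
    have "offset (heights i) 0 + 0 < offset (heights i) (return_time q tau i)"
      using t.return_time_ge1[OF i] return_time_ge1[of "i div 2"] i by (intro offset_add_less) (auto simp: length_visited nth_visited Suc_le_eq)
    then show "1 \<le> sum_list (heights i) \<and> (doubled_g ^^ sum_list (heights i)) i < q"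
      using doubled_offset[OF i order_refl] t.return_less[OF i] sum by simp
    fix t assume t: "1 \<le> t \<and> (doubled_g ^^ t) i < q"
    show "sum_list (heights i) \<le> t"
    proof (rule ccontr)
      assume "\<not> sum_list (heights i) \<le> t"
      then obtain m s where ms: "m < return_time q tau i" "s < return_time q g ((tau ^^ m) i div 2)" "t = offset (heights i) m + s"
        using offset_heights_exists[of t i] by auto
      let ?c = "(tau ^^ m) i"
      have v: "(doubled_g ^^ t) i = 2 * (g ^^ s) (?c div 2) + ?c mod 2" using doubled_offset_add[OF i ms(1,2)] ms(3) by simp
      show False
      proof (cases s)
        case 0
        then have "m \<noteq> 0" using t ms(3) by (cases m) auto
        then have "q \<le> ?c" using t.before_return[OF i, of m] ms(1) by simp
        then show False using v t 0 by simp
      next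
        case (Suc s')
        have "?c < 2 * q" using tau_less i by simp
        then have "q \<le> (g ^^ s) (?c div 2)" using before_return[of "?c div 2" s] ms(2) Suc by simp
        then show False using v t by linarith
      qed
    qed
  qed
qed

text \<open>Self-similarity: the next base permutation is computed from the present one.\<close>

lemma return_map_doubled: "return_map q doubled_g = return_map q tau"
proof
  fix i
  show "return_map q doubled_g i = return_map q tau i"
  proof (cases "i < q")
    case True
    have "sum_list (heights i) = offset (heights i) (return_time q tau i)"
      using offset_length[of "heights i"] by (simp add: length_visited del: map_map)
    then show ?thesis using return_time_doubled[OF True] doubled_offset[OF True order_refl] True by (simp add: return_map_def)
  qed (simp add: return_map_def)
qed

end

section \<open>Marks and merged letters\<close>

text \<open>The largest element of \<open>S\<close> up to the argument, or \<open>0\<close>. It names the block.\<close>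

primrec block_start :: "nat set \<Rightarrow> nat \<Rightarrow> nat" where
  "block_start S 0 = 0"
| "block_start S (Suc i) = (if Suc i \<in> S then Suc i else block_start S i)"

lemma block_start_le: "block_start S i \<le> i" by (induction i) auto

lemma block_start_ge: "j \<in> S \<Longrightarrow> j \<le> i \<Longrightarrow> j \<le> block_start S i"
  by (induction i) (auto simp: le_Suc_eq)

lemma block_start_pred: "j \<notin> S \<Longrightarrow> 0 < j \<Longrightarrow> block_start S j = block_start S (j - 1)"
  by (cases j) auto

lemma block_start_invariant:
  assumes "\<And>i. i < q \<Longrightarrow> i \<notin> S \<Longrightarrow> 0 < i \<Longrightarrow> f i = f (i - 1)" "i < q"
  shows "f (block_start S i) = f i"
  using assms(2)
proof (induction i)
  case (Suc i)
  then show ?case using assms(1)[of "Suc i"] by auto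
qed simp

text \<open>A cell of the refined base is cut off from its left neighbour if it is mapped to the
  first cell of the base or if it meets, on the way back, the left half of a marked cell. The right half
  of a cell always follows its left half.\<close>

definition next_marks :: "nat \<Rightarrow> (nat \<Rightarrow> nat) \<Rightarrow> nat set \<Rightarrow> nat set" where
  "next_marks q r S = {i. i < q \<and> (i = 0 \<or> return_map q (doubled q r) i = 0 \<or>
     (\<exists>m<return_time q (doubled q r) i. even ((doubled q r ^^ m) i) \<and> (doubled q r ^^ m) i div 2 \<in> S))}"

locale rotation_perm =
  fixes q :: nat and \<pi> :: "nat \<Rightarrow> nat"
  assumes q2: "2 \<le> q" and perm: "\<pi> permutes {..<q}"
begin

text \<open>The action of \<open>F\<close> on the \<open>q 2\<^sup>k\<close> cells of level \<open>k\<close>; on the cells sent into the base it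
  is \<open>F\<close> without the final odometer step.\<close>

primrec sig :: "nat \<Rightarrow> nat \<Rightarrow> nat" where
  "sig 0 = \<pi>"
| "sig (Suc k) = doubled q (sig k)"

abbreviation Q :: "nat \<Rightarrow> nat" where "Q k \<equiv> q * 2 ^ k"

abbreviation rho :: "nat \<Rightarrow> nat \<Rightarrow> nat" where "rho k \<equiv> return_map q (sig k)"

abbreviation tau :: "nat \<Rightarrow> nat \<Rightarrow> nat" where "tau k \<equiv> doubled q (rho k)"

abbreviation hgt :: "nat \<Rightarrow> nat \<Rightarrow> nat" where "hgt k \<equiv> return_time q (sig k)"

abbreviation word :: "nat \<Rightarrow> nat \<Rightarrow> nat list" where "word k \<equiv> visited q (rho k)"

lemma q_pos: "0 < q" using q2 by simp

lemma first_return_sig: "first_return q (Q k) (sig k)"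
proof (induction k)
  case 0
  then show ?case using perm by unfold_locales auto
next
  case (Suc k)
  then interpret R: first_return q "Q k" "sig k" .
  show ?case using doubled_permutes[OF R.perm R.qQ] q_pos by unfold_locales (auto simp: mult_ac)
qed

sublocale S: first_return q "Q k" "sig k" for k by (rule first_return_sig)

sublocale Tau: first_return q "2 * q" "tau k" for k by (rule S.first_return_tau)

lemma hgt_0: "i < q \<Longrightarrow> return_time q \<pi> i = 1"
  unfolding return_time_def using S.g_less[of i 0] by (intro Least_equality) auto

lemma rho_0: "return_map q \<pi> = \<pi>"
  using permutes_not_in[OF perm] by (auto simp: return_map_def hgt_0 fun_eq_iff)

lemma rho_Suc: "rho (Suc k) = return_map q (tau k)"
  using S.return_map_doubled[of k] by simp

lemma hgt_Suc: "i < q \<Longrightarrow> hgt (Suc k) i = sum_list (map (hgt k) (word k i))"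
  using S.return_time_doubled[of i k] by simp

text \<open>At level \<open>0\<close> the marks are \<open>0\<close> and the discontinuities of the rotation.\<close>

primrec marks :: "nat \<Rightarrow> nat set" where
  "marks 0 = {i. i < q \<and> (i = 0 \<or> \<pi> i \<noteq> Suc (\<pi> (i - 1)))}"
| "marks (Suc k) = next_marks q (rho k) (marks k)"

lemma marks_less: "i \<in> marks k \<Longrightarrow> i < q"
  by (cases k) (auto simp: next_marks_def)

lemma zero_marked: "0 \<in> marks k"
  using q_pos by (cases k) (auto simp: next_marks_def)

text \<open>The property that marks are made for: an unmarked base cell climbs next to its left
  neighbour, through a tower of equal height, and is returned next to it.\<close>

definition adjacent :: "nat \<Rightarrow> bool" where
  "adjacent k \<longleftrightarrow> (\<forall>i<q. i \<notin> marks k \<longrightarrow> 0 < i \<and> rho k i = Suc (rho k (i - 1)) \<and>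
     hgt k i = hgt k (i - 1) \<and> (\<forall>s<hgt k i. (sig k ^^ s) i = Suc ((sig k ^^ s) (i - 1))))"

text \<open>Adjacent numbers \<open>e - 1, e < 2 q\<close> are torn apart by \<open>swap_halves\<close> only if \<open>e = q\<close>. Then the right
  neighbour returns to \<open>0\<close>, which is a reason for a mark. The return times could differ only if the
  right neighbour arrives at \<open>q\<close> and the left one at \<open>q - 1\<close>; then the cell before is the left half of one
  that is returned to \<open>0\<close> at the coarser level, hence of a marked one.\<close>

lemma tau_adjacent:
  assumes adj: "adjacent k" and i: "i < q" "i \<notin> marks (Suc k)"
  shows "0 < i" "\<And>m. m \<le> return_time q (tau k) i \<Longrightarrow> (tau k ^^ m) i = Suc ((tau k ^^ m) (i - 1))"
    "return_time q (tau k) (i - 1) = return_time q (tau k) i"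
proof -
  show i0: "0 < i" using i by (cases i) (auto simp: next_marks_def)
  have ret0: "return_map q (tau k) i \<noteq> 0"
    and ev: "\<And>m. m < return_time q (tau k) i \<Longrightarrow> even ((tau k ^^ m) i) \<Longrightarrow> (tau k ^^ m) i div 2 \<notin> marks k"
    using i by (auto simp: next_marks_def)
  show step: "(tau k ^^ m) i = Suc ((tau k ^^ m) (i - 1))" if "m \<le> return_time q (tau k) i" for m
    using that
  proof (induction m)
    case 0
    then show ?case using i0 by simp
  next
    case (Suc m)
    define c where "c = (tau k ^^ m) i"
    define d where "d = (tau k ^^ m) (i - 1)"
    have cd: "c = Suc d" using Suc by (simp add: c_def d_def)
    have c2: "c < 2 * q" using S.tau_less[of i m k] i by (simp add: c_def)
    have ne: "tau k c \<noteq> 0"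
    proof
      assume t: "tau k c = 0"
      have "Suc m = return_time q (tau k) i" "return_map q (tau k) i = tau k c"
        using Tau.top_floor[of k m i] i Suc.prems q_pos t by (auto simp: c_def)
      then show False using ret0 t by simp
    qed
    have e: "2 * rho k (c div 2) + c mod 2 = Suc (2 * rho k (d div 2) + d mod 2)"
    proof (cases "even c")
      case True
      have "c div 2 \<notin> marks k" using ev[of m] Suc.prems True by (simp add: c_def)
      then have *: "rho k (c div 2) = Suc (rho k (c div 2 - 1))" using adj c2 unfolding adjacent_def by simp
      have "d div 2 = c div 2 - 1" "d mod 2 = 1" "c mod 2 = 0" using True cd by presburger+
      then show ?thesis using * by simp
    next
      case False
      have "d div 2 = c div 2" "d mod 2 = 0" "c mod 2 = 1" using False cd by presburger+
      then show ?thesis by simp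
    qed
    define e' where "e' = 2 * rho k (d div 2) + d mod 2"
    have "rho k (c div 2) < q" using permutes_in_image[OF S.return_map_permutes[of k], of "c div 2"] c2 by simp
    then have "2 * rho k (c div 2) + c mod 2 < 2 * q" by linarith
    then have e2: "Suc e' < 2 * q" unfolding e e'_def .
    have "swap_halves q (Suc e') \<noteq> 0" using ne unfolding doubled_def e e'_def .
    then have "swap_halves q (Suc e') = Suc (swap_halves q e')" using e2 unfolding swap_halves_def by (simp split: if_splits)
    then have "tau k c = Suc (tau k d)" unfolding doubled_def e e'_def .
    then show ?case by (simp add: c_def d_def)
  qed
  show "return_time q (tau k) (i - 1) = return_time q (tau k) i"
    unfolding return_time_def[of q "tau k" "i - 1"]
  proof (rule Least_equality)
    show "1 \<le> return_time q (tau k) i \<and> (tau k ^^ return_time q (tau k) i) (i - 1) < q"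
      using Tau.return_time_ge1[OF i(1)] Tau.return_less[OF i(1), of k] step[of "return_time q (tau k) i"] by simp
    fix n assume n: "1 \<le> n \<and> (tau k ^^ n) (i - 1) < q"
    show "return_time q (tau k) i \<le> n"
    proof (rule ccontr)
      assume "\<not> return_time q (tau k) i \<le> n"
      then have nl: "n < return_time q (tau k) i" by simp
      then have "q \<le> (tau k ^^ n) i" using Tau.before_return[OF i(1), of n] n by simp
      then have eq: "(tau k ^^ n) i = q" using step[of n] nl n by simp
      obtain m where m: "n = Suc m" using n by (cases n) auto
      define c where "c = (tau k ^^ m) i"
      have "swap_halves q (2 * rho k (c div 2) + c mod 2) = q" using eq m by (simp add: c_def doubled_def)
      then have "2 * rho k (c div 2) + c mod 2 = swap_halves q q" by (metis swap_halves_involution)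
      then have z: "rho k (c div 2) = 0" "c mod 2 = 0" using q_pos by (auto simp: swap_halves_def)
      have "c div 2 < q" using S.tau_less[of i m k] i by (simp add: c_def)
      moreover have "c div 2 \<notin> marks k" using ev[of m] nl m z(2) by (simp add: c_def even_iff_mod_2_eq_zero)
      ultimately have "rho k (c div 2) = Suc (rho k (c div 2 - 1))" using adj unfolding adjacent_def by simp
      then show False using z by simp
    qed
  qed
qed

lemma word_adjacent:
  assumes adj: "adjacent k" and i: "i < q" "i \<notin> marks (Suc k)" and m: "m < return_time q (tau k) i"
  shows "word k i ! m = word k (i - 1) ! m \<or>
    word k i ! m \<notin> marks k \<and> word k (i - 1) ! m = word k i ! m - 1 \<and> 0 < word k i ! m \<and> word k i ! m < q"
proof -
  note T = tau_adjacent[OF adj i]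
  have cd: "(tau k ^^ m) i = Suc ((tau k ^^ m) (i - 1))" using T(2)[of m] m by simp
  have c2: "(tau k ^^ m) i < 2 * q" using S.tau_less[of i m k] i by simp
  have w: "word k i ! m = (tau k ^^ m) i div 2" "word k (i - 1) ! m = (tau k ^^ m) (i - 1) div 2"
    using m T(3) by (simp_all add: nth_visited)
  show ?thesis
  proof (cases "even ((tau k ^^ m) i)")
    case True
    then have "(tau k ^^ m) i div 2 \<notin> marks k" using i m by (auto simp: next_marks_def)
    moreover have "0 < x div 2 \<and> y div 2 = x div 2 - 1" if "x = Suc y" "even x" for x y :: nat
      using that by presburger
    note this[OF cd True]
    moreover have "(tau k ^^ m) i div 2 < q" using c2 by simp
    ultimately show ?thesis using w by simp
  next
    case False
    moreover have "x div 2 = y div 2" if "x = Suc y" "odd x" for x y :: nat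
      using that by presburger
    ultimately show ?thesis using cd w by simp
  qed
qed

text \<open>An odd cell and its left neighbour are halves of one cell, and the even
  cells on the way of an unmarked base cell come from unmarked ones, to which the induction applies.\<close>

lemma adjacent: "adjacent k"
proof (induction k)
  case 0
  then show ?case using q_pos by (auto simp: adjacent_def rho_0 hgt_0)
next
  case (Suc k)
  show ?case
    unfolding adjacent_def
  proof (intro allI impI)
    fix i assume i: "i < q" "i \<notin> marks (Suc k)"
    note T = tau_adjacent[OF Suc i] and W = word_adjacent[OF Suc i]
    have i1: "i - 1 < q" using i by simp
    have heq: "map (hgt k) (word k i) = map (hgt k) (word k (i - 1))"
    proof (rule nth_equalityI)
      fix m assume m: "m < length (map (hgt k) (word k i))"
      then have m': "m < return_time q (tau k) i" by (simp add: length_visited)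
      have "hgt k (word k i ! m) = hgt k (word k (i - 1) ! m)"
        using W[OF m'] Suc unfolding adjacent_def by metis
      then show "map (hgt k) (word k i) ! m = map (hgt k) (word k (i - 1)) ! m"
        using m' T(3) by (simp add: length_visited)
    qed (use T(3) in \<open>simp add: length_visited\<close>)
    have h: "hgt (Suc k) i = hgt (Suc k) (i - 1)"
      unfolding hgt_Suc[OF i(1)] hgt_Suc[OF i1] heq ..
    have r: "rho (Suc k) i = Suc (rho (Suc k) (i - 1))"
      unfolding rho_Suc using T(2)[OF order_refl] T(3) i by (simp add: return_map_def)
    have "(sig (Suc k) ^^ t) i = Suc ((sig (Suc k) ^^ t) (i - 1))" if t: "t < hgt (Suc k) i" for t
    proof -
      obtain m s where ms: "m < return_time q (tau k) i" "s < hgt k ((tau k ^^ m) i div 2)"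
        "t = offset (map (hgt k) (word k i)) m + s"
        using S.offset_heights_exists[of t k i] t hgt_Suc[OF i(1)] by metis
      define c where "c = (tau k ^^ m) i"
      define d where "d = (tau k ^^ m) (i - 1)"
      have cd: "c = Suc d" using T(2)[of m] ms(1) by (simp add: c_def d_def)
      have wc: "word k i ! m = c div 2" "word k (i - 1) ! m = d div 2"
        using ms(1) T(3) by (simp_all add: c_def d_def nth_visited)
      have hcd: "hgt k (c div 2) = hgt k (d div 2)" using W[OF ms(1)] Suc unfolding adjacent_def wc by metis
      have A: "(sig (Suc k) ^^ t) i = 2 * (sig k ^^ s) (c div 2) + c mod 2"
        using S.doubled_offset_add[OF i(1) ms(1,2)] ms(3) by (simp add: c_def)
      have B: "(sig (Suc k) ^^ t) (i - 1) = 2 * (sig k ^^ s) (d div 2) + d mod 2"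
        using S.doubled_offset_add[OF i1, of m k s] ms hcd T(3) heq by (simp add: c_def d_def)
      show ?thesis
      proof (cases "even c")
        case True
        have "c div 2 \<notin> marks k" using i ms(1) True by (auto simp: next_marks_def c_def)
        moreover have "c div 2 < q" using S.tau_less[of i m k] i by (simp add: c_def)
        ultimately have "(sig k ^^ s) (c div 2) = Suc ((sig k ^^ s) (c div 2 - 1))"
          using Suc ms(2) unfolding adjacent_def c_def by blast
        moreover have "d div 2 = c div 2 - 1" "d mod 2 = 1" "c mod 2 = 0" using True cd by presburger+
        ultimately show ?thesis using A B by simp
      next
        case False
        have "d div 2 = c div 2" "d mod 2 = 0" "c mod 2 = 1" using False cd by presburger+
        then show ?thesis using A B by simp
      qed
    qed
    then show "0 < i \<and> rho (Suc k) i = Suc (rho (Suc k) (i - 1)) \<and>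
       hgt (Suc k) i = hgt (Suc k) (i - 1) \<and>
       (\<forall>s<hgt (Suc k) i. (sig (Suc k) ^^ s) i = Suc ((sig (Suc k) ^^ s) (i - 1)))"
      using T(1) r h by blast
  qed
qed

lemma unmarked:
  assumes "i < q" "i \<notin> marks k"
  shows "0 < i" "rho k i = Suc (rho k (i - 1))" "hgt k i = hgt k (i - 1)"
    "\<And>s. s < hgt k i \<Longrightarrow> (sig k ^^ s) i = Suc ((sig k ^^ s) (i - 1))"
  using adjacent[of k] assms unfolding adjacent_def by blast+

abbreviation block :: "nat \<Rightarrow> nat \<Rightarrow> nat" where "block k \<equiv> block_start (marks k)"

lemma block_less: "i < q \<Longrightarrow> block k i < q" using block_start_le[of "marks k" i] by simp

lemma hgt_block: "i < q \<Longrightarrow> hgt k (block k i) = hgt k i"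
  by (rule block_start_invariant[of q]) (use unmarked(3) in auto)

definition merged :: "nat \<Rightarrow> nat \<Rightarrow> nat list" where
  "merged k i = map (block k) (word k i)"

lemma length_merged: "length (merged k i) = return_time q (tau k) i"
  by (simp add: merged_def length_visited)

text \<open>Hence the merged word belongs to the block and not to the cell.\<close>

lemma merged_block: "i < q \<Longrightarrow> merged k (block (Suc k) i) = merged k i"
proof (rule block_start_invariant[of q])
  fix i assume i: "i < q" "i \<notin> marks (Suc k)" "0 < i"
  show "merged k i = merged k (i - 1)"
  proof (rule nth_equalityI)
    show l: "length (merged k i) = length (merged k (i - 1))"
      using tau_adjacent(3)[OF adjacent i(1,2)] by (simp add: length_merged)
    fix m assume m: "m < length (merged k i)"
    then have "block k (word k i ! m) = block k (word k (i - 1) ! m)"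
      using word_adjacent[OF adjacent i(1,2), of m] block_start_pred[of "word k i ! m" "marks k"] by (auto simp: length_merged)
    then show "merged k i ! m = merged k (i - 1) ! m"
      using m l by (simp add: merged_def)
  qed
qed

lemma merged_less: "i < q \<Longrightarrow> set (merged k i) \<subseteq> {..<q}"
  using S.visited_less[of i] block_less by (auto simp: merged_def)

lemma map_hgt_merged: "i < q \<Longrightarrow> map (hgt k) (merged k i) = map (hgt k) (word k i)"
  using S.visited_less[of i] hgt_block by (simp add: merged_def)

text \<open>The boundary between the cells \<open>c - 1\<close> and \<open>c\<close> is interior to a block floor.\<close>

definition joined :: "nat \<Rightarrow> nat \<Rightarrow> bool" where
  "joined k c \<longleftrightarrow> (\<exists>i<q. i \<notin> marks k \<and> (\<exists>s<hgt k i. c = (sig k ^^ s) i))"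

lemma joined_forward: "joined k c \<Longrightarrow> q \<le> sig k c \<Longrightarrow> joined k (sig k c)"
proof -
  assume j: "joined k c" and l: "q \<le> sig k c"
  then obtain i s where i: "i < q" "i \<notin> marks k" "s < hgt k i" "c = (sig k ^^ s) i" unfolding joined_def by blast
  then have "Suc s < hgt k i" using S.next_floor[of k s i] l by simp
  then show ?thesis unfolding joined_def using i by (intro exI[of _ i] conjI exI[of _ "Suc s"]) auto
qed

lemma joined_back: "joined k (sig k c) \<Longrightarrow> q \<le> sig k c \<Longrightarrow> joined k c"
proof -
  assume j: "joined k (sig k c)" and l: "q \<le> sig k c"
  then obtain i s where i: "i < q" "i \<notin> marks k" "s < hgt k i" "sig k c = (sig k ^^ s) i" unfolding joined_def by blast
  then obtain t where t: "s = Suc t" using l by (cases s) auto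
  then have "c = (sig k ^^ t) i" using i(4) injD[OF S.inj_g[of k]] by simp
  then show ?thesis unfolding joined_def using i t by (intro exI[of _ i] conjI exI[of _ t]) auto
qed

lemma joined_top: "joined k c \<Longrightarrow> sig k c \<noteq> 0"
proof
  assume j: "joined k c" and z: "sig k c = 0"
  then obtain i s where i: "i < q" "i \<notin> marks k" "s < hgt k i" "c = (sig k ^^ s) i" unfolding joined_def by blast
  then have "rho k i = 0" using S.top_floor(2)[of k s i] z q_pos by simp
  then show False using unmarked(2)[OF i(1,2)] by simp
qed

lemma joined_0: "\<not> joined k 0"
proof
  assume "joined k 0"
  then obtain i s where i: "i < q" "i \<notin> marks k" "s < hgt k i" "(sig k ^^ s) i = 0" unfolding joined_def by metis
  have "s = 0" using S.before_return[OF i(1), of s k] i q_pos by (cases s) auto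
  then show False using i zero_marked by simp
qed

lemma floor_refine:
  assumes i: "i < q" and t: "t < hgt (Suc k) i"
  obtains m s where "m < return_time q (tau k) i" "s < hgt k (word k i ! m)"
    "t = offset (map (hgt k) (word k i)) m + s"
    "(sig (Suc k) ^^ t) i = 2 * (sig k ^^ s) (word k i ! m) + (tau k ^^ m) i mod 2"
proof -
  obtain m s where ms: "m < return_time q (tau k) i" "s < hgt k ((tau k ^^ m) i div 2)"
    "t = offset (map (hgt k) (word k i)) m + s"
    using S.offset_heights_exists[of t k i] t hgt_Suc[OF i] by metis
  show ?thesis
    by (rule that[OF ms(1) _ ms(3)]) (use ms S.doubled_offset_add[OF i ms(1,2)] in \<open>simp_all add: nth_visited\<close>)
qed

text \<open>A boundary that is also one of the coarser level is interior there as well, since a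
  base cell is marked as soon as its orbit meets the left half of a marked cell.\<close>

lemma joined_descend: "joined (Suc k) (2 * c) \<Longrightarrow> joined k c"
proof -
  assume "joined (Suc k) (2 * c)"
  then obtain i t where i: "i < q" "i \<notin> marks (Suc k)" "t < hgt (Suc k) i" "2 * c = (sig (Suc k) ^^ t) i"
    unfolding joined_def by blast
  obtain m s where ms: "m < return_time q (tau k) i" "s < hgt k (word k i ! m)"
    "(sig (Suc k) ^^ t) i = 2 * (sig k ^^ s) (word k i ! m) + (tau k ^^ m) i mod 2"
    using floor_refine[OF i(1,3)] by metis
  define x where "x = (sig k ^^ s) (word k i ! m)"
  define y where "y = (tau k ^^ m) i"
  have "2 * c = 2 * x + y mod 2" using ms(3) i(4) by (simp add: x_def y_def)
  then have "c = x" "even y" by presburger+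
  then have c: "c = (sig k ^^ s) (word k i ! m)" "even ((tau k ^^ m) i)" by (simp_all add: x_def y_def)
  then have "word k i ! m \<notin> marks k" using i ms(1) by (auto simp: next_marks_def nth_visited)
  moreover have "word k i ! m < q" using S.visited_less[OF i(1) nth_mem] ms(1) by (simp add: length_visited)
  ultimately show ?thesis unfolding joined_def using c ms(2) by blast
qed

lemma joined_descend_pow: "joined (k + n) (2 ^ n * c) \<Longrightarrow> joined k c"
  by (induction n) (auto simp: mult.assoc dest: joined_descend)

lemma unmarked_run:
  assumes "i + a < q" "\<And>j. i < j \<Longrightarrow> j \<le> i + a \<Longrightarrow> j \<notin> marks k" "s < hgt k i"
  shows "(sig k ^^ s) (i + a) = (sig k ^^ s) i + a \<and> hgt k (i + a) = hgt k i"
  using assms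
proof (induction a)
  case (Suc a)
  then show ?case using unmarked[of "i + Suc a" k] by auto
qed simp

text \<open>A block floor is a run of at most \<open>q\<close> adjacent cells, and the boundaries between them are joined.\<close>

lemma same_block:
  assumes "i < q" "i' < q" "block k i = block k i'" "s < hgt k i" "s < hgt k i'"
    and less: "(sig k ^^ s) i' < (sig k ^^ s) i"
  shows "(sig k ^^ s) i < (sig k ^^ s) i' + q"
    "\<And>a. (sig k ^^ s) i' < a \<Longrightarrow> a \<le> (sig k ^^ s) i \<Longrightarrow> joined k a"
proof -
  have free: "j \<notin> marks k" if "x < j" "j \<le> y" "block k x = block k y" for j x y
    using block_start_ge[of j "marks k" y] block_start_le[of "marks k" x] that by auto
  have "i' < i"
  proof (rule ccontr)
    assume "\<not> i' < i"
    then have i: "i' = i + (i' - i)" by simp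
    have "(sig k ^^ s) (i + (i' - i)) = (sig k ^^ s) i + (i' - i)"
      using unmarked_run[of i "i' - i" k s] free[of i _ i'] assms i by simp
    then show False using less i by simp
  qed
  then obtain d where d: "i = i' + d" by (metis less_imp_add_positive)
  have run: "(sig k ^^ s) (i' + a) = (sig k ^^ s) i' + a \<and> hgt k (i' + a) = hgt k i'" if "a \<le> d" for a
    using unmarked_run[of i' a k s] free[of i' _ i] assms d that by simp
  show "(sig k ^^ s) i < (sig k ^^ s) i' + q" using run[of d] d assms by simp
  fix a assume a: "(sig k ^^ s) i' < a" "a \<le> (sig k ^^ s) i"
  then obtain b where b: "a = (sig k ^^ s) i' + b" "0 < b" by (metis less_imp_add_positive)
  then have "b \<le> d" using a run[of d] d by simp
  then show "joined k a"
    unfolding joined_def using run[of b] b assms d free[of i' "i' + b" i]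
    by (intro exI[of _ "i' + b"] conjI exI[of _ s]) auto
qed

text \<open>An image is in the base of the finer level only if it was in the right half before the halves
  were exchanged. So its distance from the last base cell \<open>q - 1\<close> is halved on passing to the parent.\<close>

lemma top_contract:
  "sig (k + n) c < q \<Longrightarrow> sig k (c div 2 ^ n) < q \<and> q - 1 - sig k (c div 2 ^ n) = (q - 1 - sig (k + n) c) div 2 ^ n"
proof (induction n arbitrary: c)
  case (Suc n)
  define d where "d = sig (k + n) (c div 2)"
  define e where "e = 2 * d + c mod 2"
  have s: "sig (k + Suc n) c = swap_halves q e" by (simp add: doubled_def d_def e_def)
  then have e: "q \<le> e" "e < 2 * q" "sig (k + Suc n) c = e - q"
    using Suc.prems by (auto simp: swap_halves_def split: if_splits)
  then have d: "d < q" "q - 1 - d = (q - 1 - sig (k + Suc n) c) div 2"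
    by (auto simp: e_def)
  have "sig k (c div 2 div 2 ^ n) < q \<and> q - 1 - sig k (c div 2 div 2 ^ n) = (q - 1 - d) div 2 ^ n"
    using Suc.IH[of "c div 2"] d(1) by (simp add: d_def)
  then show ?case using d(2) by (simp add: div_mult2_eq)
qed simp

lemma less_pow2: "q < 2 ^ q" by (rule less_exp)

lemma top_contract_q:
  assumes "sig (k + q) c < q"
  shows "sig k (c div 2 ^ q) = q - 1"
proof -
  have "(q - 1 - sig (k + q) c) div 2 ^ q = 0" using less_pow2 by (intro div_less) linarith
  then show ?thesis using top_contract[OF assms] by linarith
qed

lemma states_preperiodic:
  "\<exists>a p. 1 \<le> p \<and> (\<forall>k\<ge>a. rho k = rho (k + p) \<and> marks k = marks (k + p))"
proof -
  define flr where "flr k = (rho k, marks k)" for k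
  have "finite (range flr)"
  proof (rule finite_subset)
    show "range flr \<subseteq> {r. r permutes {..<q}} \<times> Pow {..<q}"
      using S.return_map_permutes marks_less by (auto simp: flr_def)
    show "finite ({r. r permutes {..<q}} \<times> Pow {..<q})" by (intro finite_cartesian_product finite_permutations) auto
  qed
  then have "\<not> inj flr" using range_inj_infinite by blast
  then obtain a b where ab: "flr a = flr b" "a < b"
    unfolding inj_def by (metis linorder_neqE_nat)
  have "flr (a + n) = flr (b + n)" for n
  proof (induction n)
    case (Suc n)
    then show ?case unfolding flr_def prod.inject add_Suc_right rho_Suc marks.simps by simp
  qed (simp add: ab(1))
  note shift = this
  have "flr k = flr (k + (b - a))" if "a \<le> k" for k
  proof -
    have "k + (b - a) = b + (k - a)" using that ab(2) by simp
    then show ?thesis using shift[of "k - a"] that by simp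
  qed
  then have "rho k = rho (k + (b - a)) \<and> marks k = marks (k + (b - a))" if "a \<le> k" for k
    using that unfolding flr_def prod.inject by blast
  moreover have "1 \<le> b - a" using ab(2) by simp
  ultimately show ?thesis by blast
qed

end

section \<open>The odometer\<close>

lemma odometer_eq:
  assumes "1 \<le> n" "x \<in> {1 - 2 / 2 ^ n ..< 1 - 1 / 2 ^ n}"
  shows "odometer x = x - (1 - 3 / 2 ^ n)"
proof -
  have disj: False if "m < n" "x < 1 - 1 / 2 ^ m" "1 - 2 / 2 ^ n \<le> x" for m n :: nat
  proof -
    have "(2::real) ^ Suc m \<le> 2 ^ n" using that by (intro power_increasing) auto
    then have "2 / 2 ^ n \<le> (2::real) / 2 ^ Suc m" by (intro divide_left_mono) auto
    then show False using that by simp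
  qed
  have "(THE n::nat. 1 \<le> n \<and> x \<in> {1 - 2 / 2 ^ n ..< 1 - 1 / 2 ^ n}) = n"
  proof (rule the_equality)
    fix m :: nat assume m: "1 \<le> m \<and> x \<in> {1 - 2 / 2 ^ m ..< 1 - 1 / 2 ^ m}"
    then show "m = n" using disj[of m n] disj[of n m] assms by (cases m n rule: linorder_cases) auto
  qed (use assms in auto)
  then show ?thesis by (simp add: odometer_def)
qed

lemma odometer_index:
  fixes x :: real
  assumes "0 \<le> x" "x < 1"
  obtains n :: nat where "1 \<le> n" "x \<in> {1 - 2 / 2 ^ n ..< 1 - 1 / 2 ^ n}"
proof -
  obtain m where "(1/2) ^ m < 1 - x" using real_arch_pow_inv[of "1 - x" "1/2"] assms by auto
  then have ex: "\<exists>m. x < 1 - 1 / 2 ^ m" by (auto simp: power_divide field_simps)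
  define n where "n = (LEAST m. x < 1 - 1 / 2 ^ m)"
  have n: "x < 1 - 1 / 2 ^ n" unfolding n_def using ex by (rule LeastI_ex)
  obtain m where m: "n = Suc m" using n assms by (cases n) auto
  have "\<not> x < 1 - 1 / 2 ^ m" using not_less_Least[of m "\<lambda>m. x < 1 - 1 / 2 ^ m"] m by (simp add: n_def)
  then show ?thesis using n m by (intro that[of n]) auto
qed

lemma odometer_left: "0 \<le> x \<Longrightarrow> x < 1 / 2 \<Longrightarrow> odometer x = x + 1 / 2"
  using odometer_eq[of 1 x] by simp

text \<open>Self-similarity of the odometer.\<close>

lemma odometer_right:
  assumes "1 / 2 \<le> x" "x < 1"
  shows "odometer x = odometer (2 * x - 1) / 2"
proof -
  obtain n :: nat where n: "1 \<le> n" "2 * x - 1 \<in> {1 - 2 / 2 ^ n ..< 1 - 1 / 2 ^ n}"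
    using odometer_index[of "2 * x - 1"] assms by auto
  then have "x \<in> {1 - 2 / 2 ^ Suc n ..< 1 - 1 / 2 ^ Suc n}" by auto
  then have x: "odometer x = x - (1 - 3 / 2 ^ Suc n)" by (intro odometer_eq) auto
  define w where "w = 3 / (2::real) ^ n"
  have "odometer x = x - (1 - w / 2)" unfolding x by (simp add: w_def)
  moreover have "odometer (2 * x - 1) = 2 * x - 1 - (1 - w)" using odometer_eq[OF n] by (simp only: w_def)
  ultimately show ?thesis by (simp add: field_simps)
qed

lemma odometer_range: "0 \<le> x \<Longrightarrow> x < 1 \<Longrightarrow> 0 < odometer x \<and> odometer x < 1"
proof -
  assume "0 \<le> x" "x < 1"
  then obtain n :: nat where n: "1 \<le> n" "x \<in> {1 - 2 / 2 ^ n ..< 1 - 1 / 2 ^ n}" by (rule odometer_index)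
  have "(2::real) ^ 1 \<le> 2 ^ n" using n(1) by (intro power_increasing) auto
  then have "2 / 2 ^ n \<le> (1::real)" by simp
  moreover have "0 < 1 / (2::real) ^ n" by simp
  moreover have "2 / 2 ^ n = 2 * (1 / (2::real) ^ n)" "3 / 2 ^ n = 3 * (1 / (2::real) ^ n)" by simp_all
  ultimately show ?thesis using n(2) odometer_eq[OF n] unfolding atLeastLessThan_iff by linarith
qed

lemma odometer_inj: "inj_on odometer {0..<1}"
proof (rule inj_onI)
  fix x y :: real assume xy: "x \<in> {0..<1}" "y \<in> {0..<1}" "odometer x = odometer y"
  obtain n :: nat where n: "1 \<le> n" "x \<in> {1 - 2 / 2 ^ n ..< 1 - 1 / 2 ^ n}" using xy(1) odometer_index[of x] by auto
  obtain m :: nat where m: "1 \<le> m" "y \<in> {1 - 2 / 2 ^ m ..< 1 - 1 / 2 ^ m}" using xy(2) odometer_index[of y] by auto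
  note ox = odometer_eq[OF n] and oy = odometer_eq[OF m]
  have disj: False if "m < n" "z < 2 / 2 ^ n" "1 / 2 ^ m \<le> z" for z :: real and m n :: nat
  proof -
    have "(2::real) ^ Suc m \<le> 2 ^ n" using that by (intro power_increasing) auto
    then have "2 / 2 ^ n \<le> (2::real) / 2 ^ Suc m" by (intro divide_left_mono) auto
    then show False using that by simp
  qed
  have split: "3 / (2::real) ^ n = 1 / 2 ^ n + 2 / 2 ^ n" for n
    by (metis add_divide_distrib one_add_one numeral_Bit1 numeral_One one_plus_numeral semiring_norm(3))
  have "1 / 2 ^ n \<le> odometer x" "odometer x < 2 / 2 ^ n" "1 / 2 ^ m \<le> odometer x" "odometer x < 2 / 2 ^ m"
    using n(2) m(2) ox oy xy(3) split[of n] split[of m] unfolding atLeastLessThan_iff by linarith+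
  then have "m = n" using disj[of m n] disj[of n m] by (cases m n rule: linorder_cases) auto
  show "x = y" using ox oy xy(3) unfolding \<open>m = n\<close> by linarith
qed

lemma odometer_endpoint: "odometer (1 - 1 / 2 ^ n) = 1 / 2 ^ Suc n"
  using odometer_eq[of "Suc n" "1 - 1 / 2 ^ n"] by (simp add: field_simps)

lemma odometer_local:
  assumes z: "0 \<le> z" "z < 1" "\<And>n::nat. z \<noteq> 1 - 1 / 2 ^ n"
  shows "\<exists>\<delta>>0. \<forall>y. \<bar>y - z\<bar> < \<delta> \<longrightarrow> odometer y = odometer z + (y - z)"
proof -
  obtain n :: nat where n: "1 \<le> n" "z \<in> {1 - 2 / 2 ^ n ..< 1 - 1 / 2 ^ n}" using odometer_index[OF z(1,2)] by auto
  obtain m where m: "n = Suc m" using n(1) by (cases n) auto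
  have "z \<noteq> 1 - 2 / 2 ^ n" using z(3)[of m] m by simp
  then have lt: "1 - 2 / 2 ^ n < z" "z < 1 - 1 / 2 ^ n" using n by auto
  define \<delta> where "\<delta> = min (z - (1 - 2 / 2 ^ n)) (1 - 1 / 2 ^ n - z)"
  have "odometer y = odometer z + (y - z)" if "\<bar>y - z\<bar> < \<delta>" for y
  proof -
    have "y \<in> {1 - 2 / 2 ^ n ..< 1 - 1 / 2 ^ n}" using that by (auto simp: \<delta>_def)
    then show ?thesis using odometer_eq[OF n(1)] n(2) by simp
  qed
  moreover have "\<delta> > 0" using lt by (simp add: \<delta>_def)
  ultimately show ?thesis by blast
qed

context rotation_perm
begin

section \<open>The rotated odometer on cells\<close>

abbreviation F :: "real \<Rightarrow> real" where "F \<equiv> rot_odometer q \<pi>"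

abbreviation R :: "real \<Rightarrow> real" where "R \<equiv> rotation q \<pi>"

abbreviation DD :: "real set" where "DD \<equiv> D q \<pi>"

definition cell :: "nat \<Rightarrow> real \<Rightarrow> nat" where
  "cell k x = nat \<lfloor>real (Q k) * x\<rfloor>"

lemma Q_pos: "0 < real (Q k)" using q_pos by simp

lemma cell_bounds:
  assumes "0 \<le> x"
  shows "real (cell k x) \<le> real (Q k) * x" "real (Q k) * x < real (cell k x) + 1"
proof -
  have "0 \<le> real (Q k) * x" using assms Q_pos[of k] by simp
  then show "real (cell k x) \<le> real (Q k) * x" "real (Q k) * x < real (cell k x) + 1"
    unfolding cell_def by linarith+
qed

lemma cell_eqI: "real c \<le> real (Q k) * x \<Longrightarrow> real (Q k) * x < real c + 1 \<Longrightarrow> cell k x = c"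
  unfolding cell_def by linarith

lemma cell_grid: "cell k (real c / real (Q k)) = c"
  by (rule cell_eqI) (use Q_pos[of k] in auto)

lemma cell_less:
  assumes "0 \<le> x" "x < 1"
  shows "cell k x < Q k"
proof -
  have "real (Q k) * x < real (Q k) * 1" using assms Q_pos[of k] by (intro mult_strict_left_mono) auto
  then have "real (cell k x) < real (Q k)" using cell_bounds(1)[OF assms(1), of k] by linarith
  then show ?thesis by (simp only: of_nat_less_iff)
qed

lemma cell_Suc_div:
  assumes "0 \<le> x"
  shows "cell (Suc k) x div 2 = cell k x"
proof (rule cell_eqI[symmetric])
  let ?c = "cell (Suc k) x"
  have b: "real ?c \<le> 2 * (real (Q k) * x)" "2 * (real (Q k) * x) < real ?c + 1"
    using cell_bounds[OF assms, of "Suc k"] by (simp_all add: mult_ac)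
  have "2 * (?c div 2) \<le> ?c" by simp
  then have "real (2 * (?c div 2)) \<le> real ?c" by (simp only: of_nat_le_iff)
  then show "real (?c div 2) \<le> real (Q k) * x" using b by simp
  have "c + 1 \<le> 2 * (c div 2) + 2" for c :: nat by presburger
  from this[of ?c] have "real ?c + 1 \<le> 2 * real (?c div 2) + 2" by linarith
  then show "real (Q k) * x < real (?c div 2) + 1" using b by linarith
qed

lemma rotation_eq: "R x = x + (real (\<pi> (cell 0 x)) - real (cell 0 x)) / real q"
  by (simp add: rotation_def Let_def cell_def diff_divide_distrib)

lemma rotation_range:
  assumes "0 \<le> x" "x < 1"
  shows "0 \<le> R x" "R x < 1" "cell 0 (R x) = \<pi> (cell 0 x)"
proof -
  let ?i = "cell 0 x"
  have "?i < q" using cell_less[OF assms, of 0] by simp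
  then have "\<pi> ?i < q" using permutes_in_image[OF perm, of ?i] by simp
  then have pi: "real (\<pi> ?i) + 1 \<le> real q" by linarith
  have q0: "0 < real q" using q_pos by simp
  have m: "real q * R x = real q * x + (real (\<pi> ?i) - real ?i)"
    unfolding rotation_eq using q0 by (simp add: distrib_left)
  have b: "real ?i \<le> real q * x" "real q * x < real ?i + 1" using cell_bounds[OF assms(1), of 0] by simp_all
  show c: "cell 0 (R x) = \<pi> ?i" by (rule cell_eqI) (use m b in simp_all)
  have "0 \<le> real q * R x" "real q * R x < real q * 1" using m b pi by linarith+
  then show "0 \<le> R x" "R x < 1" using q0 by (simp_all add: zero_le_mult_iff)
qed

lemma rotation_inj: "inj_on R {0..<1}"
proof (rule inj_onI)
  fix x y :: real assume a: "x \<in> {0..<1}" "y \<in> {0..<1}" "R x = R y"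
  then have "\<pi> (cell 0 x) = \<pi> (cell 0 y)" using rotation_range(3)[of x] rotation_range(3)[of y] by auto
  then have "cell 0 x = cell 0 y" using permutes_inj[OF perm] by (auto dest: injD)
  then show "x = y" using a(3) by (simp add: rotation_eq)
qed

lemma rotation_surj:
  assumes "0 \<le> y" "y < 1"
  shows "\<exists>x\<in>{0..<1}. R x = y \<and> x = y + (real (inv \<pi> (cell 0 y)) - real (cell 0 y)) / real q"
proof -
  let ?j = "cell 0 y" let ?i = "inv \<pi> ?j"
  have j: "?j < q" using cell_less[OF assms, of 0] by simp
  then have i: "?i < q" using permutes_in_image[OF permutes_inv[OF perm], of ?j] by simp
  have q0: "0 < real q" using q_pos by simp
  define x where "x = y + (real ?i - real ?j) / real q"
  have m: "real q * x = real q * y + (real ?i - real ?j)"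
    unfolding x_def using q0 by (simp add: distrib_left)
  have b: "real ?j \<le> real q * y" "real q * y < real ?j + 1" using cell_bounds[OF assms(1), of 0] by simp_all
  have c: "cell 0 x = ?i" by (rule cell_eqI) (use m b in simp_all)
  have "real ?i + 1 \<le> real q" using i by linarith
  then have "0 \<le> real q * x" "real q * x < real q * 1" using m b by linarith+
  then have "x \<in> {0..<1}" using q0 by (simp add: zero_le_mult_iff)
  moreover have "R x = y"
    unfolding rotation_eq c using permutes_inverses(1)[OF perm] by (simp add: x_def diff_divide_distrib)
  ultimately show ?thesis unfolding x_def by blast
qed

lemma rotation_inv:
  assumes "0 \<le> y" "y < 1"
  shows "rotation_inv q \<pi> y \<in> {0..<1}" "R (rotation_inv q \<pi> y) = y"
    "rotation_inv q \<pi> y = y + (real (inv \<pi> (cell 0 y)) - real (cell 0 y)) / real q"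
proof -
  obtain x where x: "x \<in> {0..<1}" "R x = y" "x = y + (real (inv \<pi> (cell 0 y)) - real (cell 0 y)) / real q"
    using rotation_surj[OF assms] by blast
  then have "rotation_inv q \<pi> y = x" unfolding rotation_inv_def using inv_into_f_f[OF rotation_inj] by blast
  then show "rotation_inv q \<pi> y \<in> {0..<1}" "R (rotation_inv q \<pi> y) = y"
    "rotation_inv q \<pi> y = y + (real (inv \<pi> (cell 0 y)) - real (cell 0 y)) / real q" using x by auto
qed

text \<open>By induction on the level: a cell sent into the base is halved, and \<open>odometer_left\<close> and
  \<open>odometer_right\<close> carry out the exchange of the two halves.\<close>

lemma F_cell_aux:
  assumes x: "0 \<le> x" "x < 1"
  defines "c k \<equiv> real (cell k x)" and "d k \<equiv> real (sig k (cell k x))"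
  shows "(q \<le> sig k (cell k x) \<longrightarrow> F x = x + (d k - c k) / real (Q k)) \<and>
    (sig k (cell k x) < q \<longrightarrow> 0 \<le> 2 ^ k * x + (d k - c k) / real q \<and> 2 ^ k * x + (d k - c k) / real q < 1 \<and>
       F x = odometer (2 ^ k * x + (d k - c k) / real q) / 2 ^ k)"
proof (induction k)
  case 0
  have "cell 0 x < q" using cell_less[OF x, of 0] by simp
  then have "\<pi> (cell 0 x) < q" using permutes_in_image[OF perm, of "cell 0 x"] by simp
  then show ?case using rotation_range[OF x] by (simp add: rot_odometer_def rotation_eq c_def d_def)
next
  case (Suc k)
  define C where "C = cell k x"
  define C' where "C' = cell (Suc k) x"
  define b where "b = C' mod 2"
  define E where "E = 2 * sig k C + b"
  have div: "C' div 2 = C" using cell_Suc_div[OF x(1)] by (simp add: C_def C'_def)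
  have C': "C' = 2 * C + b" using div unfolding b_def by presburger
  have s: "sig (Suc k) C' = swap_halves q E" by (simp add: doubled_def div E_def b_def)
  have q0: "0 < real q" using q_pos by simp
  have bnd: "real C' \<le> 2 * 2 ^ k * real q * x" "2 * 2 ^ k * real q * x < real C' + 1"
    using cell_bounds[OF x(1), of "Suc k"] by (simp_all add: C'_def mult_ac)
  have b2: "b < 2" by (simp add: b_def)
  show ?case
  proof (cases "q \<le> sig k C")
    case True
    then have "2 * q \<le> E" by (simp add: E_def)
    then have sE: "sig (Suc k) C' = E" using s by (simp add: swap_halves_def)
    have "F x = x + (real (sig k C) - real C) / real (Q k)" using Suc True by (simp add: c_def d_def C_def)
    also have "(real (sig k C) - real C) / real (Q k) = (real E - real C') / real (Q (Suc k))"
      using q0 by (simp add: E_def C' field_simps)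
    finally show ?thesis using \<open>2 * q \<le> E\<close> sE by (simp add: c_def d_def C'_def[symmetric] del: sig.simps)
  next
    case False
    define y where "y = 2 ^ k * x + (real (sig k C) - real C) / real q"
    have y: "0 \<le> y" "y < 1" "F x = odometer y / 2 ^ k"
      using Suc False by (auto simp: c_def d_def C_def y_def)
    have qy: "2 * real q * y = 2 * 2 ^ k * real q * x + real E - real C'"
      using q0 by (simp add: y_def E_def C' field_simps)
    have E2: "E < 2 * q" using False b2 by (simp add: E_def)
    show ?thesis
    proof (cases "E < q")
      case True
      then have "real E + 1 \<le> real q" by linarith
      then have "2 * real q * y < real q" using qy bnd by linarith
      then have "y < 1 / 2" using q0 by (simp add: field_simps)
      then have "F x = (y + 1 / 2) / 2 ^ k" using y odometer_left by simp
      also have "\<dots> = x + (real (E + q) - real C') / real (Q (Suc k))"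
        using q0 by (simp add: y_def E_def C' field_simps)
      finally show ?thesis using s True by (simp add: swap_halves_def c_def d_def C'_def[symmetric] del: sig.simps)
    next
      case False
      then have "real q \<le> real E" by simp
      then have "real q \<le> 2 * real q * y" using qy bnd by linarith
      then have "1 / 2 \<le> y" using q0 by (simp add: field_simps)
      then have "F x = odometer (2 * y - 1) / 2 ^ Suc k" and y': "0 \<le> 2 * y - 1" "2 * y - 1 < 1"
        using y odometer_right by simp_all
      moreover have "2 * y - 1 = 2 ^ Suc k * x + (real (E - q) - real C') / real q"
        using q0 False by (simp add: y_def E_def C' field_simps of_nat_diff)
      moreover have sE: "sig (Suc k) C' = E - q" using s False E2 by (simp add: swap_halves_def)
      moreover have "E - q < q" using E2 False by simp
      ultimately show ?thesis
        unfolding c_def d_def C'_def[symmetric] sE by (intro conjI impI) (simp_all only: linorder_not_le[symmetric] not_True_eq_False)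
    qed
  qed
qed

lemma F_up:
  assumes "0 \<le> x" "x < 1" "q \<le> sig k (cell k x)"
  shows "F x = x + (real (sig k (cell k x)) - real (cell k x)) / real (Q k)"
  using F_cell_aux[OF assms(1,2), of k] assms(3) by simp

lemma F_top:
  assumes "0 \<le> x" "x < 1" "sig k (cell k x) < q"
  shows "F x = odometer (2 ^ k * x + (real (sig k (cell k x)) - real (cell k x)) / real q) / 2 ^ k"
    "0 < F x" "F x < 1 / 2 ^ k"
proof -
  show 1: "F x = odometer (2 ^ k * x + (real (sig k (cell k x)) - real (cell k x)) / real q) / 2 ^ k"
    using F_cell_aux[OF assms(1,2), of k] assms(3) by simp
  have "0 < F x * 2 ^ k" "F x * 2 ^ k < 1"
    using F_cell_aux[OF assms(1,2), of k] assms(3) odometer_range[of "2 ^ k * x + (real (sig k (cell k x)) - real (cell k x)) / real q"]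
    by auto
  then show "0 < F x" "F x < 1 / 2 ^ k" by (simp_all add: zero_less_mult_iff field_simps)
qed

lemma F_range:
  assumes "0 \<le> x" "x < 1"
  shows "0 < F x" "F x < 1"
  using odometer_range[OF rotation_range(1,2)[OF assms]] by (simp_all add: rot_odometer_def)

lemma F_inj: "\<lbrakk>0 \<le> x; x < 1; 0 \<le> y; y < 1; F x = F y\<rbrakk> \<Longrightarrow> x = y"
  using inj_onD[OF odometer_inj, of "R x" "R y"] rotation_range[of x] rotation_range[of y]
    inj_onD[OF rotation_inj, of x y] by (simp add: rot_odometer_def)

lemma cell_F:
  assumes "0 \<le> x" "x < 1" "q \<le> sig k (cell k x)"
  shows "cell k (F x) = sig k (cell k x)"
proof (rule cell_eqI)
  have "real (Q k) * F x = real (Q k) * x + (real (sig k (cell k x)) - real (cell k x))"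
    unfolding F_up[OF assms] using q_pos by (simp add: distrib_left)
  then show "real (sig k (cell k x)) \<le> real (Q k) * F x" "real (Q k) * F x < real (sig k (cell k x)) + 1"
    using cell_bounds[OF assms(1), of k] by linarith+
qed

lemma grid_ge: "q \<le> c \<Longrightarrow> 1 / 2 ^ k \<le> real c / real (Q k)"
  using q_pos by (simp add: field_simps)

lemma up_iff:
  assumes "0 \<le> x" "x < 1"
  shows "q \<le> sig k (cell k x) \<longleftrightarrow> 1 / 2 ^ k \<le> F x"
proof
  assume a: "q \<le> sig k (cell k x)"
  have "real (sig k (cell k x)) \<le> real (Q k) * F x"
    using cell_bounds(1)[of "F x" k] cell_F[OF assms a] F_range[OF assms] by simp
  then have "real (sig k (cell k x)) / real (Q k) \<le> F x" using Q_pos[of k] by (simp add: field_simps)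
  then show "1 / 2 ^ k \<le> F x" using grid_ge[OF a, of k] by linarith
next
  assume "1 / 2 ^ k \<le> F x"
  then show "q \<le> sig k (cell k x)" using F_top(3)[OF assms, of k] by linarith
qed

lemma small_cell: "0 \<le> x \<Longrightarrow> x < 1 / 2 ^ k \<Longrightarrow> cell k x < q"
proof -
  assume a: "0 \<le> x" "x < 1 / 2 ^ k"
  then have "real (Q k) * x < real q" using q_pos by (simp add: field_simps)
  then show ?thesis using cell_bounds(1)[OF a(1), of k] by linarith
qed

lemma cell_F_top: "\<lbrakk>0 \<le> x; x < 1; sig k (cell k x) < q\<rbrakk> \<Longrightarrow> cell k (F x) < q"
  using F_top[of x k] small_cell[of "F x" k] by simp

lemma F_pow_range: "0 \<le> x \<Longrightarrow> x < 1 \<Longrightarrow> 0 \<le> (F ^^ n) x \<and> (F ^^ n) x < 1"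
  by (induction n) (auto dest: F_range less_imp_le)

lemma F_pow_cell:
  assumes x: "0 \<le> x" "x < 1" and up: "\<And>j. 1 \<le> j \<Longrightarrow> j \<le> s \<Longrightarrow> q \<le> (sig k ^^ j) (cell k x)"
  shows "(F ^^ s) x = x + (real ((sig k ^^ s) (cell k x)) - real (cell k x)) / real (Q k) \<and>
    cell k ((F ^^ s) x) = (sig k ^^ s) (cell k x)"
  using up
proof (induction s)
  case (Suc s)
  then have IH: "(F ^^ s) x = x + (real ((sig k ^^ s) (cell k x)) - real (cell k x)) / real (Q k)"
    "cell k ((F ^^ s) x) = (sig k ^^ s) (cell k x)" by auto
  let ?y = "(F ^^ s) x"
  have y: "0 \<le> ?y" "?y < 1" using F_pow_range[OF x] by auto
  have u: "q \<le> sig k (cell k ?y)" using IH(2) Suc.prems[of "Suc s"] by simp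
  show ?case using F_up[OF y u] cell_F[OF y u] IH by (simp add: diff_divide_distrib add_divide_distrib)
qed simp

lemma F_pow_tower:
  assumes x: "0 \<le> x" "x < 1" "cell k x < q" and s: "s < hgt k (cell k x)"
  shows "(F ^^ s) x = x + (real ((sig k ^^ s) (cell k x)) - real (cell k x)) / real (Q k)"
    "cell k ((F ^^ s) x) = (sig k ^^ s) (cell k x)"
proof -
  have "q \<le> (sig k ^^ j) (cell k x)" if "1 \<le> j" "j \<le> s" for j
    using S.before_return[OF x(3) that(1), of k] that(2) s by simp
  then show "(F ^^ s) x = x + (real ((sig k ^^ s) (cell k x)) - real (cell k x)) / real (Q k)"
    "cell k ((F ^^ s) x) = (sig k ^^ s) (cell k x)"
    using F_pow_cell[OF x(1,2), of s k] by blast+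
qed

section \<open>Periodic points\<close>

abbreviation Per :: "real set" where "Per \<equiv> I_per q \<pi>"

lemma Per_F: "0 \<le> x \<Longrightarrow> x < 1 \<Longrightarrow> F x \<in> Per \<longleftrightarrow> x \<in> Per"
proof
  assume x: "0 \<le> x" "x < 1"
  { assume "F x \<in> Per"
    then obtain n where n: "n \<ge> 1" "(F ^^ n) (F x) = F x" by (auto simp: I_per_def)
    then have "F ((F ^^ n) x) = F x" by (simp add: funpow_swap1)
    then have "(F ^^ n) x = x" using F_inj[of "(F ^^ n) x" x] F_pow_range[OF x, of n] x by blast
    then show "x \<in> Per" using n(1) x unfolding I_per_def by auto }
  { assume "x \<in> Per"
    then obtain n where n: "n \<ge> 1" "(F ^^ n) x = x" by (auto simp: I_per_def)
    then have "(F ^^ n) (F x) = F x" by (metis funpow_swap1)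
    then show "F x \<in> Per" using n(1) F_range[OF x] unfolding I_per_def by auto }
qed

lemma Per_F_pow: "0 \<le> x \<Longrightarrow> x < 1 \<Longrightarrow> (F ^^ n) x \<in> Per \<longleftrightarrow> x \<in> Per"
proof (induction n)
  case (Suc n)
  then show ?case using F_pow_range[of x n] Per_F[of "(F ^^ n) x"] by simp
qed simp

text \<open>\<open>0\<close> is not in the range of \<open>F\<close>.\<close>

lemma zero_not_Per: "0 \<notin> Per"
proof
  assume "0 \<in> Per"
  then obtain n where n: "n \<ge> 1" "(F ^^ n) 0 = 0" by (auto simp: I_per_def)
  then obtain m where "n = Suc m" by (cases n) auto
  then show False using n F_range[of "(F ^^ m) 0"] F_pow_range[of 0 m] by simp
qed

lemma not_in_tower_Per:
  assumes x: "0 \<le> x" "x < 1" and "\<not> in_tower q (sig k) (cell k x)"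
  shows "x \<in> Per"
proof -
  obtain n where n: "n \<ge> 1" "(sig k ^^ n) (cell k x) = cell k x"
    using S.pow_cycle[OF cell_less[OF x], of k] by auto
  have "(F ^^ n) x = x"
    using F_pow_cell[OF x, of n k] S.not_in_tower[OF assms(3)] n by simp
  then show ?thesis using n(1) x unfolding I_per_def by auto
qed

section \<open>The set D is invariant\<close>

lemma endpoint_range: "0 \<le> 1 - 1 / (2::real) ^ n" "1 - 1 / (2::real) ^ n < 1"
  by (simp_all add: field_simps)

lemma D0_range: "D0 q \<pi> \<subseteq> {0..<1}"
  using rotation_inv(1)[OF endpoint_range] by (auto simp: D0_def)

lemma D_range: "DD \<subseteq> {0..<1}"
  using D0_range F_pow_range by (fastforce simp: D_def)

lemma D0_D: "D0 q \<pi> \<subseteq> DD"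
  unfolding D_def by (auto intro!: exI[of _ "0::nat"])

lemma zero_D: "0 \<in> DD"
  using D0_D by (auto simp: D0_def)

lemma D_F: "x \<in> DD \<Longrightarrow> F x \<in> DD"
  unfolding D_def
proof (elim UnE)
  assume "x \<in> {(F ^^ n) x |n x. x \<in> D0 q \<pi>}"
  then obtain n y where "x = (F ^^ n) y" "y \<in> D0 q \<pi>" by auto
  then have "F x = (F ^^ Suc n) y" by simp
  then show "F x \<in> {(F ^^ n) x |n x. x \<in> D0 q \<pi>} \<union> {y \<in> {0..<1}. \<exists>n. (F ^^ n) y \<in> D0 q \<pi> - {0}}"
    using \<open>y \<in> D0 q \<pi>\<close> by blast
next
  assume "x \<in> {y \<in> {0..<1}. \<exists>n. (F ^^ n) y \<in> D0 q \<pi> - {0}}"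
  then obtain n where n: "x \<in> {0..<1}" "(F ^^ n) x \<in> D0 q \<pi> - {0}" by auto
  show "F x \<in> {(F ^^ n) x |n x. x \<in> D0 q \<pi>} \<union> {y \<in> {0..<1}. \<exists>n. (F ^^ n) y \<in> D0 q \<pi> - {0}}"
  proof (cases n)
    case 0
    then have "F x = (F ^^ 1) x" "x \<in> D0 q \<pi>" using n by auto
    then show ?thesis by blast
  next
    case (Suc m)
    then have "(F ^^ m) (F x) \<in> D0 q \<pi> - {0}" using n by (simp add: funpow_swap1)
    then show ?thesis using F_range[of x] n(1) by auto
  qed
qed

text \<open>Together with \<open>D_F\<close> this makes \<open>D\<close> fully invariant. The point \<open>0\<close>, whose backward orbit
  is left out of \<open>D\<close>, has no preimage.\<close>

lemma D_F_back:
  assumes x: "0 \<le> x" "x < 1" and "F x \<in> DD"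
  shows "x \<in> DD"
  using assms(3) unfolding D_def
proof (elim UnE)
  assume "F x \<in> {(F ^^ n) x |n x. x \<in> D0 q \<pi>}"
  then obtain n y where y: "F x = (F ^^ n) y" "y \<in> D0 q \<pi>" by auto
  then have y1: "0 \<le> y" "y < 1" using D0_range by auto
  show "x \<in> {(F ^^ n) x |n x. x \<in> D0 q \<pi>} \<union> {y \<in> {0..<1}. \<exists>n. (F ^^ n) y \<in> D0 q \<pi> - {0}}"
  proof (cases n)
    case 0
    then have "(F ^^ 1) x \<in> D0 q \<pi> - {0}" using y F_range[OF x] by auto
    then show ?thesis using x by (auto intro!: exI[of _ "1::nat"])
  next
    case (Suc m)
    then have "x = (F ^^ m) y" using y F_inj[OF x, of "(F ^^ m) y"] F_pow_range[OF y1, of m] by simp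
    then show ?thesis using y by blast
  qed
next
  assume "F x \<in> {y \<in> {0..<1}. \<exists>n. (F ^^ n) y \<in> D0 q \<pi> - {0}}"
  then obtain n where "(F ^^ n) (F x) \<in> D0 q \<pi> - {0}" by auto
  then have "(F ^^ Suc n) x \<in> D0 q \<pi> - {0}" by (simp add: funpow_swap1)
  then have "\<exists>n. (F ^^ n) x \<in> D0 q \<pi> - {0}" by (rule exI)
  then show "x \<in> {(F ^^ n) x |n x. x \<in> D0 q \<pi>} \<union> {y \<in> {0..<1}. \<exists>n. (F ^^ n) y \<in> D0 q \<pi> - {0}}"
    using x by simp
qed

lemma D_F_pow: "0 \<le> x \<Longrightarrow> x < 1 \<Longrightarrow> (F ^^ n) x \<in> DD \<longleftrightarrow> x \<in> DD"
proof (induction n)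
  case (Suc n)
  have "F ((F ^^ n) x) \<in> DD \<longleftrightarrow> (F ^^ n) x \<in> DD"
    using D_F D_F_back F_pow_range[OF Suc.prems, of n] by blast
  then show ?case using Suc by simp
qed simp

text \<open>It is the image of \<open>R\<^sup>-\<^sup>1(1 - 2\<^sup>1\<^sup>-\<^sup>n)\<close>. So the base of each level except \<open>0\<close> ends at a point of \<open>D\<close>.\<close>

lemma power_D: "1 \<le> n \<Longrightarrow> 1 / 2 ^ n \<in> DD"
proof -
  assume "1 \<le> n"
  then obtain m where m: "n = Suc m" by (cases n) auto
  have "rotation_inv q \<pi> (1 - 1 / 2 ^ m) \<in> DD" using D0_D by (auto simp: D0_def)
  then have "F (rotation_inv q \<pi> (1 - 1 / 2 ^ m)) \<in> DD" by (rule D_F)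
  then show ?thesis using rotation_inv(2)[OF endpoint_range, of m] odometer_endpoint[of m] m
    by (simp add: rot_odometer_def)
qed

lemma continuous_F: "0 \<le> x \<Longrightarrow> x < 1 \<Longrightarrow> x \<notin> DD \<Longrightarrow> continuous (at x within {0..<1}) F"
  using D0_D by (auto simp: D0_def)

section \<open>Cuts and the set D\<close>

abbreviation grid :: "nat \<Rightarrow> nat \<Rightarrow> real" where "grid k c \<equiv> real c / real (Q k)"

lemma less_Q: "i < q \<Longrightarrow> i < Q k"
  using order.strict_trans2[OF _ S.qQ] .

lemma grid_range: "c < Q k \<Longrightarrow> 0 \<le> grid k c \<and> grid k c < 1"
proof -
  assume "c < Q k"
  then have "real c < real (Q k)" by (simp only: of_nat_less_iff)
  then show ?thesis by simp
qed

lemma grid_Suc: "grid (Suc k) (2 * c) = grid k c"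
  by simp

lemma F_grid: "c < Q k \<Longrightarrow> q \<le> sig k c \<Longrightarrow> F (grid k c) = grid k (sig k c)"
  using F_up[of "grid k c" k] grid_range[of c k] by (simp only: cell_grid) (simp add: diff_divide_distrib)

lemma F_pow_grid:
  assumes "i < q" "s < hgt k i"
  shows "(F ^^ s) (grid k i) = grid k ((sig k ^^ s) i)"
proof -
  have "i < Q k" using assms(1) by (rule less_Q)
  then have "0 \<le> grid k i" "grid k i < 1" using grid_range by auto
  then show ?thesis using F_pow_tower(1)[of "grid k i" k s] assms by (simp only: cell_grid) (simp add: diff_divide_distrib)
qed

lemma grid_q: "grid k q = 1 / 2 ^ k" using q_pos by simp

text \<open>\<open>F\<close> is continuous off \<open>D\<close>, so the value at a grid point outside \<open>D\<close> is seen from the cell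
  to its left.\<close>

lemma left_points:
  assumes c: "c < Q k" "0 < c" and e: "0 < e" and nD: "grid k c \<notin> DD"
  obtains y where "0 \<le> y" "y < 1" "cell k y = c - 1" "\<bar>y - grid k c\<bar> < e" "\<bar>F y - F (grid k c)\<bar> < e"
proof -
  let ?x = "grid k c"
  have x: "0 \<le> ?x" "?x < 1" using grid_range[OF c(1)] by auto
  obtain d where d: "d > 0" "\<And>y. y \<in> {0..<1} \<Longrightarrow> dist y ?x < d \<Longrightarrow> dist (F y) (F ?x) < e"
    using continuous_F[OF x nD] e unfolding continuous_within_eps_delta by blast
  have Qp: "0 < real (Q k)" by (rule Q_pos)
  define m where "m = min (1 / real (Q k)) (min d e)"
  define r where "r = m / 2"
  have m: "0 < m" "m \<le> d" "m \<le> e" "m \<le> 1 / real (Q k)" using d(1) e Qp unfolding m_def by auto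
  then have r: "0 < r" "r < d" "r < e" "r < 1 / real (Q k)" unfolding r_def by linarith+
  define y where "y = ?x - r"
  have rq: "real (Q k) * r < 1" "0 < real (Q k) * r" using r Qp by (simp_all add: field_simps)
  have qy: "real (Q k) * y = real c - real (Q k) * r" using q_pos by (simp add: y_def right_diff_distrib)
  have c1: "real (c - 1) = real c - 1" using c(2) by (simp add: of_nat_diff)
  have "cell k y = c - 1" by (rule cell_eqI) (use qy rq c1 in linarith)+
  moreover have "1 \<le> real c" using c(2) by simp
  then have "0 \<le> real (Q k) * y" using qy rq by linarith
  then have y0: "0 \<le> y" using Qp by (simp only: zero_le_mult_iff) auto
  moreover have y1: "y < 1" using x r(1) by (simp add: y_def)
  moreover have "\<bar>y - ?x\<bar> < e" using r by (simp add: y_def)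
  moreover have "\<bar>F y - F ?x\<bar> < e" using d(2)[of y] y0 y1 r by (simp add: y_def dist_real_def)
  ultimately show ?thesis using that by blast
qed

lemma eq_if_close: "(\<And>e. 0 < e \<Longrightarrow> \<bar>a - b\<bar> < 2 * e) \<Longrightarrow> a = (b::real)"
proof (rule ccontr)
  assume a: "\<And>e. 0 < e \<Longrightarrow> \<bar>a - b\<bar> < 2 * e" "a \<noteq> b"
  have "\<bar>a - b\<bar> < 2 * (\<bar>a - b\<bar> / 2)" using a(2) by (intro a(1)) simp
  then show False by simp
qed

text \<open>Off \<open>D\<close> a cell moves together with its left neighbour. Otherwise the left limit of \<open>F\<close> would
  differ from its value: the two images either are not adjacent or lie on different sides of \<open>2\<^sup>-\<^sup>k \<in> D\<close>.\<close>

lemma uncut_step: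
  assumes c: "c < Q k" and nD: "grid k c \<notin> DD"
  shows "0 < c" "q \<le> sig k c \<longleftrightarrow> q \<le> sig k (c - 1)"
    "q \<le> sig k c \<Longrightarrow> sig k c = Suc (sig k (c - 1))"
proof -
  show c0: "0 < c" using nD zero_D by (cases c) auto
  let ?x = "grid k c"
  have x: "0 \<le> ?x" "?x < 1" using grid_range[OF c] by auto
  have FD: "F ?x \<notin> DD" using D_F_back[OF x] nD by blast
  have Qp: "0 < real (Q k)" by (rule Q_pos)
  have "(q \<le> sig k c \<longleftrightarrow> q \<le> sig k (c - 1)) \<and> (q \<le> sig k c \<longrightarrow> sig k c = Suc (sig k (c - 1)))"
  proof (cases "q \<le> sig k (c - 1)")
    case True
    have "F ?x = grid k (Suc (sig k (c - 1)))"
    proof (rule eq_if_close)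
      fix e :: real assume e: "0 < e"
      obtain y where y: "0 \<le> y" "y < 1" "cell k y = c - 1" "\<bar>y - ?x\<bar> < e" "\<bar>F y - F ?x\<bar> < e"
        using left_points[OF c c0 e nD] .
      have "F y = y + (real (sig k (c - 1)) - real (c - 1)) / real (Q k)"
        using F_up[OF y(1,2), of k] True y(3) by simp
      also have "real (c - 1) = real c - 1" using c0 by (simp add: of_nat_diff)
      finally have Fy: "F y = y - ?x + grid k (Suc (sig k (c - 1)))" by (simp add: diff_divide_distrib add_divide_distrib)
      have "\<bar>a - b\<bar> < 2 * e" if "f = u - x + b" "\<bar>u - x\<bar> < e" "\<bar>f - a\<bar> < e" for a b f u x :: real
        using that by linarith
      from this[OF Fy y(4,5)] show "\<bar>F ?x - grid k (Suc (sig k (c - 1)))\<bar> < 2 * e" .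
    qed
    moreover have "q \<le> Suc (sig k (c - 1))" using True by simp
    ultimately have "1 / 2 ^ k \<le> F ?x" "F ?x = grid k (Suc (sig k (c - 1)))" using grid_ge by metis+
    moreover from this have u: "q \<le> sig k c" using up_iff[OF x, of k] by (simp only: cell_grid)
    ultimately have "grid k (sig k c) = grid k (Suc (sig k (c - 1)))" using F_grid[OF c u] by metis
    then have "sig k c = Suc (sig k (c - 1))" using cell_grid by metis
    then show ?thesis using u True by simp
  next
    case False
    have "F ?x \<le> 1 / 2 ^ k"
    proof (rule field_le_epsilon)
      fix e :: real assume e: "0 < e"
      obtain y where y: "0 \<le> y" "y < 1" "cell k y = c - 1" "\<bar>y - ?x\<bar> < e" "\<bar>F y - F ?x\<bar> < e"
        using left_points[OF c c0 e nD] .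
      have "F y < 1 / 2 ^ k" using F_top(3)[OF y(1,2), of k] y(3) False by simp
      then show "F ?x \<le> 1 / 2 ^ k + e" using y(5) by linarith
    qed
    moreover have "F ?x \<noteq> 1 / 2 ^ k"
    proof (cases k)
      case 0
      then show ?thesis using F_range(2)[OF x] by simp
    next
      case (Suc m)
      then show ?thesis using FD power_D[of k] by auto
    qed
    ultimately have "\<not> q \<le> sig k c" using up_iff[OF x, of k] by (simp only: cell_grid)
    then show ?thesis using False by simp
  qed
  then show "q \<le> sig k c \<longleftrightarrow> q \<le> sig k (c - 1)" "q \<le> sig k c \<Longrightarrow> sig k c = Suc (sig k (c - 1))" by auto
qed

lemma uncut_preimage:
  assumes c: "c < Q k" "q \<le> c" and nD: "grid k c \<notin> DD"
  obtains c' where "c' < Q k" "sig k c' = c" "grid k c' \<notin> DD"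
proof -
  obtain c' where c': "c' < Q k" "sig k c' = c"
    using permutes_image[OF S.perm[of k]] c(1) by (metis imageE lessThan_iff)
  moreover have "grid k c' \<notin> DD" using F_grid[OF c'(1)] D_F[of "grid k c'"] c' c(2) nD by metis
  ultimately show ?thesis using that by blast
qed

text \<open>\<open>swap_halves\<close> can create adjacency only at the images \<open>0\<close> and \<open>q\<close>.\<close>

lemma together_descend:
  assumes c: "0 < c" and s: "sig (Suc k) (2 * c) = Suc (sig (Suc k) (2 * c - 1))"
    and n0: "sig k c \<noteq> 0" "sig k c \<noteq> q"
  shows "sig k c = Suc (sig k (c - 1))"
proof -
  have "(2 * c - 1) div 2 = c - 1" "(2 * c - 1) mod 2 = 1" using c by presburger+
  then have "swap_halves q (2 * sig k c) = Suc (swap_halves q (2 * sig k (c - 1) + 1))"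
    using s by (simp add: doubled_def)
  then show ?thesis using n0 by (auto simp: swap_halves_def split: if_splits)
qed

text \<open>The bases shrink to \<open>0\<close>, and \<open>F x\<close> is positive.\<close>

lemma exists_up:
  assumes "0 \<le> x" "x < 1"
  obtains K where "\<And>k. K \<le> k \<Longrightarrow> q \<le> sig k (cell k x)"
proof -
  obtain K where K: "(1/2) ^ K < F x" using real_arch_pow_inv[of "F x" "1/2"] F_range[OF assms] by auto
  have "q \<le> sig k (cell k x)" if "K \<le> k" for k
  proof -
    have "(1/2::real) ^ k \<le> (1/2) ^ K" using that by (intro power_decreasing) auto
    then have "1 / 2 ^ k \<le> F x" using K by (simp add: power_divide)
    then show ?thesis using up_iff[OF assms] by simp
  qed
  then show ?thesis using that by blast
qed

text \<open>If the endpoint were not in \<open>D\<close>, the two cells meeting there would move together at a deep level,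
  hence at level \<open>0\<close>. The images \<open>0\<close> and \<open>q\<close> on the way down correspond to
  \<open>F x\<close> being a power of \<open>1/2\<close>, which lies in \<open>D\<close>.\<close>

lemma marks_0_D: "i \<in> marks 0 \<Longrightarrow> real i / real q \<in> DD"
proof (rule ccontr)
  assume i: "i \<in> marks 0" and nD: "real i / real q \<notin> DD"
  have iq: "i < q" using i by simp
  have g: "grid k (2 ^ k * i) = real i / real q" for k by simp
  have cQ: "2 ^ k * i < Q k" for k using iq by simp
  have i0: "0 < i" using nD zero_D by (cases i) auto
  have together: "sig k (2 ^ k * i) = Suc (sig k (2 ^ k * i - 1))" if "q \<le> sig k (2 ^ k * i)" for k
    using uncut_step(3)[OF cQ _ that] nD g by simp
  have ne: "sig k (2 ^ k * i) \<noteq> 0" "sig k (2 ^ k * i) \<noteq> q" for k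
  proof -
    let ?x = "grid k (2 ^ k * i)"
    have x: "0 \<le> ?x" "?x < 1" using grid_range[OF cQ] by auto
    have FD: "F ?x \<notin> DD" using D_F_back[OF x] nD g by metis
    show "sig k (2 ^ k * i) \<noteq> 0"
    proof
      assume z: "sig k (2 ^ k * i) = 0"
      have "2 ^ k * ?x = real (2 ^ k * i) / real q" by simp
      then have "2 ^ k * ?x + (real (sig k (2 ^ k * i)) - real (2 ^ k * i)) / real q = 0"
        using z by (simp add: diff_divide_distrib)
      then have "F ?x = odometer 0 / 2 ^ k"
        using F_top(1)[OF x, of k] z q_pos by (simp only: cell_grid)
      then have "F ?x = 1 / 2 ^ Suc k" using odometer_left[of 0] by simp
      then show False using FD power_D[of "Suc k"] by simp
    qed
    show "sig k (2 ^ k * i) \<noteq> q"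
    proof
      assume z: "sig k (2 ^ k * i) = q"
      then have "F ?x = 1 / 2 ^ k" using F_grid[OF cQ, of k] grid_q[of k] by simp
      moreover have "1 \<le> k" using z S.g_less[OF cQ, of k] by (cases k) auto
      ultimately show False using FD power_D[of k] by simp
    qed
  qed
  have down: "sig n (2 ^ n * i) = Suc (sig n (2 ^ n * i - 1))" if "sig k (2 ^ k * i) = Suc (sig k (2 ^ k * i - 1))" "n \<le> k" for n k
    using that(2,1)
  proof (induction n rule: inc_induct)
    case (step n)
    then have "sig (Suc n) (2 * (2 ^ n * i)) = Suc (sig (Suc n) (2 * (2 ^ n * i) - 1))"
      by (simp only: power_Suc mult.assoc)
    then show ?case using together_descend[of "2 ^ n * i" n] ne i0 by simp
  qed
  obtain K where "\<And>k. K \<le> k \<Longrightarrow> q \<le> sig k (cell k (real i / real q))"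
    using exists_up[of "real i / real q"] iq by auto
  then have "q \<le> sig K (2 ^ K * i)" using cell_grid[of K "2 ^ K * i"] g[of K] by (metis order_refl)
  then have "sig 0 (2 ^ 0 * i) = Suc (sig 0 (2 ^ 0 * i - 1))" using down[of K 0] together by blast
  then show False using i i0 by simp
qed

text \<open>Each reason for a mark puts a point of the forward orbit into \<open>D\<close>: an endpoint of a marked
  cell of the previous level, or a point mapped to a power of \<open>1/2\<close>.\<close>

lemma marks_D: "i \<in> marks k \<Longrightarrow> grid k i \<in> DD"
proof (induction k arbitrary: i)
  case 0
  then show ?case using marks_0_D by simp
next
  case (Suc k)
  have i: "i < q" using marks_less[OF Suc.prems] .
  then have iQ: "i < Q (Suc k)" by (rule less_Q)
  have x: "0 \<le> grid (Suc k) i" "grid (Suc k) i < 1" using grid_range[OF iQ] by auto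
  have bwd: "grid (Suc k) i \<in> DD" if "s < hgt (Suc k) i" "grid (Suc k) ((sig (Suc k) ^^ s) i) \<in> DD" for s
    using that F_pow_grid[OF i that(1)] D_F_pow[OF x, of s] by simp
  consider "i = 0" | "rho (Suc k) i = 0"
    | m where "m < return_time q (tau k) i" "even ((tau k ^^ m) i)" "(tau k ^^ m) i div 2 \<in> marks k"
    using Suc.prems unfolding marks.simps next_marks_def rho_Suc mem_Collect_eq by metis
  then show ?case
  proof cases
    case 1
    then show ?thesis using zero_D by simp
  next
    case 2
    obtain s where s: "hgt (Suc k) i = Suc s" using S.return_time_ge1[OF i, of "Suc k"] by (cases "hgt (Suc k) i") auto
    let ?c = "(sig (Suc k) ^^ s) i"
    have z: "sig (Suc k) ?c = 0" using 2 i s by (simp add: return_map_def)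
    have cQ: "?c < Q (Suc k)" using S.pow_less[OF iQ] .
    have y: "0 \<le> grid (Suc k) ?c" "grid (Suc k) ?c < 1" using grid_range[OF cQ] by auto
    have "2 ^ Suc k * grid (Suc k) ?c + (real (sig (Suc k) ?c) - real ?c) / real q = 0"
      using z q_pos by (simp add: field_simps del: sig.simps)
    then have "F (grid (Suc k) ?c) = odometer 0 / 2 ^ Suc k"
      using F_top(1)[OF y, of "Suc k"] z q_pos by (simp only: cell_grid)
    then have "F (grid (Suc k) ?c) = 1 / 2 ^ Suc (Suc k)" using odometer_left[of 0] by simp
    then have "grid (Suc k) ?c \<in> DD" using D_F_back[OF y] power_D[of "Suc (Suc k)"] by simp
    then show ?thesis using bwd[of s] s by simp
  next
    case 3
    let ?c = "(tau k ^^ m) i"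
    have c2: "?c < 2 * q" using S.tau_less[of i m k] i by simp
    then have h: "0 < hgt k (?c div 2)" using S.return_time_ge1[of "?c div 2" k] by (simp add: Suc_le_eq)
    let ?t = "offset (map (hgt k) (word k i)) m"
    have "?t + 0 < offset (map (hgt k) (word k i)) (return_time q (tau k) i)"
      using 3(1) h by (intro offset_add_less) (auto simp: length_visited nth_visited)
    then have t: "?t < hgt (Suc k) i"
      using offset_length[of "map (hgt k) (word k i)"] hgt_Suc[OF i, of k] by (simp add: length_visited del: map_map)
    have "(sig (Suc k) ^^ ?t) i = ?c" using S.doubled_offset[OF i, of m k] 3(1) by simp
    moreover have "grid (Suc k) ?c = grid k (?c div 2)"
      using grid_Suc[of "?c div 2" k] unfolding dvd_mult_div_cancel[OF 3(2)] .
    ultimately have "grid (Suc k) ((sig (Suc k) ^^ ?t) i) \<in> DD" using Suc.IH[OF 3(3)] by simp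
    then show ?thesis using bwd[OF t] by blast
  qed
qed

lemma uncut_floor:
  assumes nD: "grid k c \<notin> DD" and i: "i < q" "s < hgt k i" "c = (sig k ^^ s) i"
  shows "i \<notin> marks k" "0 < i" "c = Suc ((sig k ^^ s) (i - 1))" "s < hgt k (i - 1)"
proof -
  have "i < Q k" using i(1) by (rule less_Q)
  then have "grid k i \<notin> DD"
    using nD F_pow_grid[OF i(1,2)] D_F_pow[of "grid k i" s] grid_range[of i k] i(3) by metis
  then show m: "i \<notin> marks k" using marks_D by blast
  show "0 < i" "c = Suc ((sig k ^^ s) (i - 1))" "s < hgt k (i - 1)" using unmarked[OF i(1) m] i by auto
qed

text \<open>To the right of a tower cell, across a boundary outside \<open>D\<close>, there is a tower cell: follow
  both cells back to the base, whose right end is in \<open>D\<close> or equal to \<open>1\<close>.\<close>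

lemma uncut_in_tower:
  "\<lbrakk>j < q; s < hgt k j; c - 1 = (sig k ^^ s) j; c < Q k; grid k c \<notin> DD\<rbrakk> \<Longrightarrow> in_tower q (sig k) c"
proof (induction s arbitrary: c)
  case 0
  have "c \<noteq> q"
  proof
    assume "c = q"
    moreover have "k \<noteq> 0" using \<open>c = q\<close> 0 by (cases k) auto
    ultimately show False using 0 grid_q[of k] power_D[of k] by simp
  qed
  then have "c < q" using 0 by simp
  then show ?case by (rule S.in_tower_base)
next
  case (Suc s)
  have "q \<le> c - 1" using S.before_return[OF Suc.prems(1), of "Suc s" k] Suc.prems by simp
  then have cq: "q \<le> c" by simp
  obtain c' where c': "c' < Q k" "sig k c' = c" "grid k c' \<notin> DD"
    using uncut_preimage[OF Suc.prems(4) cq Suc.prems(5)] .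
  have "sig k (c' - 1) = sig k ((sig k ^^ s) j)"
    using uncut_step(3)[OF c'(1,3)] c'(2) cq Suc.prems(3) by simp
  then have "c' - 1 = (sig k ^^ s) j" using injD[OF S.inj_g[of k]] by blast
  then have "in_tower q (sig k) c'" using Suc.IH[of c'] Suc.prems c' by simp
  then obtain i r where i: "i < q" "r < hgt k i" "c' = (sig k ^^ r) i" unfolding in_tower_def by blast
  then have "Suc r < hgt k i" using S.next_floor[of k r i] c'(2) cq by simp
  then show ?case unfolding in_tower_def using i c'(2) by (intro exI[of _ i] conjI exI[of _ "Suc r"]) auto
qed

text \<open>Meaningful for cells in towers; the first component names a block of base cells.\<close>

definition adr :: "nat \<Rightarrow> nat \<Rightarrow> nat \<times> nat" where
  "adr k c = (block k (tower_of q (sig k) c), floor_of q (sig k) c)"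

abbreviation inT :: "nat \<Rightarrow> nat \<Rightarrow> bool" where "inT k c \<equiv> in_tower q (sig k) c"

lemma adr_eq: "\<lbrakk>i < q; s < hgt k i; c = (sig k ^^ s) i\<rbrakk> \<Longrightarrow> adr k c = (block k i, s)"
  using S.address_eq[of i s k c] by (simp add: adr_def)

lemma inT_floor:
  assumes "inT k c"
  obtains i s where "i < q" "s < hgt k i" "c = (sig k ^^ s) i" "adr k c = (block k i, s)"
  using assms adr_eq unfolding in_tower_def by blast

lemma uncut_adr:
  assumes c: "c < Q k" and nD: "grid k c \<notin> DD"
  shows "inT k (c - 1) \<longleftrightarrow> inT k c" "inT k c \<Longrightarrow> adr k (c - 1) = adr k c"
proof -
  have A: "inT k (c - 1) \<and> adr k (c - 1) = adr k c" if t: "inT k c"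
  proof -
    obtain i s where i: "i < q" "s < hgt k i" "c = (sig k ^^ s) i" "adr k c = (block k i, s)"
      using inT_floor[OF t] .
    note u = uncut_floor[OF nD i(1,2,3)]
    have j: "i - 1 < q" "c - 1 = (sig k ^^ s) (i - 1)" using i(1) u(3) by simp_all
    then have "inT k (c - 1)" unfolding in_tower_def using u(4) by blast
    moreover have "adr k (c - 1) = (block k (i - 1), s)" using adr_eq[OF j(1) u(4) j(2)] .
    ultimately show ?thesis using i(4) block_start_pred[OF u(1,2)] by simp
  qed
  moreover have "inT k c" if "inT k (c - 1)"
    using that uncut_in_tower[OF _ _ _ c nD] unfolding in_tower_def by blast
  ultimately show "inT k (c - 1) \<longleftrightarrow> inT k c" "inT k c \<Longrightarrow> adr k (c - 1) = adr k c" by auto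
qed

section \<open>Points of D are eventually cuts\<close>

text \<open>A grid point of level \<open>k\<close> that is not interior to a block floor.\<close>

definition cut_at :: "nat \<Rightarrow> real \<Rightarrow> bool" where
  "cut_at k d \<longleftrightarrow> (\<exists>c<Q k. d = grid k c \<and> \<not> joined k c)"

definition eventually_cut :: "real \<Rightarrow> bool" where
  "eventually_cut d \<longleftrightarrow> (\<exists>K. \<forall>k\<ge>K. cut_at k d)"

lemma cut_at_F:
  assumes y: "0 \<le> y" "y < 1" and u: "q \<le> sig k (cell k y)"
  shows "cut_at k (F y) \<longleftrightarrow> cut_at k y"
proof
  assume "cut_at k y"
  then obtain c where c: "c < Q k" "y = grid k c" "\<not> joined k c" unfolding cut_at_def by blast
  then have "q \<le> sig k c" using u by (simp only: cell_grid)
  then have "F y = grid k (sig k c)" "\<not> joined k (sig k c)" "sig k c < Q k"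
    using F_grid[OF c(1)] joined_back[of k c] c S.g_less[OF c(1)] by auto
  then show "cut_at k (F y)" unfolding cut_at_def by blast
next
  assume "cut_at k (F y)"
  then obtain c where c: "c < Q k" "F y = grid k c" "\<not> joined k c" unfolding cut_at_def by blast
  let ?c = "cell k y"
  have e: "sig k ?c = c" using cell_F[OF y u] c(2) by (simp only: cell_grid)
  have "y = grid k ?c" using F_up[OF y u] c(2) e by (simp add: diff_divide_distrib)
  moreover have "\<not> joined k ?c" using joined_forward[of k ?c] u c(3) e by metis
  ultimately show "cut_at k y" unfolding cut_at_def using cell_less[OF y] by blast
qed

text \<open>Being a cut moves along orbits at all levels at which the point does not enter the base, so
  only the generators \<open>D0\<close> need inspection.\<close>

lemma eventually_cut_F:
  assumes y: "0 \<le> y" "y < 1"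
  shows "eventually_cut (F y) \<longleftrightarrow> eventually_cut y"
proof -
  obtain K where "\<And>k. K \<le> k \<Longrightarrow> q \<le> sig k (cell k y)" using exists_up[OF y] by blast
  then have K: "\<And>k. K \<le> k \<Longrightarrow> cut_at k (F y) \<longleftrightarrow> cut_at k y" using cut_at_F[OF y] by blast
  show ?thesis
    unfolding eventually_cut_def
  proof
    assume "\<exists>L. \<forall>k\<ge>L. cut_at k (F y)"
    then obtain L where "\<forall>k\<ge>L. cut_at k (F y)" by blast
    then have "\<forall>k\<ge>max K L. cut_at k y" using K by (metis max.bounded_iff)
    then show "\<exists>L. \<forall>k\<ge>L. cut_at k y" by blast
  next
    assume "\<exists>L. \<forall>k\<ge>L. cut_at k y"
    then obtain L where "\<forall>k\<ge>L. cut_at k y" by blast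
    then have "\<forall>k\<ge>max K L. cut_at k (F y)" using K by (metis max.bounded_iff)
    then show "\<exists>L. \<forall>k\<ge>L. cut_at k (F y)" by blast
  qed
qed

lemma eventually_cut_F_pow: "0 \<le> y \<Longrightarrow> y < 1 \<Longrightarrow> eventually_cut ((F ^^ n) y) \<longleftrightarrow> eventually_cut y"
proof (induction n)
  case (Suc n)
  have "eventually_cut (F ((F ^^ n) y)) \<longleftrightarrow> eventually_cut ((F ^^ n) y)"
    using eventually_cut_F F_pow_range[OF Suc.prems, of n] by blast
  then show ?case using Suc by simp
qed simp

text \<open>By \<open>joined_descend\<close> a cut remains a cut at all deeper levels.\<close>

lemma eventually_cutI:
  assumes c: "c < Q n" "\<not> joined n c"
  shows "eventually_cut (grid n c)"
  unfolding eventually_cut_def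
proof (intro exI[of _ n] allI impI)
  fix k assume "n \<le> k"
  then obtain m where m: "k = n + m" using le_Suc_ex by blast
  have "grid n c = grid k (2 ^ m * c)" using m by (simp add: power_add)
  moreover have "2 ^ m * c < Q k" using c(1) m by (simp add: power_add)
  moreover have "\<not> joined k (2 ^ m * c)" using joined_descend_pow[of n m c] c(2) m by blast
  ultimately show "cut_at k (grid n c)" unfolding cut_at_def by blast
qed

lemma rotation_local:
  assumes x: "0 \<le> x" "x < 1" and nm: "\<not> (\<exists>i\<in>marks 0. x = real i / real q)"
  shows "\<exists>\<delta>>0. \<forall>y. 0 \<le> y \<longrightarrow> \<bar>y - x\<bar> < \<delta> \<longrightarrow> R y = R x + (y - x)"
proof -
  let ?i = "cell 0 x"
  have iq: "?i < q" using cell_less[OF x, of 0] by simp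
  have q0: "0 < real q" using q_pos by simp
  have b: "real ?i \<le> real q * x" "real q * x < real ?i + 1" using cell_bounds[OF x(1), of 0] by simp_all
  have right: "R y = R x + (y - x)" if "0 \<le> y" "real ?i \<le> real q * y" "real q * y < real ?i + 1" for y
  proof -
    have "cell 0 y = ?i" by (rule cell_eqI) (use that in simp_all)
    then show ?thesis by (simp add: rotation_eq)
  qed
  show ?thesis
  proof (cases "real q * x = real ?i")
    case False
    define d where "d = min (real q * x - real ?i) (real ?i + 1 - real q * x)"
    have d: "0 < d" using False b by (simp add: d_def)
    have "R y = R x + (y - x)" if "0 \<le> y" "\<bar>y - x\<bar> < d / real q" for y
    proof (rule right[OF that(1)])
      have "real q * \<bar>y - x\<bar> < d" using that(2) q0 by (simp add: field_simps)
      then have "\<bar>real q * y - real q * x\<bar> < d" using q0 by (simp add: abs_mult right_diff_distrib[symmetric])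
      then show "real ?i \<le> real q * y" "real q * y < real ?i + 1" unfolding d_def by linarith+
    qed
    then show ?thesis using d q0 by (intro exI[of _ "d / real q"]) auto
  next
    case True
    then have "x = real ?i / real q" using q0 by (simp add: field_simps)
    then have "?i \<notin> marks 0" using nm by blast
    then have i: "0 < ?i" "\<pi> ?i = Suc (\<pi> (?i - 1))" using iq by auto
    have "R y = R x + (y - x)" if y: "0 \<le> y" "\<bar>y - x\<bar> < 1 / real q" for y
    proof -
      have "real q * \<bar>y - x\<bar> < 1" using y(2) q0 by (simp add: field_simps)
      then have near: "\<bar>real q * y - real q * x\<bar> < 1" using q0 by (simp add: abs_mult right_diff_distrib[symmetric])
      show ?thesis
      proof (cases "real ?i \<le> real q * y")
        case True2: True
        then show ?thesis using right[OF y(1)] near True by linarith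
      next
        case False
        have i1: "real (?i - 1) = real ?i - 1" using i(1) by (simp add: of_nat_diff)
        have "cell 0 y = ?i - 1" by (rule cell_eqI) (use False near True i1 in simp_all)
        then show ?thesis using i(2) i1 by (simp add: rotation_eq)
      qed
    qed
    then show ?thesis using q0 by (intro exI[of _ "1 / real q"]) auto
  qed
qed

lemma discontinuity_F:
  assumes x: "0 \<le> x" "x < 1" and dis: "\<not> continuous (at x within {0..<1}) F"
  shows "(\<exists>i\<in>marks 0. x = real i / real q) \<or> (\<exists>n::nat. R x = 1 - 1 / 2 ^ n)"
proof (rule ccontr)
  assume a: "\<not> ?thesis"
  obtain d1 where d1: "d1 > 0" "\<And>y. 0 \<le> y \<Longrightarrow> \<bar>y - x\<bar> < d1 \<Longrightarrow> R y = R x + (y - x)"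
    using rotation_local[OF x] a by blast
  obtain d2 where d2: "d2 > 0" "\<And>z. \<bar>z - R x\<bar> < d2 \<Longrightarrow> odometer z = odometer (R x) + (z - R x)"
    using odometer_local[OF rotation_range(1,2)[OF x]] a by blast
  have loc: "F y = F x + (y - x)" if "0 \<le> y" "\<bar>y - x\<bar> < min d1 d2" for y
    using d1(2)[of y] d2(2)[of "R y"] that by (simp add: rot_odometer_def)
  have "continuous (at x within {0..<1}) F"
    unfolding continuous_within_eps_delta
  proof (intro allI impI)
    fix e :: real assume e: "0 < e"
    have "dist (F y) (F x) < e" if "y \<in> {0..<1}" "dist y x < min e (min d1 d2)" for y
      using loc[of y] that by (simp add: dist_real_def)
    then show "\<exists>d>0. \<forall>x'\<in>{0..<1}. dist x' x < d \<longrightarrow> dist (F x') (F x) < e"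
      using e d1(1) d2(1) by (intro exI[of _ "min e (min d1 d2)"]) auto
  qed
  then show False using dis by simp
qed

lemma eventually_cut_zero: "eventually_cut 0"
  using eventually_cutI[of 0 0] joined_0 q_pos by simp

lemma eventually_cut_marks_0: "i \<in> marks 0 \<Longrightarrow> eventually_cut (real i / real q)"
proof -
  assume i: "i \<in> marks 0"
  have "\<not> joined 0 i"
  proof
    assume "joined 0 i"
    then obtain j s where "j < q" "j \<notin> marks 0" "s < hgt 0 j" "i = (sig 0 ^^ s) j" unfolding joined_def by blast
    moreover from this have "s = 0" by (simp add: hgt_0)
    ultimately show False using i by simp
  qed
  then show ?thesis using eventually_cutI[of i 0] i by simp
qed

text \<open>At level \<open>n\<close> the cell to the right of \<open>R\<^sup>-\<^sup>1(1 - 2\<^sup>-\<^sup>n)\<close> is sent to the first cell of the base,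
  and no cell joined to its left neighbour is.\<close>

lemma eventually_cut_R:
  assumes x: "0 \<le> x" "x < 1" and Rx: "R x = 1 - 1 / 2 ^ n"
  shows "eventually_cut x"
proof -
  let ?c = "cell n x"
  let ?i = "cell 0 x"
  have Qp: "0 < real (Q n)" by (rule Q_pos)
  have q0: "0 < real q" using q_pos by simp
\<comment> \<open>First, \<open>x\<close> is a grid point of level \<open>n\<close>: \<open>q 2\<^sup>n x\<close> is an integer.\<close>
  have "x = R x - (real (\<pi> ?i) - real ?i) / real q" by (simp add: rotation_eq)
  then have "real (Q n) * x = real (Q n) * (1 - 1 / 2 ^ n) - real (Q n) * ((real (\<pi> ?i) - real ?i) / real q)"
    unfolding Rx by (metis right_diff_distrib)
  also have "\<dots> = real_of_int (int q * 2 ^ n - int q - 2 ^ n * (int (\<pi> ?i) - int ?i))"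
    using q0 by (simp add: field_simps)
  finally obtain z :: int where z: "real (Q n) * x = real_of_int z" by blast
  have "real_of_int (int ?c) \<le> real_of_int z" "real_of_int z < real_of_int (int ?c + 1)"
    using cell_bounds[OF x(1), of n] z by simp_all
  then have "z = int ?c" by linarith
  then have "real (Q n) * x = real ?c" using z by simp
  then have xg: "x = grid n ?c" using q_pos by (simp add: field_simps)
  have Fx: "F x = 1 / 2 ^ Suc n" using odometer_endpoint[of n] Rx by (simp add: rot_odometer_def)
  then have "F x < 1 / 2 ^ n" by (simp add: field_simps)
  then have t: "sig n ?c < q" using up_iff[OF x, of n] by simp
  let ?d = "sig n ?c"
  have xq: "2 ^ n * x = real ?c / real q" by (subst xg) (use q0 in simp)
  have "F x = odometer (real ?d / real q) / 2 ^ n"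
    using F_top(1)[OF x t] xq by (simp add: diff_divide_distrib)
  then have "odometer (real ?d / real q) = odometer 0"
    using Fx odometer_left[of 0] by (simp add: field_simps)
  moreover have "real ?d / real q \<in> {0..<1}" using t q0 by simp
  ultimately have "real ?d / real q = 0" using inj_onD[OF odometer_inj, of "real ?d / real q" 0] by simp
  then have "?d = 0" using q0 by simp
  then have "\<not> joined n ?c" using joined_top by blast
  then show ?thesis using eventually_cutI[of ?c n] cell_less[OF x, of n] xg by simp
qed

lemma eventually_cut_D0: "x \<in> D0 q \<pi> \<Longrightarrow> eventually_cut x"
proof -
  assume x: "x \<in> D0 q \<pi>"
  then have r: "0 \<le> x" "x < 1" using D0_range by auto
  have "x = 0 \<or> (\<exists>n. x = rotation_inv q \<pi> (1 - 1 / 2 ^ n)) \<or> \<not> continuous (at x within {0..<1}) F"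
    using x unfolding D0_def by blast
  moreover have "eventually_cut x" if "x = rotation_inv q \<pi> (1 - 1 / 2 ^ n)" for n
    using eventually_cut_R[OF r, of n] rotation_inv(2)[OF endpoint_range, of n] that by simp
  moreover have "eventually_cut x" if "\<not> continuous (at x within {0..<1}) F"
    using discontinuity_F[OF r that] eventually_cut_marks_0 eventually_cut_R[OF r] by blast
  ultimately show ?thesis using eventually_cut_zero by blast
qed

lemma eventually_cut_D: "d \<in> DD \<Longrightarrow> eventually_cut d"
  unfolding D_def
proof (elim UnE)
  assume "d \<in> {(F ^^ n) x |n x. x \<in> D0 q \<pi>}"
  then obtain n x where "d = (F ^^ n) x" "x \<in> D0 q \<pi>" by auto
  then show ?thesis using eventually_cut_F_pow[of x n] eventually_cut_D0 D0_range by auto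
next
  assume "d \<in> {y \<in> {0..<1}. \<exists>n. (F ^^ n) y \<in> D0 q \<pi> - {0}}"
  then obtain n where "0 \<le> d" "d < 1" "(F ^^ n) d \<in> D0 q \<pi>" by auto
  then show ?thesis using eventually_cut_F_pow[of d n] eventually_cut_D0 by blast
qed

section \<open>Addresses\<close>

text \<open>The stacking of towers, read off from addresses: this is where the merged words become the
  words of the diagram.\<close>

lemma adr_down:
  assumes t: "inT (Suc k) c"
  obtains m where "inT k (c div 2)"
    "m < length (merged k (fst (adr (Suc k) c)))"
    "fst (adr k (c div 2)) = merged k (fst (adr (Suc k) c)) ! m"
    "snd (adr (Suc k) c) = offset (map (hgt k) (merged k (fst (adr (Suc k) c)))) m + snd (adr k (c div 2))"
proof -
  obtain i t where i: "i < q" "t < hgt (Suc k) i" "c = (sig (Suc k) ^^ t) i" "adr (Suc k) c = (block (Suc k) i, t)"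
    using inT_floor[OF t] .
  obtain m s where ms: "m < return_time q (tau k) i" "s < hgt k (word k i ! m)"
    "t = offset (map (hgt k) (word k i)) m + s"
    "(sig (Suc k) ^^ t) i = 2 * (sig k ^^ s) (word k i ! m) + (tau k ^^ m) i mod 2"
    using floor_refine[OF i(1,2)] .
  have wq: "word k i ! m < q" using S.visited_less[OF i(1) nth_mem] ms(1) by (simp add: length_visited)
  have c2: "c div 2 = (sig k ^^ s) (word k i ! m)" using ms(4) i(3) by simp
  have mb: "merged k (block (Suc k) i) = merged k i" using merged_block[OF i(1)] .
  have A: "adr k (c div 2) = (block k (word k i ! m), s)" using adr_eq[OF wq ms(2) c2] .
  show ?thesis
  proof (rule that[of m])
    show "inT k (c div 2)" unfolding in_tower_def using wq ms(2) c2 by blast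
    show "m < length (merged k (fst (adr (Suc k) c)))" using ms(1) by (simp add: i(4) mb length_merged del: marks.simps)
    show "fst (adr k (c div 2)) = merged k (fst (adr (Suc k) c)) ! m"
      using ms(1) by (simp add: A i(4) mb del: marks.simps) (simp add: merged_def length_visited)
    show "snd (adr (Suc k) c) = offset (map (hgt k) (merged k (fst (adr (Suc k) c)))) m + snd (adr k (c div 2))"
      by (simp add: A i(4) mb map_hgt_merged[OF i(1)] ms(3) del: marks.simps)
  qed
qed

lemma adr_bounds:
  assumes "inT k c"
  shows "fst (adr k c) < q" "snd (adr k c) < hgt k (fst (adr k c))"
proof -
  obtain i s where "i < q" "s < hgt k i" "c = (sig k ^^ s) i" "adr k c = (block k i, s)"
    using inT_floor[OF assms] .
  then show "fst (adr k c) < q" "snd (adr k c) < hgt k (fst (adr k c))" using block_less hgt_block by auto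
qed

lemma adr_mono_Suc:
  assumes "inT (Suc k) c" "inT (Suc k) c'" "adr (Suc k) c = adr (Suc k) c'"
  shows "adr k (c div 2) = adr k (c' div 2)"
proof -
  obtain m where m: "inT k (c div 2)" "m < length (merged k (fst (adr (Suc k) c)))"
    "fst (adr k (c div 2)) = merged k (fst (adr (Suc k) c)) ! m"
    "snd (adr (Suc k) c) = offset (map (hgt k) (merged k (fst (adr (Suc k) c)))) m + snd (adr k (c div 2))"
    using adr_down[OF assms(1)] .
  obtain m' where m': "inT k (c' div 2)" "m' < length (merged k (fst (adr (Suc k) c')))"
    "fst (adr k (c' div 2)) = merged k (fst (adr (Suc k) c')) ! m'"
    "snd (adr (Suc k) c') = offset (map (hgt k) (merged k (fst (adr (Suc k) c')))) m' + snd (adr k (c' div 2))"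
    using adr_down[OF assms(2)] .
  let ?xs = "map (hgt k) (merged k (fst (adr (Suc k) c)))"
  have "m = m' \<and> snd (adr k (c div 2)) = snd (adr k (c' div 2))"
  proof (rule offset_unique[where xs = ?xs])
    show "m < length ?xs" "m' < length ?xs" using m(2) m'(2) assms(3) by simp_all
    show "snd (adr k (c div 2)) < ?xs ! m" using adr_bounds(2)[OF m(1)] m(2,3) by simp
    show "snd (adr k (c' div 2)) < ?xs ! m'" using adr_bounds(2)[OF m'(1)] m'(2,3) assms(3) by simp
    show "offset ?xs m + snd (adr k (c div 2)) = offset ?xs m' + snd (adr k (c' div 2))"
      using m(4) m'(4) assms(3) by metis
  qed
  then show ?thesis using m(3) m'(3) assms(3) by (metis prod_eqI)
qed

lemma same_adr:
  assumes "inT k c" "inT k c'" "adr k c = adr k c'" "c' < c"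
  shows "c < c' + q" "\<And>a. c' < a \<Longrightarrow> a \<le> c \<Longrightarrow> joined k a"
proof -
  obtain i s where i: "i < q" "s < hgt k i" "c = (sig k ^^ s) i" "adr k c = (block k i, s)"
    using inT_floor[OF assms(1)] .
  obtain i' s' where i': "i' < q" "s' < hgt k i'" "c' = (sig k ^^ s') i'" "adr k c' = (block k i', s')"
    using inT_floor[OF assms(2)] .
  have s: "s' = s" "block k i = block k i'" using i(4) i'(4) assms(3) by simp_all
  note sb = same_block[OF i(1) i'(1) s(2) i(2) i'(2)[unfolded s(1)]]
  show "c < c' + q" "\<And>a. c' < a \<Longrightarrow> a \<le> c \<Longrightarrow> joined k a"
    using sb assms(4) unfolding i(3) i'(3)[unfolded s(1)] by blast+
qed

text \<open>The cell lies in an interval between consecutive grid points of \<open>D\<close>, on which addresses are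
  constant. In the compactification it is an order interval that is both open and closed.\<close>

lemma cut_block:
  assumes c: "c < Q k"
  obtains a b where "a \<le> c" "c < b" "b \<le> Q k" "grid k a \<in> DD" "b = Q k \<or> grid k b \<in> DD"
    "\<And>e. a \<le> e \<Longrightarrow> e < b \<Longrightarrow> (inT k e \<longleftrightarrow> inT k c) \<and> (inT k c \<longrightarrow> adr k e = adr k c)"
proof -
  define A where "A = {a. a \<le> c \<and> grid k a \<in> DD}"
  define a where "a = Max A"
  have "finite A" by (simp add: A_def)
  moreover have "0 \<in> A" using zero_D by (simp add: A_def)
  ultimately have "a \<in> A" "\<And>e. e \<in> A \<Longrightarrow> e \<le> a"
    unfolding a_def using Max_in[of A] Max_ge[of A] by blast+
  then have a: "a \<le> c" "grid k a \<in> DD" "\<And>e. e \<le> c \<Longrightarrow> grid k e \<in> DD \<Longrightarrow> e \<le> a"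
    unfolding A_def by blast+
  define b where "b = (LEAST b. c < b \<and> (b = Q k \<or> grid k b \<in> DD))"
  have "c < b \<and> (b = Q k \<or> grid k b \<in> DD)" unfolding b_def by (rule LeastI[of _ "Q k"]) (use c in simp)
  moreover have block_start: "b \<le> Q k" unfolding b_def by (rule Least_le) (use c in simp)
  moreover have bn: "grid k e \<notin> DD" if "c < e" "e < b" for e
    using not_less_Least[of e "\<lambda>b. c < b \<and> (b = Q k \<or> grid k b \<in> DD)"] that unfolding b_def by blast
  ultimately have b: "c < b" "b = Q k \<or> grid k b \<in> DD" "b \<le> Q k" by auto
  have free: "grid k e \<notin> DD" if "a < e" "e < b" for e
    using that a(3)[of e] bn[of e] by (metis not_le)
  have chain: "(inT k (a + n) \<longleftrightarrow> inT k a) \<and> (inT k a \<longrightarrow> adr k (a + n) = adr k a)" if "a + n < b" for n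
    using that
  proof (induction n)
    case (Suc n)
    have "a + Suc n < Q k" using Suc.prems block_start by simp
    then show ?case using uncut_adr[OF _ free[of "a + Suc n"]] Suc by auto
  qed simp
  have all: "(inT k e \<longleftrightarrow> inT k a) \<and> (inT k a \<longrightarrow> adr k e = adr k a)" if "a \<le> e" "e < b" for e
    using chain[of "e - a"] that by simp
  show ?thesis
    by (rule that[OF a(1) b(1,3) a(2) b(2)]) (use all all[OF a(1) b(1)] in metis)
qed

section \<open>Points of the compactification\<close>

abbreviation Star :: "point set" where "Star \<equiv> I_star q \<pi>"

abbreviation NP :: "point set" where "NP \<equiv> I_np_star q \<pi>"

text \<open>The point \<open>Minus z\<close> belongs to the cell that ends at \<open>z\<close> or contains \<open>z\<close> in its interior.\<close>

primrec pcell :: "nat \<Rightarrow> point \<Rightarrow> nat" where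
  "pcell k (At x) = cell k x"
| "pcell k (Minus z) = nat (\<lceil>real (Q k) * z\<rceil> - 1)"

text \<open>The split interval in which every point is doubled; it contains the compactification and
  gives meaning to cells of \<open>Minus z\<close> for arbitrary \<open>z\<close>.\<close>

primrec valid :: "point \<Rightarrow> bool" where
  "valid (At x) \<longleftrightarrow> 0 \<le> x \<and> x < 1"
| "valid (Minus z) \<longleftrightarrow> 0 < z \<and> z \<le> 1"

lemma Star_At: "At x \<in> Star \<longleftrightarrow> 0 \<le> x \<and> x < 1"
  by (auto simp: I_star_def)

lemma Star_Minus: "Minus z \<in> Star \<longleftrightarrow> z \<in> DD - {0} \<union> {1}"
  by (auto simp: I_star_def)

lemma Star_valid: "p \<in> Star \<Longrightarrow> valid p"
  using D_range by (cases p) (auto simp: Star_At Star_Minus less_le)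

lemma pcell_Minus:
  assumes "0 < z"
  shows "real (pcell k (Minus z)) < real (Q k) * z" "real (Q k) * z \<le> real (pcell k (Minus z)) + 1"
proof -
  have "0 < real (Q k) * z" using assms Q_pos[of k] by simp
  then have "1 \<le> \<lceil>real (Q k) * z\<rceil>" by linarith
  then show "real (pcell k (Minus z)) < real (Q k) * z" "real (Q k) * z \<le> real (pcell k (Minus z)) + 1"
    unfolding pcell.simps by linarith+
qed

lemma pcell_Minus_eqI: "real c < real (Q k) * z \<Longrightarrow> real (Q k) * z \<le> real c + 1 \<Longrightarrow> pcell k (Minus z) = c"
  unfolding pcell.simps by linarith

lemma pcell_bounds:
  assumes "valid p"
  shows "real (pcell k p) \<le> real (Q k) * base p" "real (Q k) * base p \<le> real (pcell k p) + 1"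
proof -
  have "real (pcell k p) \<le> real (Q k) * base p \<and> real (Q k) * base p \<le> real (pcell k p) + 1"
  proof (cases p)
    case (At x)
    then have "0 \<le> x" using assms by simp
    from cell_bounds[OF this, of k] show ?thesis unfolding At pcell.simps base.simps by linarith
  next
    case (Minus z)
    then have "0 < z" using assms by simp
    from pcell_Minus[OF this, of k] show ?thesis unfolding Minus base.simps by linarith
  qed
  then show "real (pcell k p) \<le> real (Q k) * base p" "real (Q k) * base p \<le> real (pcell k p) + 1" by blast+
qed

lemma pcell_less: "valid p \<Longrightarrow> pcell k p < Q k"
proof (cases p)
  case (At x)
  then show "valid p \<Longrightarrow> ?thesis" using cell_less by simp
next
  case (Minus z)
  assume "valid p"
  then have z: "0 < z" "z \<le> 1" using Minus by auto
  then have "real (Q k) * z \<le> real (Q k) * 1" using Q_pos[of k] by (intro mult_left_mono) auto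
  then have "real (pcell k p) < real (Q k)" using pcell_Minus(1)[OF z(1), of k] unfolding Minus by linarith
  then show ?thesis by (simp only: of_nat_less_iff)
qed

lemma pcell_Suc_div:
  assumes "valid p"
  shows "pcell (Suc k) p div 2 = pcell k p"
proof (cases p)
  case (At x)
  then show ?thesis using cell_Suc_div assms by simp
next
  case (Minus z)
  then have z: "0 < z" using assms by simp
  let ?c = "pcell (Suc k) (Minus z)"
  have b: "real ?c < 2 * (real (Q k) * z)" "2 * (real (Q k) * z) \<le> real ?c + 1"
    using pcell_Minus[OF z, of "Suc k"] by (simp_all add: mult_ac del: pcell.simps)
  have "pcell k (Minus z) = ?c div 2"
  proof (rule pcell_Minus_eqI)
    have "2 * (?c div 2) \<le> ?c" by simp
    then have "real (2 * (?c div 2)) \<le> real ?c" by (simp only: of_nat_le_iff)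
    then show "real (?c div 2) < real (Q k) * z" using b by simp
    have "c + 1 \<le> 2 * (c div 2) + 2" for c :: nat by presburger
    from this[of ?c] have "real ?c + 1 \<le> 2 * real (?c div 2) + 2" by linarith
    then show "real (Q k) * z \<le> real (?c div 2) + 1" using b by linarith
  qed
  then show ?thesis using Minus by simp
qed

lemma pcell_div: "valid p \<Longrightarrow> pcell (k + n) p div 2 ^ n = pcell k p"
proof (induction n)
  case (Suc n)
  have "pcell (k + Suc n) p div 2 ^ Suc n = pcell (Suc (k + n)) p div 2 div 2 ^ n"
    by (simp add: div_mult2_eq)
  then show ?case using Suc pcell_Suc_div[of p "k + n"] by simp
qed simp

lemma grid_less_iff:
  assumes p: "valid p"
  shows "a \<le> pcell k p \<longleftrightarrow> Minus (grid k a) < p"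
proof -
  have Qp: "0 < real (Q k)" by (rule Q_pos)
  show ?thesis
  proof (cases p)
    case (At x)
    then have x: "0 \<le> x" using p by simp
    have "a \<le> cell k x \<longleftrightarrow> real a \<le> real (Q k) * x" using cell_bounds[OF x, of k] by linarith
    also have "\<dots> \<longleftrightarrow> grid k a \<le> x" by (simp only: pos_divide_le_eq[OF Qp] mult.commute)
    finally show ?thesis using At by (auto simp: less_point_def)
  next
    case (Minus z)
    then have z: "0 < z" using p by simp
    have "a \<le> pcell k (Minus z) \<longleftrightarrow> real a < real (Q k) * z" using pcell_Minus[OF z, of k] by linarith
    also have "\<dots> \<longleftrightarrow> grid k a < z" by (simp only: pos_divide_less_eq[OF Qp] mult.commute)
    finally show ?thesis using Minus by (auto simp: less_point_def simp del: pcell.simps)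
  qed
qed

lemma Minus_less_iff: "Minus d < p \<longleftrightarrow> At d \<le> p"
  by (cases p) (auto simp: less_point_def less_eq_point_def)

lemma less_At_iff: "p < At d \<longleftrightarrow> p \<le> Minus d"
  by (cases p) (auto simp: less_point_def less_eq_point_def)

lemma less_grid_iff: "valid p \<Longrightarrow> pcell k p < a \<longleftrightarrow> p < At (grid k a)"
  using grid_less_iff[of p a k] Minus_less_iff[of "grid k a" p] by (metis not_le)

abbreviation padr :: "nat \<Rightarrow> point \<Rightarrow> nat \<times> nat" where "padr k p \<equiv> adr k (pcell k p)"
abbreviation pinT :: "nat \<Rightarrow> point \<Rightarrow> bool" where "pinT k p \<equiv> inT k (pcell k p)"

text \<open>A cut is never interior to a block floor.\<close>

lemma cut_separates:
  assumes "cut_at k d" "valid p" "valid p'" "p < At d" "At d \<le> p'" "pinT k p" "pinT k p'"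
  shows "padr k p \<noteq> padr k p'"
proof
  assume eq: "padr k p = padr k p'"
  obtain c where c: "d = grid k c" "\<not> joined k c" using assms(1) unfolding cut_at_def by blast
  have "pcell k p < c" using less_grid_iff[OF assms(2)] assms(4) c(1) by blast
  moreover have "c \<le> pcell k p'" using grid_less_iff[OF assms(3)] assms(5) Minus_less_iff c(1) by metis
  ultimately show False using same_adr(2)[OF assms(7,6) eq[symmetric]] c(2) by simp
qed

lemma same_padr_close:
  assumes "valid p" "valid p'" "pinT k p" "pinT k p'" "padr k p = padr k p'"
  shows "\<bar>base p - base p'\<bar> \<le> 1 / 2 ^ k"
proof -
  have le: "base p - base p' \<le> 1 / 2 ^ k"
    if "valid p" "valid p'" "pinT k p" "pinT k p'" "padr k p = padr k p'" for p p'
  proof -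
    have "pcell k p + 1 \<le> pcell k p' + q"
      using same_adr(1)[OF that(3,4,5)] q_pos by (cases "pcell k p' < pcell k p") auto
    then have "real (pcell k p) + 1 - real (pcell k p') \<le> real q" by linarith
    then have "real (Q k) * base p - real (Q k) * base p' \<le> real q"
      using pcell_bounds[OF that(1), of k] pcell_bounds[OF that(2), of k] by linarith
    then have "real (Q k) * (base p - base p') \<le> real q" by (simp only: right_diff_distrib)
    then have "base p - base p' \<le> real q / real (Q k)"
      using Q_pos[of k] by (simp only: pos_le_divide_eq mult.commute)
    then show ?thesis using q_pos by simp
  qed
  show ?thesis using le[OF assms] le[OF assms(2,1,4,3) assms(5)[symmetric]] by linarith
qed

abbreviation Aper :: "real set" where "Aper \<equiv> {0..<1} - Per"

lemma Aper_inT: "x \<in> Aper \<Longrightarrow> inT k (cell k x)"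
  using not_in_tower_Per[of x k] by auto

text \<open>A point is aperiodic iff all its floors contain aperiodic reals. If no real with the
  address of a point is aperiodic, then the interval of \<open>cut_block\<close> around the point is periodic.
  Conversely the endpoints of a periodic order interval are eventually cuts, so the deep floors
  around a point of the interval stay inside it and contain only periodic reals.\<close>

lemma NP_iff:
  "p \<in> NP \<longleftrightarrow> p \<in> Star \<and> (\<forall>k. pinT k p \<and> (\<exists>x\<in>Aper. adr k (cell k x) = padr k p))"
proof
  assume p: "p \<in> NP"
  then have pS: "p \<in> Star" and np: "p \<notin> I_per_star q \<pi>" by (auto simp: I_np_star_def)
  have v: "valid p" using Star_valid[OF pS] .
  have "pinT k p \<and> (\<exists>x\<in>Aper. adr k (cell k x) = padr k p)" for k
  proof -
    obtain a b where ab: "a \<le> pcell k p" "pcell k p < b" "b \<le> Q k" "grid k a \<in> DD" "b = Q k \<or> grid k b \<in> DD"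
      "\<And>e. a \<le> e \<Longrightarrow> e < b \<Longrightarrow> (inT k e \<longleftrightarrow> pinT k p) \<and> (pinT k p \<longrightarrow> adr k e = padr k p)"
      using cut_block[OF pcell_less[OF v]] by metis
    have gb: "grid k b \<in> DD \<union> {1}" using ab(5) q_pos by auto
    have "grid k b \<le> 1"
    proof -
      have "real b \<le> real (Q k)" using ab(3) by (simp only: of_nat_le_iff)
      then show ?thesis using Q_pos[of k] by (simp only: divide_le_eq_1) auto
    qed
    have "At (grid k a) \<le> p" using ab(1) grid_less_iff[OF v] Minus_less_iff by blast
    moreover have "p \<le> Minus (grid k b)" using ab(2) less_grid_iff[OF v] less_At_iff by blast
    ultimately have "\<not> {grid k a..<grid k b} \<subseteq> Per"
      using np pS ab(4) gb unfolding I_per_star_def by blast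
    then obtain x where x: "grid k a \<le> x" "x < grid k b" "x \<notin> Per"
      unfolding subset_iff atLeastLessThan_iff by blast
    have xA: "x \<in> Aper" using x \<open>grid k b \<le> 1\<close> by (auto intro: order_trans[of 0 "grid k a"])
    then have vx: "valid (At x)" by simp
    have "a \<le> cell k x" using grid_less_iff[OF vx, of a k] x(1) by (simp add: less_point_def) argo
    moreover have "cell k x < b" using less_grid_iff[OF vx, of k b] x(2) by (simp add: less_point_def)
    ultimately show ?thesis using ab(6)[of "cell k x"] Aper_inT[OF xA, of k] xA by blast
  qed
  then show "p \<in> Star \<and> (\<forall>k. pinT k p \<and> (\<exists>x\<in>Aper. adr k (cell k x) = padr k p))" using pS by blast
next
  assume a: "p \<in> Star \<and> (\<forall>k. pinT k p \<and> (\<exists>x\<in>Aper. adr k (cell k x) = padr k p))"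
  then have v: "valid p" using Star_valid by blast
  have "p \<notin> I_per_star q \<pi>"
  proof
    assume "p \<in> I_per_star q \<pi>"
    then obtain u w where uw: "u \<in> DD" "w \<in> DD \<union> {1}" "{u..<w} \<subseteq> Per" "At u \<le> p" "p \<le> Minus w"
      unfolding I_per_star_def by blast
    obtain K where K: "\<And>k. K \<le> k \<Longrightarrow> cut_at k u" using eventually_cut_D[OF uw(1)] unfolding eventually_cut_def by blast
    obtain L where L: "\<And>k. L \<le> k \<Longrightarrow> w \<noteq> 1 \<Longrightarrow> cut_at k w"
      using eventually_cut_D[of w] uw(2) unfolding eventually_cut_def by blast
    define k where "k = max K L"
    obtain x where x: "x \<in> Aper" "adr k (cell k x) = padr k p" using a by blast
    have vx: "valid (At x)" "padr k (At x) = padr k p" "pinT k (At x)" "pinT k p" using x Aper_inT a by auto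
    have "u \<le> x"
    proof (rule ccontr)
      assume "\<not> u \<le> x"
      then have "At x < At u" by (simp add: less_point_def)
      then show False using cut_separates[OF K vx(1) v _ uw(4) vx(3,4)] vx(2) by (simp add: k_def)
    qed
    moreover have "x < w"
    proof (rule ccontr)
      assume xw: "\<not> x < w"
      then have "w \<noteq> 1" using x by auto
      moreover have "At w \<le> At x" using xw by (auto simp: less_eq_point_def)
      moreover have "p < At w" using uw(5) less_At_iff by blast
      ultimately show False using cut_separates[OF L v vx(1) _ _ vx(4,3)] vx(2) by (simp add: k_def)
    qed
    ultimately show False using uw(3) x(1) by auto
  qed
  then show "p \<in> NP" using a by (simp add: I_np_star_def)
qed

lemma NP_D:
  assumes "p \<in> NP"
  shows "p \<in> Star" "valid p" "pinT k p" "\<exists>x\<in>Aper. adr k (cell k x) = padr k p"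
  using assms NP_iff Star_valid by blast+

lemma Aper_NP: "x \<in> Aper \<Longrightarrow> At x \<in> NP"
  unfolding NP_iff using Aper_inT by (auto simp: Star_At)

lemma pinT_down: "valid p \<Longrightarrow> pinT (k + n) p \<Longrightarrow> pinT k p"
proof (induction n)
  case (Suc n)
  obtain m where "inT (k + n) (pcell (Suc (k + n)) p div 2)"
    using adr_down[of "k + n" "pcell (Suc (k + n)) p"] Suc.prems by auto
  then show ?case using Suc pcell_Suc_div[of p "k + n"] by simp
qed simp

lemma padr_mono:
  assumes v: "valid p" "valid p'" and t: "pinT (k + n) p" "pinT (k + n) p'" "padr (k + n) p = padr (k + n) p'"
  shows "padr k p = padr k p'"
  using t
proof (induction n)
  case (Suc n)
  have T: "pinT (k + n) p" "pinT (k + n) p'"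
    using pinT_down[OF v(1), of "k + n" 1] pinT_down[OF v(2), of "k + n" 1] Suc.prems by simp_all
  have "padr (k + n) p = padr (k + n) p'"
    using adr_mono_Suc[of "k + n" "pcell (Suc (k + n)) p" "pcell (Suc (k + n)) p'"] Suc.prems
    by (simp add: pcell_Suc_div[OF v(1)] pcell_Suc_div[OF v(2)])
  then show ?case using Suc.IH T by blast
qed simp

lemma pow_small: "0 < (e::real) \<Longrightarrow> \<exists>K. \<forall>k\<ge>K. 1 / 2 ^ k < e"
proof -
  assume "0 < e"
  then obtain K where K: "(1/2) ^ K < e" using real_arch_pow_inv[of e "1/2"] by auto
  have "1 / 2 ^ k < e" if "K \<le> k" for k
  proof -
    have "(1/2::real) ^ k \<le> (1/2) ^ K" using that by (intro power_decreasing) auto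
    then show ?thesis using K by (simp add: power_divide)
  qed
  then show ?thesis by blast
qed

text \<open>Equal addresses at all levels force equal base points, and the two copies of a point of \<open>D\<close>
  are separated by a cut.\<close>

lemma padr_sep:
  assumes p: "p \<in> NP" "p' \<in> NP" and eq: "\<And>k. padr k p = padr k p'"
  shows "p = p'"
proof -
  have False if p: "p \<in> NP" "p' \<in> NP" and eq: "\<And>k. padr k p = padr k p'" and less: "p < p'" for p p'
  proof -
    have close: "\<bar>base p - base p'\<bar> \<le> 1 / 2 ^ k" for k
      by (rule same_padr_close[OF NP_D(2)[OF p(1)] NP_D(2)[OF p(2)] NP_D(3)[OF p(1)] NP_D(3)[OF p(2)] eq])
    have "base p = base p'"
    proof (rule ccontr)
      assume "base p \<noteq> base p'"
      then obtain K where "\<forall>k\<ge>K. 1 / 2 ^ k < \<bar>base p - base p'\<bar>" using pow_small[of "\<bar>base p - base p'\<bar>"] by auto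
      then show False using close[of K] by force
    qed
    then obtain z where z: "p = Minus z" "p' = At z" using less by (cases p; cases p') (auto simp: less_point_def)
    then have "z \<in> DD" using NP_D(1)[OF p(1)] NP_D(1)[OF p(2)] by (auto simp: Star_Minus Star_At)
    then obtain K where "cut_at K z" using eventually_cut_D unfolding eventually_cut_def by blast
    moreover have "p < At z" "At z \<le> p'" using z by (auto simp: less_point_def less_eq_point_def)
    ultimately show False using cut_separates[OF _ NP_D(2)[OF p(1)] NP_D(2)[OF p(2)] _ _ NP_D(3)[OF p(1)] NP_D(3)[OF p(2)]] eq by blast
  qed
  then show ?thesis using assms by (metis linorder_neqE)
qed

end

text \<open>Convergence may be tested on a subbasis.\<close>

lemma limitin_generated:
  assumes "l \<in> \<Union>S" "\<And>B. B \<in> S \<Longrightarrow> l \<in> B \<Longrightarrow> eventually (\<lambda>x. f x \<in> B) G"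
  shows "limitin (topology_generated_by S) f l G"
proof -
  have "eventually (\<lambda>x. f x \<in> U) G" if "generate_topology_on S U" "l \<in> U" for U
    using that
  proof (induction rule: generate_topology_on.induct)
    case (Int a b)
    then have "eventually (\<lambda>x. f x \<in> a) G" "eventually (\<lambda>x. f x \<in> b) G" by auto
    then show ?case by eventually_elim auto
  next
    case (UN K)
    then obtain k where "k \<in> K" "l \<in> k" by auto
    then have "eventually (\<lambda>x. f x \<in> k) G" using UN by blast
    then show ?case by eventually_elim (use \<open>k \<in> K\<close> in auto)
  qed (use assms(2) in auto)
  then show ?thesis
    unfolding limitin_def topology_generated_by_topspace openin_topology_generated_by_iff using assms(1) by blast
qed

lemma topspace_order_topology_on: "topspace (order_topology_on X) = X"
  unfolding order_topology_on_def topology_generated_by_topspace by blast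

lemma openin_order_topology_less: "a \<in> X \<Longrightarrow> openin (order_topology_on X) {y \<in> X. y < a}"
  unfolding order_topology_on_def by (rule topology_generated_by_Basis) blast

lemma openin_order_topology_greater: "a \<in> X \<Longrightarrow> openin (order_topology_on X) {y \<in> X. a < y}"
  unfolding order_topology_on_def by (rule topology_generated_by_Basis) blast

lemma Hausdorff_order_topology_on: "Hausdorff_space (order_topology_on X)"
proof -
  have sep: "\<exists>U V. openin (order_topology_on X) U \<and> openin (order_topology_on X) V \<and> x \<in> U \<and> y \<in> V \<and> disjnt U V"
    if "x \<in> X" "y \<in> X" "x < y" for x y
  proof (cases "\<exists>c\<in>X. x < c \<and> c < y")
    case True
    then obtain c where c: "c \<in> X" "x < c" "c < y" by blast
    show ?thesis
      by (rule exI[of _ "{z \<in> X. z < c}"], rule exI[of _ "{z \<in> X. c < z}"])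
        (use that c in \<open>auto simp: disjnt_def intro: openin_order_topology_less openin_order_topology_greater\<close>)
  next
    case False
    show ?thesis
      by (rule exI[of _ "{z \<in> X. z < y}"], rule exI[of _ "{z \<in> X. x < z}"])
        (use that False in \<open>auto simp: disjnt_def intro: openin_order_topology_less openin_order_topology_greater\<close>)
  qed
  show ?thesis
    unfolding Hausdorff_space_def topspace_order_topology_on
  proof (intro allI impI)
    fix x y assume "x \<in> X \<and> y \<in> X \<and> x \<noteq> y"
    then consider "x \<in> X" "y \<in> X" "x < y" | "x \<in> X" "y \<in> X" "y < x" using linorder_neqE by blast
    then show "\<exists>U V. openin (order_topology_on X) U \<and> openin (order_topology_on X) V \<and> x \<in> U \<and> y \<in> V \<and> disjnt U V"
    proof cases
      case 1
      then show ?thesis by (rule sep)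
    next
      case 2
      then show ?thesis using sep[OF 2(2,1,3)] disjnt_sym by blast
    qed
  qed
qed

context rotation_perm
begin

section \<open>The topology of the aperiodic part\<close>

abbreviation X0 :: "point topology" where "X0 \<equiv> order_topology_on Star"

lemma topspace_NP: "topspace (I_np_star_topology q \<pi>) = NP"
  by (auto simp: I_np_star_topology_def topspace_order_topology_on I_np_star_def)

text \<open>For a ray whose endpoint lies over a different real it suffices that floors are short.
  Otherwise the endpoint and the point are the two copies of a point of \<open>D\<close>, and a cut separates them.\<close>

lemma open_cylinder:
  assumes U: "generate_topology_on ({Star} \<union> {{y \<in> Star. y < a} | a. a \<in> Star} \<union> {{y \<in> Star. a < y} | a. a \<in> Star}) U"
    and p: "p \<in> NP" "p \<in> U"
  shows "\<exists>K. \<forall>k\<ge>K. \<forall>p'\<in>NP. padr k p' = padr k p \<longrightarrow> p' \<in> U"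
  using U p(2)
proof (induction rule: generate_topology_on.induct)
  case (Int a b)
  then obtain K L where "\<forall>k\<ge>K. \<forall>p'\<in>NP. padr k p' = padr k p \<longrightarrow> p' \<in> a"
    "\<forall>k\<ge>L. \<forall>p'\<in>NP. padr k p' = padr k p \<longrightarrow> p' \<in> b" by blast
  then have "\<forall>k\<ge>max K L. \<forall>p'\<in>NP. padr k p' = padr k p \<longrightarrow> p' \<in> a \<inter> b" by auto
  then show ?case by blast
next
  case (UN C)
  then obtain c K where "c \<in> C" "\<forall>k\<ge>K. \<forall>p'\<in>NP. padr k p' = padr k p \<longrightarrow> p' \<in> c" by blast
  then show ?case by (intro exI[of _ K]) blast
next
  case (Basis s)
  have far: "\<exists>K. \<forall>k\<ge>K. \<forall>p'\<in>NP. padr k p' = padr k p \<longrightarrow> \<bar>base p' - base p\<bar> < e" if e: "0 < e" for e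
  proof -
    obtain K where K: "\<forall>k\<ge>K. 1 / 2 ^ k < e" using pow_small[OF e] by blast
    have "\<bar>base p' - base p\<bar> < e" if "K \<le> k" "p' \<in> NP" "padr k p' = padr k p" for k p'
      using same_padr_close[OF NP_D(2)[OF that(2)] NP_D(2)[OF p(1)] NP_D(3)[OF that(2)] NP_D(3)[OF p(1)] that(3)]
        K that(1) by force
    then show ?thesis by blast
  qed
  have cut: "\<exists>K. \<forall>k\<ge>K. \<forall>p'\<in>NP. padr k p' = padr k p \<longrightarrow> (p' < At z \<longleftrightarrow> p < At z)" if z: "z \<in> DD" for z
  proof -
    obtain K where K: "\<forall>k\<ge>K. cut_at k z" using eventually_cut_D[OF z] unfolding eventually_cut_def by blast
    have "p' < At z \<longleftrightarrow> p < At z" if k: "K \<le> k" "p' \<in> NP" "padr k p' = padr k p" for k p'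
    proof -
      have "cut_at k z" using K k(1) by blast
      note sep = cut_separates[OF this]
      show ?thesis
        using sep[OF NP_D(2)[OF p(1)] NP_D(2)[OF k(2)] _ _ NP_D(3)[OF p(1)] NP_D(3)[OF k(2)]]
          sep[OF NP_D(2)[OF k(2)] NP_D(2)[OF p(1)] _ _ NP_D(3)[OF k(2)] NP_D(3)[OF p(1)]] k(3)
        by (metis not_le)
    qed
    then show ?thesis by blast
  qed
  have pS: "p \<in> Star" using NP_D(1)[OF p(1)] .
  have NS: "NP \<subseteq> Star" by (auto simp: I_np_star_def)
  consider "s = Star" | a where "a \<in> Star" "s = {y \<in> Star. y < a}" | a where "a \<in> Star" "s = {y \<in> Star. a < y}"
    using Basis(1) by blast
  then show ?case
  proof cases
    case 1
    then show ?thesis using NS by blast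
  next
    case (2 a)
    then have pa: "p < a" using Basis by simp
    show ?thesis
    proof (cases "base p < base a")
      case True
      then obtain K where K: "\<forall>k\<ge>K. \<forall>p'\<in>NP. padr k p' = padr k p \<longrightarrow> \<bar>base p' - base p\<bar> < base a - base p"
        using far[of "base a - base p"] by auto
      have "p' \<in> s" if "K \<le> k" "p' \<in> NP" "padr k p' = padr k p" for k p'
      proof -
        have "base p' < base a" using K that by force
        then show ?thesis using 2 NS that(2) by (auto simp: less_point_def)
      qed
      then show ?thesis by blast
    next
      case False
      then obtain z where z: "p = Minus z" "a = At z" using pa by (cases p; cases a) (auto simp: less_point_def)
      then have "z \<in> DD" using pS 2 by (auto simp: Star_Minus Star_At)
      from cut[OF this] obtain K where "\<forall>k\<ge>K. \<forall>p'\<in>NP. padr k p' = padr k p \<longrightarrow> (p' < At z \<longleftrightarrow> p < At z)" by blast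
      then have "\<forall>k\<ge>K. \<forall>p'\<in>NP. padr k p' = padr k p \<longrightarrow> p' \<in> s" using pa z 2 NS by blast
      then show ?thesis by blast
    qed
  next
    case (3 a)
    then have pa: "a < p" using Basis by simp
    show ?thesis
    proof (cases "base a < base p")
      case True
      then obtain K where K: "\<forall>k\<ge>K. \<forall>p'\<in>NP. padr k p' = padr k p \<longrightarrow> \<bar>base p' - base p\<bar> < base p - base a"
        using far[of "base p - base a"] by auto
      have "p' \<in> s" if "K \<le> k" "p' \<in> NP" "padr k p' = padr k p" for k p'
      proof -
        have "base a < base p'" using K that by force
        then show ?thesis using 3 NS that(2) by (auto simp: less_point_def)
      qed
      then show ?thesis by blast
    next
      case False
      then obtain z where z: "a = Minus z" "p = At z" using pa by (cases p; cases a) (auto simp: less_point_def)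
      then have "z \<in> DD" using pS 3 by (auto simp: Star_Minus Star_At)
      from cut[OF this] obtain K where "\<forall>k\<ge>K. \<forall>p'\<in>NP. padr k p' = padr k p \<longrightarrow> (p' < At z \<longleftrightarrow> p < At z)" by blast
      then have "\<forall>k\<ge>K. \<forall>p'\<in>NP. padr k p' = padr k p \<longrightarrow> a < p'"
        using z Minus_less_iff[of z] by (metis not_le less_irrefl)
      then have "\<forall>k\<ge>K. \<forall>p'\<in>NP. padr k p' = padr k p \<longrightarrow> p' \<in> s" using 3 NS by blast
      then show ?thesis by blast
    qed
  qed
qed simp

lemma cylinder_open:
  assumes p: "p \<in> NP"
  shows "\<exists>W. openin X0 W \<and> p \<in> W \<and> (\<forall>p'\<in>W. valid p' \<and> padr k p' = padr k p)"
proof -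
  have v: "valid p" using NP_D(2)[OF p] .
  obtain a b where ab: "a \<le> pcell k p" "pcell k p < b" "b \<le> Q k" "grid k a \<in> DD" "b = Q k \<or> grid k b \<in> DD"
    "\<And>e. a \<le> e \<Longrightarrow> e < b \<Longrightarrow> (inT k e \<longleftrightarrow> pinT k p) \<and> (pinT k p \<longrightarrow> adr k e = padr k p)"
    using cut_block[OF pcell_less[OF v]] by metis
  define W1 where "W1 = {r \<in> Star. a \<le> pcell k r}"
  define W2 where "W2 = {r \<in> Star. pcell k r < b}"
  have S: "openin X0 Star" using openin_topspace[of X0] by (simp add: topspace_order_topology_on)
  have "openin X0 W1"
  proof (cases "a = 0")
    case True
    then show ?thesis using S by (simp add: W1_def)
  next
    case False
    then have "Minus (grid k a) \<in> Star" using ab(4) q_pos by (simp add: Star_Minus)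
    moreover have "W1 = {r \<in> Star. Minus (grid k a) < r}" using grid_less_iff Star_valid by (auto simp: W1_def)
    ultimately show ?thesis using openin_order_topology_greater by metis
  qed
  moreover have "openin X0 W2"
  proof (cases "b = Q k")
    case True
    then have "W2 = Star" using pcell_less Star_valid by (auto simp: W2_def)
    then show ?thesis using S by simp
  next
    case False
    then have "grid k b \<in> DD" using ab(5) by blast
    then have "At (grid k b) \<in> Star" using D_range by (auto simp: Star_At)
    moreover have "W2 = {r \<in> Star. r < At (grid k b)}" using less_grid_iff Star_valid by (auto simp: W2_def)
    ultimately show ?thesis using openin_order_topology_less by metis
  qed
  ultimately have "openin X0 (W1 \<inter> W2)" by (rule openin_Int)
  moreover have "p \<in> W1 \<inter> W2" using ab(1,2) NP_D(1)[OF p] by (simp add: W1_def W2_def)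
  moreover have "valid p' \<and> padr k p' = padr k p" if "p' \<in> W1 \<inter> W2" for p'
    using that ab(6)[of "pcell k p'"] NP_D(3)[OF p, of k] Star_valid[of p'] by (simp add: W1_def W2_def)
  ultimately show ?thesis by blast
qed

lemma openin_NP_iff:
  "openin (I_np_star_topology q \<pi>) U \<longleftrightarrow> U \<subseteq> NP \<and> (\<forall>p\<in>U. \<exists>k. \<forall>p'\<in>NP. padr k p' = padr k p \<longrightarrow> p' \<in> U)"
proof (intro iffI conjI)
  assume o: "openin (I_np_star_topology q \<pi>) U"
  then obtain W where W: "openin X0 W" "U = W \<inter> NP"
    unfolding I_np_star_topology_def openin_subtopology by blast
  then show "U \<subseteq> NP" by blast
  have g: "generate_topology_on ({Star} \<union> {{y \<in> Star. y < a} | a. a \<in> Star} \<union> {{y \<in> Star. a < y} | a. a \<in> Star}) W"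
    using W(1) unfolding order_topology_on_def openin_topology_generated_by_iff .
  show "\<forall>p\<in>U. \<exists>k. \<forall>p'\<in>NP. padr k p' = padr k p \<longrightarrow> p' \<in> U"
  proof
    fix p assume "p \<in> U"
    then have "p \<in> NP" "p \<in> W" using W(2) by auto
    from open_cylinder[OF g this] show "\<exists>k. \<forall>p'\<in>NP. padr k p' = padr k p \<longrightarrow> p' \<in> U" using W(2) by blast
  qed
next
  assume a: "U \<subseteq> NP \<and> (\<forall>p\<in>U. \<exists>k. \<forall>p'\<in>NP. padr k p' = padr k p \<longrightarrow> p' \<in> U)"
  define \<W> where "\<W> = {W. openin X0 W \<and> W \<inter> NP \<subseteq> U}"
  have "U = \<Union>\<W> \<inter> NP"
  proof (intro equalityI subsetI)
    fix p assume p: "p \<in> U"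
    then obtain k where k: "\<forall>p'\<in>NP. padr k p' = padr k p \<longrightarrow> p' \<in> U" using a by blast
    obtain W where "openin X0 W" "p \<in> W" "\<forall>p'\<in>W. valid p' \<and> padr k p' = padr k p"
      using cylinder_open[of p k] p a by blast
    then have "W \<in> \<W>" "p \<in> W" using k unfolding \<W>_def by blast+
    then show "p \<in> \<Union>\<W> \<inter> NP" using p a by blast
  qed (auto simp: \<W>_def)
  moreover have "openin X0 (\<Union>\<W>)" by (rule openin_Union) (simp add: \<W>_def)
  ultimately show "openin (I_np_star_topology q \<pi>) U"
    unfolding I_np_star_topology_def openin_subtopology by blast
qed

section \<open>The extended map\<close>

text \<open>Just below \<open>1\<close> the inverse rotation is the translation from the last of the \<open>q\<close> intervals.\<close>

lemma x_hat_eq: "x_hat q \<pi> = (real (inv \<pi> (q - 1)) + 1) / real q"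
proof -
  let ?t = "(real (inv \<pi> (q - 1)) - real (q - 1)) / real q"
  have q0: "0 < real q" using q_pos by simp
  have q1: "real (q - 1) = real q - 1" using q_pos by (simp add: of_nat_diff)
  have "rotation_inv q \<pi> y = y + ?t" if y: "1 - 1 / real q < y" "y < 1" for y
  proof -
    have "1 / real q \<le> 1" using q_pos by simp
    then have y0: "0 \<le> y" using y by linarith
    have "real q * (1 - 1 / real q) < real q * y" "real q * y < real q * 1"
      using y q0 by (intro mult_strict_left_mono; simp)+
    then have "real q - 1 < real q * y" "real q * y < real q" using q0 by (simp_all add: right_diff_distrib)
    then have "cell 0 y = q - 1" by (intro cell_eqI) (use q1 in simp_all)
    then show ?thesis using rotation_inv(3)[OF y0 y(2)] by simp
  qed
  then have ev: "eventually (\<lambda>y. y + ?t = rotation_inv q \<pi> y) (at_left 1)"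
    unfolding eventually_at_left_field using q0 by (intro exI[of _ "1 - 1 / real q"]) auto
  have "((\<lambda>y. y + ?t) \<longlongrightarrow> 1 + ?t) (at_left 1)" by (intro tendsto_intros)
  then have "(rotation_inv q \<pi> \<longlongrightarrow> 1 + ?t) (at_left 1)" using ev by (rule Lim_transform_eventually)
  then have "x_hat q \<pi> = 1 + ?t" unfolding x_hat_def by (intro tendsto_Lim) auto
  also have "\<dots> = (real (inv \<pi> (q - 1)) + 1) / real q" using q0 q1 by (simp add: field_simps)
  finally show ?thesis .
qed

lemma x_hat_valid: "valid (Minus (x_hat q \<pi>))"
proof -
  have "inv \<pi> (q - 1) < q" using permutes_in_image[OF permutes_inv[OF perm], of "q - 1"] q_pos by simp
  then have "real (inv \<pi> (q - 1)) + 1 \<le> real q" by linarith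
  then show ?thesis using q_pos by (simp add: x_hat_eq field_simps)
qed

text \<open>At each level the cell of this point is sent to the last cell of the base, so the point is on
  all top floors.\<close>

lemma sig_x_hat: "sig k (pcell k (Minus (x_hat q \<pi>))) = q - 1"
proof -
  define j where "j = inv \<pi> (q - 1)"
  have "pcell k (Minus (x_hat q \<pi>)) = 2 ^ k * (j + 1) - 1" for k
  proof (rule pcell_Minus_eqI)
    have "real (Q k) * x_hat q \<pi> = 2 ^ k * (real j + 1)" using q_pos by (simp add: x_hat_eq j_def)
    moreover have "real (2 ^ k * (j + 1) - 1) = 2 ^ k * (real j + 1) - 1"
      by (simp add: of_nat_diff Suc_le_eq distrib_left)
    ultimately show "real (2 ^ k * (j + 1) - 1) < real (Q k) * x_hat q \<pi>"
      "real (Q k) * x_hat q \<pi> \<le> real (2 ^ k * (j + 1) - 1) + 1" by linarith+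
  qed
  moreover have "sig k (2 ^ k * (j + 1) - 1) = q - 1"
  proof (induction k)
    case 0
    then show ?case using permutes_inverses(1)[OF perm] by (simp add: j_def)
  next
    case (Suc k)
    have "(2 * c - 1) div 2 = c - 1 \<and> (2 * c - 1) mod 2 = 1" if "0 < c" for c :: nat using that by presburger
    from this[of "2 ^ k * (j + 1)"] have "sig (Suc k) (2 * (2 ^ k * (j + 1)) - 1) = swap_halves q (2 * (q - 1) + 1)"
      using Suc by (simp add: doubled_def)
    moreover have "swap_halves q (2 * (q - 1) + 1) = q - 1" using q2 by (auto simp: swap_halves_def)
    ultimately show ?case by (simp only: power_Suc mult.assoc)
  qed
  ultimately show ?thesis by simp
qed

lemma up_mono: "valid p \<Longrightarrow> q \<le> sig k (pcell k p) \<Longrightarrow> q \<le> sig (k + n) (pcell (k + n) p)"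
  using top_contract[of k n "pcell (k + n) p"] pcell_div[of p k n] by (metis not_le)

text \<open>A point sent into the base at every level has the same cells as \<open>x_hat\<close>, by the contraction.\<close>

lemma exists_up_Minus:
  assumes v: "valid (Minus z)" and z: "z \<noteq> x_hat q \<pi>"
  shows "\<exists>k. q \<le> sig k (pcell k (Minus z))"
proof (rule ccontr)
  assume "\<not> ?thesis"
  then have t: "sig k (pcell k (Minus z)) < q" for k by (metis not_le)
  have "\<bar>z - x_hat q \<pi>\<bar> \<le> 1 / 2 ^ k" for k
  proof -
    let ?c = "pcell k (Minus z)"
    have "sig k ?c = q - 1" using top_contract_q[OF t[of "k + q"]] pcell_div[OF v, of k q] by simp
    then have "?c = pcell k (Minus (x_hat q \<pi>))" using sig_x_hat[of k] injD[OF S.inj_g[of k]] by metis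
    then have "\<bar>real (Q k) * z - real (Q k) * x_hat q \<pi>\<bar> \<le> 1"
      using pcell_bounds[OF v, of k] pcell_bounds[OF x_hat_valid, of k] unfolding base.simps by linarith
    then have "real (Q k) * \<bar>z - x_hat q \<pi>\<bar> \<le> 1"
      unfolding right_diff_distrib[symmetric] abs_mult using Q_pos[of k] by simp
    moreover have "2 ^ k * \<bar>z - x_hat q \<pi>\<bar> \<le> real (Q k) * \<bar>z - x_hat q \<pi>\<bar>"
      using q_pos by (intro mult_right_mono) auto
    ultimately have "2 ^ k * \<bar>z - x_hat q \<pi>\<bar> \<le> 1" by linarith
    then show ?thesis by (simp add: field_simps)
  qed
  then have "z = x_hat q \<pi>" using pow_small[of "\<bar>z - x_hat q \<pi>\<bar>"] z by (metis abs_ge_zero abs_le_zero_iff eq_iff_diff_eq_0 less_le not_le order_refl)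
  then show False using z by simp
qed

lemma left_cell:
  assumes "0 < z" "z \<le> 1"
  shows "eventually (\<lambda>y. 0 \<le> y \<and> y < 1 \<and> cell k y = pcell k (Minus z)) (at_left z)"
proof -
  let ?c = "pcell k (Minus z)"
  have b: "real ?c < real (Q k) * z" "real (Q k) * z \<le> real ?c + 1" using pcell_Minus[OF assms(1), of k] by auto
  have Qp: "0 < real (Q k)" by (rule Q_pos)
  have lt: "grid k ?c < z" using b(1) Qp by (simp only: pos_divide_less_eq mult.commute)
  have "0 \<le> y \<and> y < 1 \<and> cell k y = ?c" if "grid k ?c < y" "y < z" for y
  proof -
    have "real ?c < real (Q k) * y" using that(1) Qp by (simp only: pos_divide_less_eq mult.commute)
    moreover have "real (Q k) * y < real (Q k) * z" using that(2) Qp by (intro mult_strict_left_mono) auto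
    ultimately have "cell k y = ?c" using b by (intro cell_eqI) linarith+
    moreover have "0 \<le> grid k ?c" by simp
    ultimately show ?thesis using that assms(2) by linarith
  qed
  then show ?thesis unfolding eventually_at_left_field using lt by blast
qed

text \<open>Near \<open>z\<close> on the left \<open>F\<close> is a translation by \<open>t\<close>, hence \<open>Minus (z + t)\<close> is the limit, provided
  that it is a point of the compactification. If \<open>z + t\<close> were not in \<open>D\<close> then \<open>F\<close> would carry \<open>z\<close> to \<open>z + t\<close> as well,
  because cells move together there, and \<open>z\<close> would not be in \<open>D\<close>.\<close>

lemma F_star_Minus:
  assumes zS: "Minus z \<in> Star" and zx: "z \<noteq> x_hat q \<pi>"
  obtains t where "Minus (z + t) \<in> Star" "F_star q \<pi> (Minus z) = Minus (z + t)"
    "eventually (\<lambda>y. F y = y + t) (at_left z)"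
proof -
  have v: "valid (Minus z)" using Star_valid[OF zS] .
  then have z: "0 < z" "z \<le> 1" by auto
  obtain K where K: "q \<le> sig K (pcell K (Minus z))" using exists_up_Minus[OF v zx] by blast
  obtain L where L: "\<And>n. L \<le> n \<Longrightarrow> \<exists>c\<le>Q n. z = grid n c"
  proof (cases "z = 1")
    case True
    then have "z = grid n (Q n)" for n using q_pos by simp
    then show ?thesis using that by blast
  next
    case False
    then have "z \<in> DD" using zS by (simp add: Star_Minus)
    from eventually_cut_D[OF this] obtain L where L: "\<forall>k\<ge>L. cut_at k z" unfolding eventually_cut_def by blast
    have "\<exists>c\<le>Q n. z = grid n c" if "L \<le> n" for n
      using L that unfolding cut_at_def by (meson less_imp_le)
    then show ?thesis using that by blast
  qed
  define n where "n = max K L"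
  obtain c where c: "c \<le> Q n" "z = grid n c" using L[of n] by (auto simp: n_def)
  have Qp: "0 < real (Q n)" by (rule Q_pos)
  have c0: "0 < c" using z(1) c(2) by (cases c) auto
  have qz: "real (Q n) * z = real c" unfolding c(2) using q_pos by simp
  have pc: "pcell n (Minus z) = c - 1" by (rule pcell_Minus_eqI) (use qz c0 in \<open>simp_all add: of_nat_diff\<close>)
  obtain e where "n = K + e" using le_Suc_ex[of K n] by (auto simp: n_def)
  then have u: "q \<le> sig n (c - 1)" using up_mono[OF v K, of e] pc by simp
  have c1: "c - 1 < Q n" using c(1) c0 by simp
  define g where "g = Suc (sig n (c - 1))"
  have gQ: "g \<le> Q n" using S.g_less[OF c1] by (simp add: g_def)
  define t where "t = (real (sig n (c - 1)) - real (c - 1)) / real (Q n)"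
  have "real (c - 1) = real c - 1" using c0 by (simp add: of_nat_diff)
  then have zt: "z + t = grid n g" by (simp add: c(2) t_def g_def diff_divide_distrib add_divide_distrib)
  have evF: "eventually (\<lambda>y. F y = y + t) (at_left z)"
    using left_cell[OF z, of n]
  proof eventually_elim
    case (elim y)
    then show ?case using F_up[of y n] u pc by (simp add: t_def)
  qed
  have gD: "grid n g \<in> DD \<union> {1}"
  proof (rule ccontr)
    assume nD: "\<not> ?thesis"
    have "g \<noteq> Q n" using nD Qp by auto
    then have gl: "g < Q n" using gQ by simp
    have gq: "q \<le> g" using u by (simp add: g_def)
    obtain c' where c': "c' < Q n" "sig n c' = g" "grid n c' \<notin> DD"
      using uncut_preimage[OF gl gq] nD by blast
    have "g = Suc (sig n (c' - 1))" "0 < c'" using uncut_step(1,3)[OF c'(1,3)] c'(2) gq by auto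
    then have "c' - 1 = c - 1" using injD[OF S.inj_g[of n], of "c' - 1" "c - 1"] by (simp add: g_def)
    then have "c' = c" using c0 \<open>0 < c'\<close> by simp
    then have "z \<notin> DD" "z < 1" using c' c(2) grid_range[of c n] by auto
    then show False using zS by (simp add: Star_Minus)
  qed
  moreover have g0: "grid n g \<noteq> 0" using q_pos by (simp add: g_def)
  ultimately have zS': "Minus (z + t) \<in> Star" unfolding Star_Minus zt by blast
  have inv: "eventually (\<lambda>y. 0 \<le> y \<and> y < 1) (at_left z)" using left_cell[OF z, of n] by eventually_elim auto
  have lim: "limitin X0 (\<lambda>y. At (F y)) (Minus (z + t)) (at_left z)"
    unfolding order_topology_on_def
  proof (rule limitin_generated)
    show "Minus (z + t) \<in> \<Union>({Star} \<union> {{y \<in> Star. y < a} |a. a \<in> Star} \<union> {{y \<in> Star. a < y} |a. a \<in> Star})"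
      using zS' by blast
    fix B assume B: "B \<in> {Star} \<union> {{y \<in> Star. y < a} |a. a \<in> Star} \<union> {{y \<in> Star. a < y} |a. a \<in> Star}"
      and lB: "Minus (z + t) \<in> B"
    have inS: "eventually (\<lambda>y. At (F y) \<in> Star) (at_left z)"
      using inv by eventually_elim (use F_range in \<open>force simp: Star_At\<close>)
    have lt: "eventually (\<lambda>y. y < z) (at_left z)" by (simp add: eventually_at_left_field) (use lt_ex in blast)
    consider "B = Star" | a where "B = {y \<in> Star. y < a}" | a where "B = {y \<in> Star. a < y}" using B by blast
    then show "eventually (\<lambda>y. At (F y) \<in> B) (at_left z)"
    proof cases
      case 1
      then show ?thesis using inS by simp
    next
      case (2 a)
      then have "Minus (z + t) < a" using lB by simp
      show ?thesis using inS evF lt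
      proof eventually_elim
        case (elim y)
        then have "At (F y) < Minus (z + t)" by (simp add: less_point_def)
        then show ?case using elim 2 \<open>Minus (z + t) < a\<close> by (auto intro: less_trans)
      qed
    next
      case (3 a)
      then have "base a < z + t" using lB by (cases a) (auto simp: less_point_def)
      then have "eventually (\<lambda>y. base a - t < y) (at_left z)"
        unfolding eventually_at_left_field by (intro exI[of _ "base a - t"]) auto
      then show ?thesis using inS evF
      proof eventually_elim
        case (elim y)
        then show ?case using 3 by (simp add: less_point_def)
      qed
    qed
  qed
  have "(THE l. limitin X0 (\<lambda>y. At (F y)) l (at_left z)) = Minus (z + t)"
  proof (rule the_equality[where P = "\<lambda>l. limitin X0 (\<lambda>y. At (F y)) l (at_left z)", OF lim])
    fix l assume "limitin X0 (\<lambda>y. At (F y)) l (at_left z)"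
    then show "l = Minus (z + t)"
      by (rule limitin_Hausdorff_unique[OF _ lim _ Hausdorff_order_topology_on]) simp
  qed
  then have "F_star q \<pi> (Minus z) = Minus (z + t)" using zx by simp
  then show ?thesis using that zS' evF by blast
qed

text \<open>On cells the extended map acts like \<open>F\<close>, also at the added points, where the action is read off
  from nearby reals on the left.\<close>

lemma F_star_step:
  assumes p: "p \<in> Star"
  shows "F_star q \<pi> p \<in> Star"
    "q \<le> sig k (pcell k p) \<Longrightarrow> pcell k (F_star q \<pi> p) = sig k (pcell k p)"
    "sig k (pcell k p) < q \<Longrightarrow> pcell k (F_star q \<pi> p) < q"
proof -
  have "F_star q \<pi> p \<in> Star \<and> (q \<le> sig k (pcell k p) \<longrightarrow> pcell k (F_star q \<pi> p) = sig k (pcell k p)) \<and>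
    (sig k (pcell k p) < q \<longrightarrow> pcell k (F_star q \<pi> p) < q)"
  proof (cases p)
    case (At x)
    then have x: "0 \<le> x" "x < 1" using p by (simp_all add: Star_At)
    then show ?thesis using At F_range[OF x] cell_F[OF x, of k] cell_F_top[OF x, of k] by (simp add: Star_At)
  next
    case (Minus z)
    show ?thesis
    proof (cases "z = x_hat q \<pi>")
      case True
      have "cell k 0 = 0" by (rule cell_eqI) auto
      then show ?thesis using Minus True sig_x_hat[of k] q_pos by (simp add: Star_At del: pcell.simps(2))
    next
      case False
      have zS: "Minus z \<in> Star" using p Minus by simp
      obtain t where t: "Minus (z + t) \<in> Star" "F_star q \<pi> (Minus z) = Minus (z + t)"
        "eventually (\<lambda>y. F y = y + t) (at_left z)" using F_star_Minus[OF zS False] .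
      have z: "0 < z" "z \<le> 1" using Star_valid[OF zS] by auto
      have zt: "0 < z + t" "z + t \<le> 1" using Star_valid[OF t(1)] by auto
      have "eventually (\<lambda>w. 0 \<le> w \<and> w < 1 \<and> cell k w = pcell k (Minus (z + t))) (at_left (z + t))"
        using left_cell[OF zt] .
      then have "eventually (\<lambda>y. cell k (y + t) = pcell k (Minus (z + t))) (at_left z)"
        unfolding eventually_at_left_field
      proof (elim exE conjE)
        fix b assume b: "b < z + t" "\<forall>w>b. w < z + t \<longrightarrow> 0 \<le> w \<and> w < 1 \<and> cell k w = pcell k (Minus (z + t))"
        show "\<exists>b<z. \<forall>y>b. y < z \<longrightarrow> cell k (y + t) = pcell k (Minus (z + t))"
          using b by (intro exI[of _ "b - t"] conjI allI impI) (simp_all del: pcell.simps)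
      qed
      then have "eventually (\<lambda>y. 0 \<le> y \<and> y < 1 \<and> cell k y = pcell k (Minus z) \<and>
          cell k (F y) = pcell k (Minus (z + t))) (at_left z)"
        using left_cell[OF z, of k] t(3) by eventually_elim (simp del: pcell.simps)
      then obtain y where y: "0 \<le> y" "y < 1" "cell k y = pcell k (Minus z)" "cell k (F y) = pcell k (Minus (z + t))"
        using eventually_happens[of _ "at_left z"] by (auto simp del: pcell.simps)
      show ?thesis
        unfolding Minus t(2) y(3)[symmetric] y(4)[symmetric] using t(1) cell_F[OF y(1,2), of k] cell_F_top[OF y(1,2), of k] by blast
    qed
  qed
  then show "F_star q \<pi> p \<in> Star"
    "q \<le> sig k (pcell k p) \<Longrightarrow> pcell k (F_star q \<pi> p) = sig k (pcell k p)"
    "sig k (pcell k p) < q \<Longrightarrow> pcell k (F_star q \<pi> p) < q" by auto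
qed

section \<open>The aperiodic part as a tower system\<close>

abbreviation Phi :: "point \<Rightarrow> point" where "Phi \<equiv> F_star q \<pi>"

lemma padr_Phi_up:
  assumes p: "p \<in> Star" and t: "pinT k p" and u: "Suc (snd (padr k p)) < hgt k (fst (padr k p))"
  shows "pinT k (Phi p) \<and> padr k (Phi p) = (fst (padr k p), Suc (snd (padr k p)))"
    "q \<le> sig k (pcell k p)"
proof -
  obtain i s where i: "i < q" "s < hgt k i" "pcell k p = (sig k ^^ s) i" "padr k p = (block k i, s)"
    using inT_floor[OF t] .
  have s: "Suc s < hgt k i" using u i(4) hgt_block[OF i(1)] by simp
  have eq: "sig k (pcell k p) = (sig k ^^ Suc s) i" using i(3) by simp
  show up: "q \<le> sig k (pcell k p)" unfolding eq using S.before_return[OF i(1) _ s] by simp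
  then have c: "pcell k (Phi p) = (sig k ^^ Suc s) i" using F_star_step(2)[OF p] eq by simp
  then have "pinT k (Phi p)" unfolding in_tower_def using i(1) s by blast
  then show "pinT k (Phi p) \<and> padr k (Phi p) = (fst (padr k p), Suc (snd (padr k p)))"
    using adr_eq[OF i(1) s c] i(4) by simp
qed

lemma padr_Phi_top:
  assumes p: "p \<in> Star" and t: "pinT k p" and u: "Suc (snd (padr k p)) = hgt k (fst (padr k p))"
  shows "snd (padr k (Phi p)) = 0" "sig k (pcell k p) < q"
proof -
  obtain i s where i: "i < q" "s < hgt k i" "pcell k p = (sig k ^^ s) i" "padr k p = (block k i, s)"
    using inT_floor[OF t] .
  have s: "Suc s = hgt k i" using u i(4) hgt_block[OF i(1)] by simp
  show lt: "sig k (pcell k p) < q" using S.return_less[OF i(1), of k] i(3) by (simp add: s[symmetric])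
  have c: "pcell k (Phi p) < q" using F_star_step(3)[OF p lt] .
  have h: "0 < hgt k (pcell k (Phi p))" using S.return_time_ge1[OF c, of k] by simp
  have "padr k (Phi p) = (block k (pcell k (Phi p)), 0)" using adr_eq[OF c h] by simp
  then show "snd (padr k (Phi p)) = 0" by simp
qed

lemma up_not_top: "pinT k p \<Longrightarrow> q \<le> sig k (pcell k p) \<Longrightarrow> Suc (snd (padr k p)) < hgt k (fst (padr k p))"
proof -
  assume t: "pinT k p" and u: "q \<le> sig k (pcell k p)"
  obtain i s where i: "i < q" "s < hgt k i" "pcell k p = (sig k ^^ s) i" "padr k p = (block k i, s)"
    using inT_floor[OF t] .
  then show ?thesis using S.next_floor[of k s i] u hgt_block[OF i(1)] by simp
qed

lemma zero_NP: "At 0 \<in> NP"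
  using Aper_NP[of 0] zero_not_Per by simp

text \<open>Away from the exceptional point some level, and each deeper one, moves the point up one
  floor, and an aperiodic real on the same floor moves along.\<close>

lemma Phi_NP:
  assumes p: "p \<in> NP"
  shows "Phi p \<in> NP"
proof (cases "p = Minus (x_hat q \<pi>)")
  case True
  then show ?thesis using zero_NP by simp
next
  case False
  have pS: "p \<in> Star" and v: "valid p" using NP_D[OF p] by auto
  have "\<exists>k. q \<le> sig k (pcell k p)"
  proof (cases p)
    case (At x)
    then have "0 \<le> x" "x < 1" using v by auto
    then obtain K where "\<And>k. K \<le> k \<Longrightarrow> q \<le> sig k (cell k x)" using exists_up by blast
    then show ?thesis using At by auto
  next
    case (Minus z)
    then show ?thesis using exists_up_Minus[of z] v False by blast
  qed
  then obtain K where K: "q \<le> sig K (pcell K p)" by blast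
  have S': "Phi p \<in> Star" using F_star_step(1)[OF pS] .
  have v': "valid (Phi p)" using Star_valid[OF S'] .
  show ?thesis
    unfolding NP_iff
  proof (intro conjI allI)
    show "Phi p \<in> Star" by (rule S')
    fix k
    define n where "n = K + k"
    have u: "q \<le> sig n (pcell n p)" using up_mono[OF v K, of k] by (simp add: n_def)
    have nt: "Suc (snd (padr n p)) < hgt n (fst (padr n p))" using up_not_top[OF NP_D(3)[OF p] u] .
    note A = padr_Phi_up(1)[OF pS NP_D(3)[OF p] nt]
    obtain x where x: "x \<in> Aper" "adr n (cell n x) = padr n p" using NP_D(4)[OF p] by blast
    have xN: "At x \<in> NP" using Aper_NP[OF x(1)] .
    have ex: "padr n (At x) = padr n p" using x(2) by simp
    have B: "padr n (At (F x)) = padr n (Phi p)"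
      using padr_Phi_up(1)[OF NP_D(1,3)[OF xN], of n] nt A unfolding ex by simp
    have FA: "F x \<in> Aper" using x(1) F_range[of x] Per_F[of x] by auto
    have FN: "At (F x) \<in> NP" using Aper_NP[OF FA] .
    have nk: "n = k + K" by (simp add: n_def)
    show "pinT k (Phi p)" using pinT_down[OF v', of k K] A nk by simp
    have "padr k (At (F x)) = padr k (Phi p)"
      using padr_mono[OF NP_D(2)[OF FN] v', of k K] NP_D(3)[OF FN] A B nk by simp
    then show "\<exists>x\<in>Aper. adr k (cell k x) = padr k (Phi p)" using FA by auto
  qed
qed

text \<open>An aperiodic real on one floor of a tower yields one on each floor, by translation down to the
  base and up again.\<close>

lemma padr_fill:
  assumes p: "p \<in> NP" and s: "s < hgt k (fst (padr k p))"
  shows "\<exists>p'\<in>NP. padr k p' = (fst (padr k p), s)"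
proof -
  obtain x where x: "x \<in> Aper" "adr k (cell k x) = padr k p" using NP_D(4)[OF p] by blast
  obtain i r where i: "i < q" "r < hgt k i" "cell k x = (sig k ^^ r) i" "adr k (cell k x) = (block k i, r)"
    using inT_floor[OF Aper_inT[OF x(1)]] .
  have Qp: "0 < real (Q k)" by (rule Q_pos)
  define y where "y = x - (real (cell k x) - real i) / real (Q k)"
  have qy: "real (Q k) * y = real (Q k) * x - (real (cell k x) - real i)"
    unfolding y_def right_diff_distrib using q_pos by simp
  have cb: "real (cell k x) \<le> real (Q k) * x" "real (Q k) * x < real (cell k x) + 1"
    using cell_bounds[of x k] x(1) by auto
  have cy: "cell k y = i" by (rule cell_eqI) (use qy cb in linarith)+
  have "real i + 1 \<le> real (Q k)" using less_Q[OF i(1), of k] by (metis Suc_leI of_nat_Suc of_nat_le_iff add.commute)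
  then have "0 \<le> real (Q k) * y" "real (Q k) * y < real (Q k) * 1" using qy cb by linarith+
  then have y: "0 \<le> y" "y < 1" using Qp by (simp_all only: zero_le_mult_iff mult_less_cancel_left_pos) auto
  have "(F ^^ r) y = x" using F_pow_tower(1)[OF y, of k r] cy i by (simp add: y_def)
  then have "y \<notin> Per" using Per_F_pow[OF y, of r] x(1) by auto
  moreover have "0 \<le> (F ^^ s) y \<and> (F ^^ s) y < 1" using F_pow_range[OF y] .
  ultimately have A: "(F ^^ s) y \<in> Aper" using Per_F_pow[OF y, of s] by auto
  have si: "s < hgt k i" using s x(2) i(4) hgt_block[OF i(1)] by (metis fst_conv)
  have "cell k ((F ^^ s) y) = (sig k ^^ s) i" using F_pow_tower(2)[OF y, of k s] cy i(1) si by simp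
  then have "padr k (At ((F ^^ s) y)) = (block k i, s)" using adr_eq[OF i(1) si] by simp
  then show ?thesis using Aper_NP[OF A] x(2) i(4) by (metis fst_conv)
qed

lemma right_cell:
  assumes "0 \<le> b"
  shows "\<exists>e>0. \<forall>y. b \<le> y \<longrightarrow> y < b + e \<longrightarrow> cell k y = cell k b"
proof -
  let ?c = "cell k b"
  have c: "real ?c \<le> real (Q k) * b" "real (Q k) * b < real ?c + 1" using cell_bounds[OF assms, of k] by auto
  have Qp: "0 < real (Q k)" by (rule Q_pos)
  define u where "u = grid k (Suc ?c)"
  have u: "real (Q k) * u = real ?c + 1" using q_pos by (simp add: u_def)
  have "real (Q k) * b < real (Q k) * u" using c u by simp
  then have bu: "b < u" using Qp by (simp only: mult_less_cancel_left_pos)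
  have "cell k y = ?c" if "b \<le> y" "y < b + (u - b)" for y
  proof (rule cell_eqI)
    have "real (Q k) * b \<le> real (Q k) * y" using that Qp by (intro mult_left_mono) auto
    then show "real ?c \<le> real (Q k) * y" using c by linarith
    have "real (Q k) * y < real (Q k) * u" using that Qp by (intro mult_strict_left_mono) auto
    then show "real (Q k) * y < real ?c + 1" using u by simp
  qed
  moreover have "0 < u - b" using bu by simp
  ultimately show ?thesis by blast
qed

text \<open>Aperiodic reals from nested floors form a Cauchy sequence with a limit \<open>b\<close>. If infinitely
  many terms are at least \<open>b\<close>, the point is \<open>At b\<close>; otherwise it is \<open>Minus b\<close>, or again \<open>At b\<close> when \<open>b\<close> is
  not split, in which case the cells on both sides have the same address.\<close>

lemma padr_realize:
  assumes x: "\<And>k. x k \<in> NP" and step: "\<And>k. padr k (x (Suc k)) = padr k (x k)"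
  shows "\<exists>p\<in>NP. \<forall>k. padr k p = padr k (x k)"
proof -
  have xn: "padr k (x (k + n)) = padr k (x k)" for k n
  proof (induction n)
    case (Suc n)
    have "padr (k + n) (x (Suc (k + n))) = padr (k + n) (x (k + n))" using step .
    then have "padr k (x (Suc (k + n))) = padr k (x (k + n))"
      by (rule padr_mono[OF NP_D(2)[OF x] NP_D(2)[OF x] NP_D(3)[OF x] NP_D(3)[OF x]])
    then show ?case using Suc by simp
  qed simp
  have "\<exists>w\<in>Aper. adr k (cell k w) = padr k (x k)" for k using NP_D(4)[OF x] .
  then obtain w where w: "\<And>k. w k \<in> Aper" "\<And>k. adr k (cell k (w k)) = padr k (x k)" by metis
  have wN: "At (w k) \<in> NP" for k using Aper_NP[OF w(1)] .
  have wn: "padr k (At (w n)) = padr k (x k)" if "k \<le> n" for k n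
  proof -
    obtain m where m: "n = k + m" using \<open>k \<le> n\<close> le_Suc_ex by blast
    have "padr (k + m) (At (w n)) = padr (k + m) (x n)" using w(2)[of n] m by simp
    then have "padr k (At (w n)) = padr k (x n)"
      by (rule padr_mono[OF NP_D(2)[OF wN] NP_D(2)[OF x] NP_D(3)[OF wN] NP_D(3)[OF x]])
    then show ?thesis using xn[of k m] m by simp
  qed
  have close: "\<bar>w n - w m\<bar> \<le> 1 / 2 ^ k" if "k \<le> n" "k \<le> m" for k n m
    using same_padr_close[OF NP_D(2)[OF wN] NP_D(2)[OF wN] NP_D(3)[OF wN] NP_D(3)[OF wN], of k n m] wn that by simp
  have "Cauchy w"
  proof (rule CauchyI)
    fix e :: real assume "0 < e"
    then obtain K where K: "\<forall>k\<ge>K. 1 / 2 ^ k < e" using pow_small by blast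
    have "norm (w m - w n) < e" if "K \<le> m" "K \<le> n" for m n
      using close[OF that] K by force
    then show "\<exists>marks. \<forall>m\<ge>marks. \<forall>n\<ge>marks. norm (w m - w n) < e" by blast
  qed
  then obtain b where b: "w \<longlonglongrightarrow> b" using Cauchy_convergent convergent_def by blast
  have b01: "0 \<le> b" "b \<le> 1"
    using LIMSEQ_le_const[OF b, of 0] LIMSEQ_le_const2[OF b, of 1] w(1) by (auto intro: less_imp_le)
  have near: "\<exists>N. \<forall>n\<ge>N. \<bar>w n - b\<bar> < e" if "0 < e" for e
    using LIMSEQ_D[OF b that] by simp
  have "\<exists>p\<in>Star. \<forall>k. \<exists>n\<ge>k. pinT k p \<and> padr k p = padr k (At (w n))"
  proof (cases "\<forall>N. \<exists>n\<ge>N. b \<le> w n")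
    case True
    then have "b < 1" using w(1) by (metis Diff_iff atLeastLessThan_iff order.strict_trans1)
    then have S: "At b \<in> Star" using b01 by (simp add: Star_At)
    have "\<exists>n\<ge>k. pinT k (At b) \<and> padr k (At b) = padr k (At (w n))" for k
    proof -
      obtain e where e: "0 < e" "\<And>y. b \<le> y \<Longrightarrow> y < b + e \<Longrightarrow> cell k y = cell k b"
        using right_cell[OF b01(1), of k] by blast
      obtain N where N: "\<And>n. N \<le> n \<Longrightarrow> \<bar>w n - b\<bar> < e" using near[OF e(1)] by blast
      obtain n where n: "n \<ge> max N k" "b \<le> w n" using True by blast
      then have "cell k (w n) = cell k b" using N[of n] by (intro e(2)) auto
      then show ?thesis using n(1) Aper_inT[OF w(1), of k n] by (intro exI[of _ n]) simp
    qed
    then show ?thesis using S by blast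
  next
    case False
    then obtain N0 where N0: "\<And>n. N0 \<le> n \<Longrightarrow> w n < b" by (metis not_le)
    have b0: "0 < b" using N0[of N0] w(1)[of N0] by auto
    have L: "\<exists>n\<ge>k. pinT k (Minus b) \<and> padr k (Minus b) = padr k (At (w n))" for k
    proof -
      obtain u where u: "u < b" "\<And>y. u < y \<Longrightarrow> y < b \<Longrightarrow> cell k y = pcell k (Minus b)"
        using left_cell[OF b0 b01(2), of k] unfolding eventually_at_left_field by blast
      obtain N where N: "\<And>n. N \<le> n \<Longrightarrow> \<bar>w n - b\<bar> < b - u" using near[of "b - u"] u(1) by auto
      define n where "n = max k (max N0 N)"
      have "N \<le> n" "N0 \<le> n" by (simp_all add: n_def)
      then have "\<bar>w n - b\<bar> < b - u" "w n < b" using N N0 by blast+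
      then have "cell k (w n) = pcell k (Minus b)" by (intro u(2)) linarith+
      then show ?thesis using Aper_inT[OF w(1), of k n]
        by (intro exI[of _ n]) (simp add: n_def del: pcell.simps(2))
    qed
    show ?thesis
    proof (cases "b \<in> DD \<or> b = 1")
      case True
      then have "Minus b \<in> Star" using b0 by (auto simp: Star_Minus)
      then show ?thesis using L by blast
    next
      case False
      then have b1: "b < 1" "b \<notin> DD" using b01 by auto
      then have S: "At b \<in> Star" using b01 by (simp add: Star_At)
      have "\<exists>n\<ge>k. pinT k (At b) \<and> padr k (At b) = padr k (At (w n))" for k
      proof -
        let ?c = "cell k b"
        have c: "?c < Q k" using cell_less[OF b01(1) b1(1)] .
        have cb: "real ?c \<le> real (Q k) * b" "real (Q k) * b < real ?c + 1" using cell_bounds[OF b01(1), of k] by auto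
        have "(pinT k (Minus b) \<longleftrightarrow> inT k ?c) \<and> (inT k ?c \<longrightarrow> padr k (Minus b) = adr k ?c)"
        proof (cases "real ?c = real (Q k) * b")
          case True
          have g: "b = grid k ?c" using True q_pos by simp
          have nD: "grid k ?c \<notin> DD" using b1(2) g by metis
          have c0: "0 < ?c" using uncut_step(1)[OF c nD] .
          have "real (?c - 1) = real ?c - 1" using c0 by (simp add: of_nat_diff)
          then have "pcell k (Minus b) = ?c - 1" by (intro pcell_Minus_eqI) (use True in linarith)+
          then show ?thesis using uncut_adr[OF c nD] by simp
        next
          case False
          have "pcell k (Minus b) = ?c" by (rule pcell_Minus_eqI) (use False cb in linarith)+
          then show ?thesis by simp
        qed
        then show ?thesis using L[of k] by auto
      qed
      then show ?thesis using S by blast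
    qed
  qed
  then obtain p where p: "p \<in> Star" "\<And>k. \<exists>n\<ge>k. pinT k p \<and> padr k p = padr k (At (w n))" by blast
  have "pinT k p \<and> padr k p = padr k (x k)" for k
    using p(2)[of k] wn by metis
  moreover from this have "p \<in> NP" unfolding NP_iff using p(1) w by metis
  ultimately show ?thesis by blast
qed

text \<open>The levels of the diagram are shifted by one against those of the cells: level \<open>0\<close> is the
  root, and the vertices of level \<open>1\<close> are the blocks of the \<open>q\<close> intervals that carry
  aperiodic points, with towers of height \<open>1\<close>.\<close>

definition lvl_vtx :: "nat \<Rightarrow> point \<Rightarrow> nat" where
  "lvl_vtx k p = (case k of 0 \<Rightarrow> 0 | Suc k \<Rightarrow> fst (padr k p))"

definition lvl_flr :: "nat \<Rightarrow> point \<Rightarrow> nat" where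
  "lvl_flr k p = (case k of 0 \<Rightarrow> 0 | Suc k \<Rightarrow> snd (padr k p))"

definition lvl_height :: "nat \<Rightarrow> nat \<Rightarrow> nat" where
  "lvl_height k i = (case k of 0 \<Rightarrow> 1 | Suc k \<Rightarrow> hgt k i)"

definition lvl_chi :: "nat \<Rightarrow> nat \<Rightarrow> nat list" where
  "lvl_chi k i = (case k of 0 \<Rightarrow> [0] | Suc k \<Rightarrow> merged k i)"

lemma lvl_simps [simp]:
  "lvl_vtx 0 p = 0" "lvl_vtx (Suc k) p = fst (padr k p)"
  "lvl_flr 0 p = 0" "lvl_flr (Suc k) p = snd (padr k p)"
  "lvl_height 0 i = 1" "lvl_height (Suc k) i = hgt k i"
  "lvl_chi 0 i = [0]" "lvl_chi (Suc k) i = merged k i"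
  by (simp_all add: lvl_vtx_def lvl_flr_def lvl_height_def lvl_chi_def)

lemma lvl_height_eq: "lvl_height (Suc k) = hgt k" "lvl_height 0 = (\<lambda>_. 1)"
  by (auto simp: fun_eq_iff)

lemma tower_coding_NP: "tower_coding (I_np_star_topology q \<pi>) Phi lvl_vtx lvl_flr lvl_height lvl_chi"
proof (unfold_locales, unfold topspace_NP)
  show "NP \<noteq> {}" using zero_NP by blast
  show "Phi p \<in> NP" if "p \<in> NP" for p using Phi_NP[OF that] .
  show "lvl_vtx 0 p = 0" "lvl_chi 0 i = [0]" "lvl_height 0 0 = 1" for p i by simp_all
  show "finite (lvl_vtx k ` NP)" for k
  proof (rule finite_subset)
    show "lvl_vtx k ` NP \<subseteq> {..<q}"
      using q_pos adr_bounds(1)[OF NP_D(3)] by (cases k) auto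
  qed simp
  show "lvl_height (Suc k) (lvl_vtx (Suc k) p) = sum_list (map (lvl_height k) (lvl_chi k (lvl_vtx (Suc k) p)))"
    if p: "p \<in> NP" for p k
  proof (cases k)
    case 0
    have "fst (padr 0 p) < q" using adr_bounds(1)[OF NP_D(3)[OF p]] .
    then show ?thesis using 0 by (simp add: hgt_0)
  next
    case (Suc k')
    have "fst (padr k p) < q" using adr_bounds(1)[OF NP_D(3)[OF p]] .
    then show ?thesis using Suc map_hgt_merged[of "fst (padr k p)" k'] hgt_Suc[of "fst (padr k p)" k']
      by (simp add: lvl_height_eq del: sig.simps)
  qed
  show "0 < lvl_height k i" if p: "p \<in> NP" and i: "i \<in> set (lvl_chi k (lvl_vtx (Suc k) p))" for p k i
  proof (cases k)
    case (Suc k')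
    have "fst (padr k p) < q" using adr_bounds(1)[OF NP_D(3)[OF p]] .
    then have "i < q" using merged_less[of "fst (padr k p)" k'] i Suc by auto
    then show ?thesis using Suc S.return_time_ge1[of i k'] by simp
  qed simp
  show "lvl_flr k p < lvl_height k (lvl_vtx k p)" if "p \<in> NP" for p k
    using adr_bounds(2)[OF NP_D(3)[OF that]] by (cases k) auto
  show "\<exists>m<length (lvl_chi k (lvl_vtx (Suc k) p)). lvl_vtx k p = lvl_chi k (lvl_vtx (Suc k) p) ! m \<and>
      lvl_flr (Suc k) p = offset (map (lvl_height k) (lvl_chi k (lvl_vtx (Suc k) p))) m + lvl_flr k p"
    if p: "p \<in> NP" for p k
  proof (cases k)
    case 0
    have "fst (padr 0 p) < q" "snd (padr 0 p) < hgt 0 (fst (padr 0 p))"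
      using adr_bounds[OF NP_D(3)[OF p, of 0]] by blast+
    then show ?thesis using 0 by (simp add: hgt_0)
  next
    case (Suc k')
    obtain m where "m < length (merged k' (fst (padr (Suc k') p)))"
      "fst (adr k' (pcell (Suc k') p div 2)) = merged k' (fst (padr (Suc k') p)) ! m"
      "snd (padr (Suc k') p) = offset (map (hgt k') (merged k' (fst (padr (Suc k') p)))) m + snd (adr k' (pcell (Suc k') p div 2))"
      using adr_down[OF NP_D(3)[OF p, of "Suc k'"]] by metis
    then show ?thesis unfolding Suc lvl_simps lvl_height_eq pcell_Suc_div[OF NP_D(2)[OF p]] by blast
  qed
  show "lvl_vtx k (Phi p) = lvl_vtx k p \<and> lvl_flr k (Phi p) = Suc (lvl_flr k p)"
    if "p \<in> NP" "Suc (lvl_flr k p) < lvl_height k (lvl_vtx k p)" for p k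
    using padr_Phi_up(1)[OF NP_D(1,3)[OF that(1)]] that(2) by (cases k) auto
  show "lvl_flr k (Phi p) = 0" if "p \<in> NP" "Suc (lvl_flr k p) = lvl_height k (lvl_vtx k p)" for p k
    using padr_Phi_top(1)[OF NP_D(1,3)[OF that(1)]] that(2) by (cases k) auto
  show "\<exists>p'\<in>NP. lvl_vtx k p' = lvl_vtx k p \<and> lvl_flr k p' = s" if "p \<in> NP" "s < lvl_height k (lvl_vtx k p)" for p s k
  proof (cases k)
    case (Suc k')
    then show ?thesis using padr_fill[OF that(1), of s k'] that(2) by (metis fst_conv snd_conv lvl_simps(2,4,6))
  qed (use that in auto)
  show "p = p'" if "p \<in> NP" "p' \<in> NP" "\<And>k. lvl_vtx k p = lvl_vtx k p'" "\<And>k. lvl_flr k p = lvl_flr k p'" for p p'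
    using padr_sep[OF that(1,2)] that(3)[of "Suc k" for k] that(4)[of "Suc k" for k] by (simp add: prod_eq_iff)
  show "\<exists>p\<in>NP. \<forall>k. lvl_vtx k p = lvl_vtx k (x k) \<and> lvl_flr k p = lvl_flr k (x k)"
    if x: "\<And>k. x k \<in> NP" and 1: "\<And>k. lvl_vtx k (x (Suc k)) = lvl_vtx k (x k)"
      and 2: "\<And>k. lvl_flr k (x (Suc k)) = lvl_flr k (x k)" for x
  proof -
    have "\<exists>p\<in>NP. \<forall>k. padr k p = padr k (x (Suc k))"
      by (rule padr_realize) (use x 1[of "Suc k" for k] 2[of "Suc k" for k] in \<open>auto simp: prod_eq_iff\<close>)
    then obtain p where p: "p \<in> NP" "\<And>k. padr k p = padr k (x (Suc k))" by blast
    have "lvl_vtx k p = lvl_vtx k (x k) \<and> lvl_flr k p = lvl_flr k (x k)" for k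
      using p(2) by (cases k) auto
    then show ?thesis using p(1) by blast
  qed
  show "\<exists>n\<ge>k. \<forall>p\<in>NP. \<forall>p'\<in>NP. lvl_flr n p = 0 \<longrightarrow> lvl_flr n p' = 0 \<longrightarrow> lvl_vtx k p = lvl_vtx k p'" for k
  proof (cases k)
    case (Suc k')
    have z: "pcell k' p = 0" if p: "p \<in> NP" "snd (padr (k' + q) p) = 0" for p
    proof -
      obtain i s where i: "i < q" "s < hgt (k' + q) i" "pcell (k' + q) p = (sig (k' + q) ^^ s) i" "padr (k' + q) p = (block (k' + q) i, s)"
        using inT_floor[OF NP_D(3)[OF p(1)]] .
      then have "pcell (k' + q) p < q" using p(2) by simp
      then have "pcell (k' + q) p div 2 ^ q = 0" using less_pow2 by (intro div_less) (rule less_trans)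
      then show ?thesis using pcell_div[OF NP_D(2)[OF p(1)], of k' q] by simp
    qed
    show ?thesis unfolding Suc by (intro exI[of _ "Suc (k' + q)"]) (use z in auto)
  qed auto
  show "\<exists>n\<ge>k. \<forall>p\<in>NP. \<forall>p'\<in>NP. Suc (lvl_flr n p) = lvl_height n (lvl_vtx n p) \<longrightarrow>
      Suc (lvl_flr n p') = lvl_height n (lvl_vtx n p') \<longrightarrow> lvl_vtx k p = lvl_vtx k p'" for k
  proof (cases k)
    case (Suc k')
    have z: "sig k' (pcell k' p) = q - 1"
      if p: "p \<in> NP" "Suc (snd (padr (k' + q) p)) = hgt (k' + q) (fst (padr (k' + q) p))" for p
      using top_contract_q[OF padr_Phi_top(2)[OF NP_D(1,3)[OF p(1)] p(2)]] pcell_div[OF NP_D(2)[OF p(1)], of k' q] by simp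
    have "pcell k' p = pcell k' p'"
      if "p \<in> NP" "p' \<in> NP" "Suc (snd (padr (k' + q) p)) = hgt (k' + q) (fst (padr (k' + q) p))"
        "Suc (snd (padr (k' + q) p')) = hgt (k' + q) (fst (padr (k' + q) p'))" for p p'
      using z[OF that(1,3)] z[OF that(2,4)] injD[OF S.inj_g[of k']] by metis
    note same = this
    show ?thesis
      unfolding Suc
    proof (intro exI[of _ "Suc (k' + q)"] conjI ballI impI, unfold lvl_simps)
      fix p p' assume a: "p \<in> NP" "p' \<in> NP" "Suc (snd (padr (k' + q) p)) = hgt (k' + q) (fst (padr (k' + q) p))"
        "Suc (snd (padr (k' + q) p')) = hgt (k' + q) (fst (padr (k' + q) p'))"
      show "fst (padr k' p) = fst (padr k' p')" unfolding same[OF a] ..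
    qed simp
  qed auto
  show "openin (I_np_star_topology q \<pi>) U \<longleftrightarrow> U \<subseteq> NP \<and>
      (\<forall>p\<in>U. \<exists>k. \<forall>p'\<in>NP. lvl_vtx k p' = lvl_vtx k p \<and> lvl_flr k p' = lvl_flr k p \<longrightarrow> p' \<in> U)" for U
  proof -
    have "(\<exists>k. \<forall>p'\<in>NP. padr k p' = padr k p \<longrightarrow> p' \<in> U) \<longleftrightarrow>
      (\<exists>k. \<forall>p'\<in>NP. lvl_vtx k p' = lvl_vtx k p \<and> lvl_flr k p' = lvl_flr k p \<longrightarrow> p' \<in> U)" for p
    proof
      assume "\<exists>k. \<forall>p'\<in>NP. padr k p' = padr k p \<longrightarrow> p' \<in> U"
      then obtain k where "\<forall>p'\<in>NP. padr k p' = padr k p \<longrightarrow> p' \<in> U" by blast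
      then have "\<forall>p'\<in>NP. lvl_vtx (Suc k) p' = lvl_vtx (Suc k) p \<and> lvl_flr (Suc k) p' = lvl_flr (Suc k) p \<longrightarrow> p' \<in> U"
        by (simp add: prod_eq_iff)
      then show "\<exists>k. \<forall>p'\<in>NP. lvl_vtx k p' = lvl_vtx k p \<and> lvl_flr k p' = lvl_flr k p \<longrightarrow> p' \<in> U" by blast
    next
      assume "\<exists>k. \<forall>p'\<in>NP. lvl_vtx k p' = lvl_vtx k p \<and> lvl_flr k p' = lvl_flr k p \<longrightarrow> p' \<in> U"
      then obtain k where k: "\<forall>p'\<in>NP. lvl_vtx k p' = lvl_vtx k p \<and> lvl_flr k p' = lvl_flr k p \<longrightarrow> p' \<in> U" by blast
      then have "\<forall>p'\<in>NP. padr (k - 1) p' = padr (k - 1) p \<longrightarrow> p' \<in> U" by (cases k) auto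
      then show "\<exists>k. \<forall>p'\<in>NP. padr k p' = padr k p \<longrightarrow> p' \<in> U" by blast
    qed
    then show ?thesis unfolding openin_NP_iff by simp
  qed
qed

text \<open>The words depend on the state \<open>(rho k, marks k)\<close> only, of which there are finitely many.\<close>

lemma merged_preperiodic: "\<exists>k0\<ge>1. \<exists>p0\<ge>1. \<forall>k\<ge>k0. \<forall>i. lvl_chi k i = lvl_chi (k + p0) i"
proof -
  obtain a p where ap: "1 \<le> p" "\<And>k. a \<le> k \<Longrightarrow> rho k = rho (k + p) \<and> marks k = marks (k + p)"
    using states_preperiodic by blast
  have "lvl_chi k i = lvl_chi (k + p) i" if k: "Suc a \<le> k" for k i
  proof -
    obtain j where j: "k = Suc j" "a \<le> j" using k by (cases k) auto
    have "merged j i = merged (j + p) i" unfolding merged_def using ap(2)[OF j(2)] by metis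
    then show ?thesis using j(1) by simp
  qed
  moreover have "1 \<le> Suc a" by simp
  ultimately show ?thesis using ap(1) by blast
qed

end

theorem theorem5p10:
  fixes q :: nat and \<pi> :: "nat \<Rightarrow> nat"
  assumes "2 \<le> q" and "\<pi> permutes {..<q}"
  shows "\<exists>(chi :: nat \<Rightarrow> nat \<Rightarrow> nat list) (B :: (nat, nat \<times> nat) bratteli).
    (\<forall>k\<ge>1. substitution {..<q} (chi k)) \<and>
    ordered_bratteli_diagram B \<and>
    (\<exists>k0\<ge>1. \<exists>p0\<ge>1. \<forall>k\<ge>k0. \<forall>i\<in>{..<q}. chi k i = chi (k + p0) i) \<and>
    (\<exists>v0. vertices B 0 = {v0}) \<and>
    (\<forall>k\<ge>1. vertices B k \<subseteq> {..<q} \<and> vertices B k \<noteq> {}) \<and>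
    (\<forall>k\<ge>1. \<forall>i\<in>vertices B (Suc k). incoming_reads B k i (chi k i)) \<and>
    (\<exists>!e. maximal_path B e) \<and>
    (\<exists>!e. minimal_path B e) \<and>
    homeomorphic_map (path_topology B) (path_topology B) (vershik B) \<and>
    F_star q \<pi> ` I_np_star q \<pi> \<subseteq> I_np_star q \<pi> \<and>
    (\<exists>\<psi>. homeomorphic_map (I_np_star_topology q \<pi>) (path_topology B) \<psi> \<and>
         (\<forall>p\<in>I_np_star q \<pi>. \<psi> (F_star q \<pi> p) = vershik B (\<psi> p)))"
proof -
  interpret rotation_perm q \<pi> using assms by unfold_locales
  interpret C: tower_coding "I_np_star_topology q \<pi>" "F_star q \<pi>" lvl_vtx lvl_flr lvl_height lvl_chi
    by (rule tower_coding_NP)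
  show ?thesis
  proof (intro exI[of _ lvl_chi] exI[of _ C.B] conjI)
    show "\<forall>k\<ge>1. substitution {..<q} (lvl_chi k)"
    proof (intro allI impI)
      fix k :: nat assume "1 \<le> k"
      then obtain j where "k = Suc j" by (cases k) auto
      then show "substitution {..<q} (lvl_chi k)"
        using merged_less[of _ j] unfolding substitution_def by auto
    qed
    show "ordered_bratteli_diagram C.B" by (rule C.ordered_diagram)
    show "\<exists>k0\<ge>1. \<exists>p0\<ge>1. \<forall>k\<ge>k0. \<forall>i\<in>{..<q}. lvl_chi k i = lvl_chi (k + p0) i"
      using merged_preperiodic by blast
    show "\<exists>v0. vertices C.B 0 = {v0}" using C.V_0 by simp
    show "\<forall>k\<ge>1. vertices C.B k \<subseteq> {..<q} \<and> vertices C.B k \<noteq> {}"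
    proof (intro allI impI conjI)
      fix k :: nat assume "1 \<le> k"
      then obtain j where j: "k = Suc j" by (cases k) auto
      show "vertices C.B k \<subseteq> {..<q}"
        unfolding word_diagram_sel topspace_NP j using adr_bounds(1)[OF NP_D(3)] by auto
      show "vertices C.B k \<noteq> {}" unfolding word_diagram_sel topspace_NP using zero_NP by blast
    qed
    show "\<forall>k\<ge>1. \<forall>i\<in>vertices C.B (Suc k). incoming_reads C.B k i (lvl_chi k i)"
    proof (intro allI impI ballI)
      fix k i assume "i \<in> vertices C.B (Suc k)"
      then show "incoming_reads C.B k i (lvl_chi k i)"
        unfolding word_diagram_sel by (rule incoming_reads_word_diagram)
    qed
    show "\<exists>!e. maximal_path C.B e" by (rule C.ex1_maximal_path)
    show "\<exists>!e. minimal_path C.B e" by (rule C.ex1_minimal_path)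
    show "homeomorphic_map (path_topology C.B) (path_topology C.B) (vershik C.B)"
      by (rule C.homeomorphic_vershik)
    show "F_star q \<pi> ` I_np_star q \<pi> \<subseteq> I_np_star q \<pi>" using Phi_NP by blast
    show "\<exists>\<psi>. homeomorphic_map (I_np_star_topology q \<pi>) (path_topology C.B) \<psi> \<and>
        (\<forall>p\<in>I_np_star q \<pi>. \<psi> (F_star q \<pi> p) = vershik C.B (\<psi> p))"
      using C.homeomorphic_code C.vershik_code unfolding topspace_NP by metis
  qed
qed

end
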